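(* Let $k\ge1$, let $(\Omega_j,\mathcal F_j,H_j,P_j)$, $j\in\{1,\dots,k+1\}$, be projection valued measure spaces, $\Omega=\Omega_1\times\cdots\times\Omega_{k+1}$, $P=P_1\otimes\cdots\otimes P_{k+1}$, $\boldsymbol P=(P_1,\dots,P_{k+1})$. If $\varphi\in L^\infty(\Omega_1,P_1)\hat\otimes_i\cdots\hat\otimes_iL^\infty(\Omega_{k+1},P_{k+1})$, then $$\big(I^{\boldsymbol P}\varphi\big)[b]=\int_\Omega\varphi\,d(P\#b)$$ for all $b\in\mathcal S_2(H_2;H_1)\times\cdots\times\mathcal S_2(H_{k+1};H_k)$.
   Context: Hilbert spaces are complex (not assumed separable), inner products linear in the first argument. $\mathcal S_2(H;K)$ is the Hilbert space of Hilbert--Schmidt operators $H\to K$. A projection valued measure space $(\Xi,\mathcal G,K,Q)$: $(\Xi,\mathcal G)$ measurable space, $K$ Hilbert space, $Q:\mathcal G\to B(K)$ with $Q(\Xi)=\mathrm{id}_K$, $Q(G)^2=Q(G)=Q(G)^*$, countably additive in the weak operator topology. $L^\infty(\Xi,Q)$: $Q$-a.e. classes of bounded measurable functions, $\|f\|_{L^\infty(Q)}=\inf\{c\ge0:Q(|f|>c)=0\}$. For $f\in L^\infty(\Xi,Q)$, $Q(f)\in B(K)$ is given by $\langle Q(f)h,k\rangle=\int f\,dQ_{h,k}$, $Q_{h,k}(G)=\langle Q(G)h,k\rangle$. $P=P_1\otimes\cdots\otimes P_{k+1}$ is the unique projection valued measure on $(\Omega,\mathcal F)$, $\mathcal F=\mathcal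 F_1\otimes\cdots\otimes\mathcal F_{k+1}$, acting on the Hilbert space tensor product of the $H_j$, with $P(G_1\times\cdots\times G_{k+1})=P_1(G_1)\otimes\cdots\otimes P_{k+1}(G_{k+1})$. Upper integral of arbitrary $h:\Sigma\to[0,\infty]$: $\overline{\int_\Sigma}h\,d\rho=\inf\{\int\tilde h\,d\rho:h\le\tilde h\ \rho\text{-a.e.},\ \tilde h\text{ measurable}\}$. An $L^\infty_P$-integral projective decomposition of $\varphi:\Omega\to\mathbb C$: a tuple $(\Sigma,\rho,\varphi_1,\dots,\varphi_{k+1})$ with $(\Sigma,\mathcal H,\rho)$ $\sigma$-finite, $\varphi_j:\Omega_j\times\Sigma\to\mathbb C$ measurable, (i) $\varphi_j(\cdot,\sigma)\in L^\infty(\Omega_j,P_j)$; (ii) $\overline{\int_\Sigma}\prod_j\|\varphi_j(\cdot,\sigma)\|_{L^\infty(P_j)}\,\rho(d\sigma)<\infty$; (iii) $\varphi(\omega_1,\dots,\omega_{k+1})=\int_\Sigma\prod_j\varphi_j(\omega_j,\sigma)\,\rho(d\sigma)$ $P$-a.e. $L^\infty(\Omega_1,P_1)\hat\otimes_i\cdots\hat\otimes_iL^\infty(\Omega_{k+1},P_{k+1})$ is the set of $P$-a.e. classes of functions admitting such a decomposition. $(I^{\boldsymbol P}\varphi)[b]:=\int_\Sigma P_1(\varphi_1(\cdot,\sigma))\,b_1\cdots P_k(\varphi_k(\cdot,\sigma))\,b_k\,P_{k+1}(\varphi_{k+1}(\cdot,\sigma))\,\rho(d\sigma)\in B(H_{k+1};H_1)$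 for any decomposition (independent of the choice), the integral being the unique bounded operator $T$ with $\langle Th,h'\rangle=\int_\Sigma\langle F(\sigma)h,h'\rangle\,\rho(d\sigma)$ for all $h\in H_{k+1},h'\in H_1$, $F$ being the integrand. Vector measure $P\#b$: a vector measure with values in a Banach space $V$ is a norm-countably additive $\mu:\mathcal F\to V$; its semivariation is $\|\mu\|_{\mathrm{svar}}=\sup\{|\ell\circ\mu|(\Omega):\ell\in V^*,\|\ell\|\le1\}$, where $|\cdot|$ denotes total variation. By a theorem of Pavlov and Birman--Solomyak, for $b=(b_1,\dots,b_k)\in\mathcal S_2(H_2;H_1)\times\cdots\times\mathcal S_2(H_{k+1};H_k)$ there is a unique vector measure $P\#b:\mathcal F\to\mathcal S_2(H_{k+1};H_1)$ of bounded semivariation with $(P\#b)(G_1\times\cdots\times G_{k+1})=P_1(G_1)\,b_1\cdots P_k(G_k)\,b_k\,P_{k+1}(G_{k+1})$ for all $G_j\in\mathcal F_j$; it vanishes on all measurable subsets of $P$-null sets. For a vector measure $\mu$ of bounded semivariation and bounded measurable $\varphi$, $\int_\Omega\varphi\,d\mu\in V$ is the uniform-norm continuous linear extension of $\int1_G\,d\mu=\mu(G)$ from simple functions; equivalently, $\ell(\int\varphi\,d\mu)=\int\varphi\,d(\ell\circ\mu)$ for all $\ell\in V^*$. Thus $\int_\Omega\varphi\,d(P\#b)$ is well defined for $\varphi\in L^\infty(\Omega,P)$. *)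

theory Defs
  imports "HOL-Analysis.Analysis"
begin

section \<open>Complex inner product spaces and Hilbert spaces\<close>

class complex_inner = real_inner +
  fixes scaleC :: "complex \<Rightarrow> 'a \<Rightarrow> 'a" (infixr "*\<^sub>C" 75)
    and cinner :: "'a \<Rightarrow> 'a \<Rightarrow> complex"
  assumes scaleC_add_right: "a *\<^sub>C (x + y) = a *\<^sub>C x + a *\<^sub>C y"
    and scaleC_add_left: "(a + b) *\<^sub>C x = a *\<^sub>C x + b *\<^sub>C x"
    and scaleC_scaleC: "a *\<^sub>C b *\<^sub>C x = (a * b) *\<^sub>C x"
    and scaleR_scaleC: "r *\<^sub>R x = complex_of_real r *\<^sub>C x"
    and cinner_commute: "cinner x y = cnj (cinner y x)"
    and cinner_add_left: "cinner (x + y) z = cinner x z + cinner y z"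
    and cinner_scaleC_left: "cinner (a *\<^sub>C x) y = a * cinner x y"
    and inner_cinner: "inner x y = Re (cinner x y)"

instantiation complex :: complex_inner
begin
definition "scaleC_complex (a :: complex) (x :: complex) = a * x"
definition "cinner_complex (x :: complex) (y :: complex) = x * cnj y"
instance
  by standard
    (auto simp: scaleC_complex_def cinner_complex_def algebra_simps inner_complex_def
      scaleR_conv_of_real)
end

definition csubspace :: "'a::complex_inner set \<Rightarrow> bool" where
  "csubspace S \<longleftrightarrow>
     0 \<in> S \<and> (\<forall>x\<in>S. \<forall>y\<in>S. x + y \<in> S) \<and> (\<forall>c. \<forall>x\<in>S. c *\<^sub>C x \<in> S)"

text \<open>
  A Hilbert space is a complete complex-linear subspace of some inner product space. The carrier
  makes it possible to speak about families of Hilbert spaces of variable length. There is no loss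
  of generality, since a finite family of Hilbert spaces embeds isometrically into its direct sum;
  no relation between the members of a family is assumed (they may overlap or coincide).
\<close>

definition hilbert_space :: "'a::complex_inner set \<Rightarrow> bool" where
  "hilbert_space H \<longleftrightarrow> csubspace H \<and> complete H"

definition onb :: "'a::complex_inner set \<Rightarrow> 'a set \<Rightarrow> bool" where
  "onb H E \<longleftrightarrow> E \<subseteq> H \<and> (\<forall>e\<in>E. norm e = 1) \<and> (\<forall>e\<in>E. \<forall>f\<in>E. e \<noteq> f \<longrightarrow> cinner e f = 0) \<and>
     H \<subseteq> closure (csubspace hull E)"

definition some_onb :: "'a::complex_inner set \<Rightarrow> 'a set" where
  "some_onb H = (SOME E. onb H E)"


section \<open>Bounded and Hilbert--Schmidt operators\<close>

text \<open>
  An operator from \<open>H\<close> to \<open>K\<close> is represented by the function on the ambient type that takes the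
  value 0 off \<open>H\<close>. So two operators are equal iff they are equal as functions, linear combinations
  of operators are formed pointwise, and products of operators are compositions.
\<close>

definition bounded_ops :: "'a::complex_inner set \<Rightarrow> 'b::complex_inner set \<Rightarrow> ('a \<Rightarrow> 'b) set" where
  "bounded_ops H K = {T.
     (\<forall>x\<in>H. T x \<in> K) \<and> (\<forall>x. x \<notin> H \<longrightarrow> T x = 0) \<and>
     (\<forall>x\<in>H. \<forall>y\<in>H. T (x + y) = T x + T y) \<and>
     (\<forall>c. \<forall>x\<in>H. T (c *\<^sub>C x) = c *\<^sub>C T x) \<and>
     (\<exists>B. \<forall>x\<in>H. norm (T x) \<le> B * norm x)}"

definition id_op :: "'a::complex_inner set \<Rightarrow> 'a \<Rightarrow> 'a" where
  "id_op H = (\<lambda>x. if x \<in> H then x else 0)"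

definition zero_op :: "'a \<Rightarrow> 'b::complex_inner" where
  "zero_op = (\<lambda>x. 0)"

text \<open>The sum of \<open>\<parallel>T e\<parallel>\<^sup>2\<close> does not depend on the orthonormal basis of \<open>H\<close>.\<close>

definition hilbert_schmidt :: "'a::complex_inner set \<Rightarrow> 'b::complex_inner set \<Rightarrow> ('a \<Rightarrow> 'b) set" where
  "hilbert_schmidt H K = {T \<in> bounded_ops H K. (\<lambda>e. (norm (T e))\<^sup>2) summable_on some_onb H}"

definition hs_norm :: "'a::complex_inner set \<Rightarrow> ('a \<Rightarrow> 'b::complex_inner) \<Rightarrow> real" where
  "hs_norm H T = sqrt (\<Sum>\<^sub>\<infinity>e\<in>some_onb H. (norm (T e))\<^sup>2)"


section \<open>Integration with respect to complex measures\<close>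

text \<open>
  Only the underlying measurable space of a parameter named \<open>M\<close> is used.

  The integral of \<open>f\<close> with respect to a complex measure \<open>\<nu>\<close> is computed from a decomposition
  \<open>\<nu> = m\<^sub>0 + \<i> m\<^sub>1 - m\<^sub>2 - \<i> m\<^sub>3\<close> into finite positive measures such as the Jordan decomposition
  of its real and imaginary part; its value does not depend on the decomposition.
\<close>

definition has_cmeasure_integral ::
    "'w measure \<Rightarrow> ('w set \<Rightarrow> complex) \<Rightarrow> ('w \<Rightarrow> complex) \<Rightarrow> complex \<Rightarrow> bool" where
  "has_cmeasure_integral M \<nu> f I \<longleftrightarrow>
     (\<exists>m :: nat \<Rightarrow> 'w measure.
        (\<forall>i<4. finite_measure (m i) \<and> sets (m i) = sets M \<and> integrable (m i) f) \<and>
        (\<forall>G\<in>sets M. \<nu> G = (\<Sum>i<4. \<i> ^ i * complex_of_real (measure (m i) G))) \<and>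
        I = (\<Sum>i<4. \<i> ^ i * (\<integral>x. f x \<partial>m i)))"

definition cmeasure_integral ::
    "'w measure \<Rightarrow> ('w set \<Rightarrow> complex) \<Rightarrow> ('w \<Rightarrow> complex) \<Rightarrow> complex" where
  "cmeasure_integral M \<nu> f = (THE I. has_cmeasure_integral M \<nu> f I)"

definition total_variation :: "'w measure \<Rightarrow> ('w set \<Rightarrow> complex) \<Rightarrow> ennreal" where
  "total_variation M \<nu> =
     (SUP \<pi> \<in> {\<pi>. finite \<pi> \<and> \<pi> \<subseteq> sets M \<and> disjoint \<pi> \<and> \<Union>\<pi> = space M}.
        \<Sum>G\<in>\<pi>. ennreal (cmod (\<nu> G)))"


section \<open>Projection valued measures\<close>

definition pvm_space ::
    "'w measure \<Rightarrow> 'a::complex_inner set \<Rightarrow> ('w set \<Rightarrow> 'a \<Rightarrow> 'a) \<Rightarrow> bool" where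
  "pvm_space M K Q \<longleftrightarrow>
     hilbert_space K \<and>
     (\<forall>G\<in>sets M. Q G \<in> bounded_ops K K) \<and>
     Q (space M) = id_op K \<and>
     (\<forall>G\<in>sets M. Q G \<circ> Q G = Q G) \<and>
     (\<forall>G\<in>sets M. \<forall>h\<in>K. \<forall>k\<in>K. cinner (Q G h) k = cinner h (Q G k)) \<and>
     (\<forall>A :: nat \<Rightarrow> 'w set. range A \<subseteq> sets M \<and> disjoint_family A \<longrightarrow>
        (\<forall>h\<in>K. \<forall>k\<in>K. (\<lambda>n. cinner (Q (A n) h) k) sums cinner (Q (\<Union>n. A n) h) k))"

definition pvm_AE ::
    "'w measure \<Rightarrow> ('w set \<Rightarrow> 'a \<Rightarrow> 'a::complex_inner) \<Rightarrow> ('w \<Rightarrow> bool) \<Rightarrow> bool" where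
  "pvm_AE M Q R \<longleftrightarrow> (\<exists>N\<in>sets M. Q N = zero_op \<and> {x \<in> space M. \<not> R x} \<subseteq> N)"

definition Linf ::
    "'w measure \<Rightarrow> ('w set \<Rightarrow> 'a \<Rightarrow> 'a::complex_inner) \<Rightarrow> ('w \<Rightarrow> complex) set" where
  "Linf M Q = {f \<in> borel_measurable M. \<exists>c\<ge>0. Q {x \<in> space M. cmod (f x) > c} = zero_op}"

definition Linf_norm ::
    "'w measure \<Rightarrow> ('w set \<Rightarrow> 'a \<Rightarrow> 'a::complex_inner) \<Rightarrow> ('w \<Rightarrow> complex) \<Rightarrow> real" where
  "Linf_norm M Q f = Inf {c. c \<ge> 0 \<and> Q {x \<in> space M. cmod (f x) > c} = zero_op}"

definition pvm_integral ::
    "'w measure \<Rightarrow> 'a::complex_inner set \<Rightarrow> ('w set \<Rightarrow> 'a \<Rightarrow> 'a) \<Rightarrow> ('w \<Rightarrow> complex) \<Rightarrow> 'a \<Rightarrow> 'a" where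
  "pvm_integral M K Q f =
     (THE T. T \<in> bounded_ops K K \<and>
        (\<forall>h\<in>K. \<forall>k\<in>K. cinner (T h) k = cmeasure_integral M (\<lambda>G. cinner (Q G h) k) f))"

text \<open>
  \<open>(T, \<tau>)\<close> is a Hilbert space tensor product of the family \<open>(H j)\<^sub>j\<close>, with \<open>\<tau> x\<close> the
  elementary tensor of \<open>x\<close>. The formula for the inner product forces \<open>\<tau>\<close> to be multilinear and,
  together with density, determines \<open>(T, \<tau>)\<close> up to a unique unitary.
\<close>

definition hilbert_tensor ::
    "'i set \<Rightarrow> ('i \<Rightarrow> 'a::complex_inner set) \<Rightarrow> 't::complex_inner set \<Rightarrow> (('i \<Rightarrow> 'a) \<Rightarrow> 't) \<Rightarrow> bool" where
  "hilbert_tensor J H T \<tau> \<longleftrightarrow>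
     hilbert_space T \<and>
     (\<forall>x\<in>PiE J H. \<forall>y\<in>PiE J H. cinner (\<tau> x) (\<tau> y) = (\<Prod>j\<in>J. cinner (x j) (y j))) \<and>
     closure (csubspace hull (\<tau> ` PiE J H)) = T"

definition tensor_pvm ::
    "'i set \<Rightarrow> ('i \<Rightarrow> 'w measure) \<Rightarrow> ('i \<Rightarrow> 'a::complex_inner set) \<Rightarrow> ('i \<Rightarrow> 'w set \<Rightarrow> 'a \<Rightarrow> 'a) \<Rightarrow>
     't::complex_inner set \<Rightarrow> (('i \<Rightarrow> 'a) \<Rightarrow> 't) \<Rightarrow> (('i \<Rightarrow> 'w) set \<Rightarrow> 't \<Rightarrow> 't) \<Rightarrow> bool" where
  "tensor_pvm J M H P T \<tau> PT \<longleftrightarrow>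
     hilbert_tensor J H T \<tau> \<and>
     pvm_space (PiM J M) T PT \<and>
     (\<forall>G\<in>(\<Pi> j\<in>J. sets (M j)). \<forall>x\<in>PiE J H.
        PT (PiE J G) (\<tau> x) = \<tau> (\<lambda>j\<in>J. P j (G j) (x j)))"


section \<open>Integral projective decompositions and multiple operator integrals\<close>

definition upper_nn_integral :: "'s measure \<Rightarrow> ('s \<Rightarrow> ennreal) \<Rightarrow> ennreal" where
  "upper_nn_integral \<rho> h =
     (INF g \<in> {g \<in> borel_measurable \<rho>. AE s in \<rho>. h s \<le> g s}. \<integral>\<^sup>+ s. g s \<partial>\<rho>)"

text \<open>
  The condition on the upper integral implies that the integrand in the last condition is
  \<open>\<rho>\<close>-integrable for almost every \<open>x\<close>.
\<close>

definition integral_decomposition ::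
    "'i set \<Rightarrow> ('i \<Rightarrow> 'w measure) \<Rightarrow> ('i \<Rightarrow> 'w set \<Rightarrow> 'a \<Rightarrow> 'a::complex_inner) \<Rightarrow>
     (('i \<Rightarrow> 'w) set \<Rightarrow> 't \<Rightarrow> 't::complex_inner) \<Rightarrow> (('i \<Rightarrow> 'w) \<Rightarrow> complex) \<Rightarrow>
     's measure \<Rightarrow> ('i \<Rightarrow> 'w \<times> 's \<Rightarrow> complex) \<Rightarrow> bool" where
  "integral_decomposition J M P PT \<phi> \<rho> \<Phi> \<longleftrightarrow>
     sigma_finite_measure \<rho> \<and>
     (\<forall>j\<in>J. \<Phi> j \<in> borel_measurable (M j \<Otimes>\<^sub>M \<rho>)) \<and>
     (\<forall>j\<in>J. \<forall>s\<in>space \<rho>. (\<lambda>x. \<Phi> j (x, s)) \<in> Linf (M j) (P j)) \<and>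
     upper_nn_integral \<rho> (\<lambda>s. \<Prod>j\<in>J. ennreal (Linf_norm (M j) (P j) (\<lambda>x. \<Phi> j (x, s)))) < \<infinity> \<and>
     pvm_AE (PiM J M) PT (\<lambda>x. \<phi> x = (\<integral>s. (\<Prod>j\<in>J. \<Phi> j (x j, s)) \<partial>\<rho>))"

text \<open>\<open>op_chain k A b\<close> is the product \<open>A\<^sub>1 b\<^sub>1 A\<^sub>2 b\<^sub>2 \<dots> A\<^sub>k b\<^sub>k A\<^sub>k\<^sub>+\<^sub>1\<close>.\<close>

fun op_chain :: "nat \<Rightarrow> (nat \<Rightarrow> 'a \<Rightarrow> 'a) \<Rightarrow> (nat \<Rightarrow> 'a \<Rightarrow> 'a) \<Rightarrow> 'a \<Rightarrow> 'a" where
  "op_chain 0 A b = A 1"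
| "op_chain (Suc n) A b = op_chain n A b \<circ> b (Suc n) \<circ> A (Suc (Suc n))"

definition weak_op_integral ::
    "'a::complex_inner set \<Rightarrow> 'b::complex_inner set \<Rightarrow> 's measure \<Rightarrow> ('s \<Rightarrow> 'a \<Rightarrow> 'b) \<Rightarrow> 'a \<Rightarrow> 'b" where
  "weak_op_integral H K \<rho> F =
     (THE T. T \<in> bounded_ops H K \<and>
        (\<forall>h\<in>H. \<forall>h'\<in>K. integrable \<rho> (\<lambda>s. cinner (F s h) h') \<and>
           cinner (T h) h' = (\<integral>s. cinner (F s h) h' \<partial>\<rho>)))"

definition multiple_op_integral ::
    "nat \<Rightarrow> (nat \<Rightarrow> 'w measure) \<Rightarrow> (nat \<Rightarrow> 'a::complex_inner set) \<Rightarrow> (nat \<Rightarrow> 'w set \<Rightarrow> 'a \<Rightarrow> 'a) \<Rightarrow>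
     's measure \<Rightarrow> (nat \<Rightarrow> 'w \<times> 's \<Rightarrow> complex) \<Rightarrow> (nat \<Rightarrow> 'a \<Rightarrow> 'a) \<Rightarrow> 'a \<Rightarrow> 'a" where
  "multiple_op_integral k M H P \<rho> \<Phi> b =
     weak_op_integral (H (k + 1)) (H 1) \<rho>
       (\<lambda>s. op_chain k (\<lambda>j. pvm_integral (M j) (H j) (P j) (\<lambda>x. \<Phi> j (x, s))) b)"


section \<open>Vector measures with values in a space of Hilbert--Schmidt operators\<close>

definition hs_vector_measure ::
    "'w measure \<Rightarrow> 'a::complex_inner set \<Rightarrow> 'b::complex_inner set \<Rightarrow> ('w set \<Rightarrow> 'a \<Rightarrow> 'b) \<Rightarrow> bool" where
  "hs_vector_measure M H K \<mu> \<longleftrightarrow>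
     (\<forall>G\<in>sets M. \<mu> G \<in> hilbert_schmidt H K) \<and>
     (\<forall>A :: nat \<Rightarrow> 'w set. range A \<subseteq> sets M \<and> disjoint_family A \<longrightarrow>
        (\<lambda>n. hs_norm H (\<lambda>x. (\<Sum>i<n. \<mu> (A i) x) - \<mu> (\<Union>i. A i) x)) \<longlonglongrightarrow> 0)"

definition hs_dual_ball ::
    "'a::complex_inner set \<Rightarrow> 'b::complex_inner set \<Rightarrow> (('a \<Rightarrow> 'b) \<Rightarrow> complex) set" where
  "hs_dual_ball H K = {l.
     (\<forall>A\<in>hilbert_schmidt H K. \<forall>B\<in>hilbert_schmidt H K. l (\<lambda>x. A x + B x) = l A + l B) \<and>
     (\<forall>c. \<forall>A\<in>hilbert_schmidt H K. l (\<lambda>x. c *\<^sub>C A x) = c * l A) \<and>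
     (\<forall>A\<in>hilbert_schmidt H K. cmod (l A) \<le> hs_norm H A)}"

definition semivariation ::
    "'w measure \<Rightarrow> 'a::complex_inner set \<Rightarrow> 'b::complex_inner set \<Rightarrow> ('w set \<Rightarrow> 'a \<Rightarrow> 'b) \<Rightarrow> ennreal" where
  "semivariation M H K \<mu> = (SUP l \<in> hs_dual_ball H K. total_variation M (\<lambda>G. l (\<mu> G)))"

text \<open>\<open>\<mu>\<close> is the vector measure \<open>P#b\<close>, which these properties determine on the product sigma-algebra.\<close>

definition is_sharp ::
    "nat \<Rightarrow> (nat \<Rightarrow> 'w measure) \<Rightarrow> (nat \<Rightarrow> 'a::complex_inner set) \<Rightarrow> (nat \<Rightarrow> 'w set \<Rightarrow> 'a \<Rightarrow> 'a) \<Rightarrow>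
     (nat \<Rightarrow> 'a \<Rightarrow> 'a) \<Rightarrow> ((nat \<Rightarrow> 'w) set \<Rightarrow> 'a \<Rightarrow> 'a) \<Rightarrow> bool" where
  "is_sharp k M H P b \<mu> \<longleftrightarrow>
     hs_vector_measure (PiM {1..k+1} M) (H (k + 1)) (H 1) \<mu> \<and>
     semivariation (PiM {1..k+1} M) (H (k + 1)) (H 1) \<mu> < \<infinity> \<and>
     (\<forall>G\<in>(\<Pi> j\<in>{1..k+1}. sets (M j)). \<mu> (PiE {1..k+1} G) = op_chain k (\<lambda>j. P j (G j)) b)"

definition simple_vector_integral ::
    "'w measure \<Rightarrow> ('w set \<Rightarrow> 'a \<Rightarrow> 'b::complex_inner) \<Rightarrow> ('w \<Rightarrow> complex) \<Rightarrow> 'a \<Rightarrow> 'b" where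
  "simple_vector_integral M \<mu> s = (\<lambda>x. \<Sum>z\<in>s ` space M. z *\<^sub>C \<mu> (s -` {z} \<inter> space M) x)"

text \<open>For bounded measurable \<open>f\<close>: the continuous extension, in the uniform norm, from simple functions.\<close>

definition bounded_vector_integral ::
    "'w measure \<Rightarrow> 'a::complex_inner set \<Rightarrow> 'b::complex_inner set \<Rightarrow> ('w set \<Rightarrow> 'a \<Rightarrow> 'b) \<Rightarrow>
     ('w \<Rightarrow> complex) \<Rightarrow> 'a \<Rightarrow> 'b" where
  "bounded_vector_integral M H K \<mu> f =
     (THE T. T \<in> hilbert_schmidt H K \<and>
        (\<forall>s :: nat \<Rightarrow> 'w \<Rightarrow> complex.
           (\<forall>n. simple_function M (s n)) \<and> uniform_limit (space M) s f sequentially \<longrightarrow>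
           (\<lambda>n. hs_norm H (\<lambda>x. simple_vector_integral M \<mu> (s n) x - T x)) \<longlonglongrightarrow> 0))"

text \<open>
  The integral of an element of \<open>L\<^sup>\<infinity>(Q)\<close>, given by an arbitrary member \<open>f\<close> of its \<open>Q\<close>-a.e. class,
  is that of any bounded measurable representative.
\<close>

definition vector_integral ::
    "'w measure \<Rightarrow> ('w set \<Rightarrow> 't \<Rightarrow> 't::complex_inner) \<Rightarrow> 'a::complex_inner set \<Rightarrow>
     'b::complex_inner set \<Rightarrow> ('w set \<Rightarrow> 'a \<Rightarrow> 'b) \<Rightarrow> ('w \<Rightarrow> complex) \<Rightarrow> 'a \<Rightarrow> 'b" where
  "vector_integral M Q H K \<mu> f =
     bounded_vector_integral M H K \<mu>
       (SOME g. g \<in> borel_measurable M \<and> bounded (g ` space M) \<and> pvm_AE M Q (\<lambda>x. g x = f x))"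

end

theory Submission imports Defs begin

text \<open>
  Fix \<open>h\<close>, \<open>h'\<close> and let \<open>\<nu> = \<langle>(P#b)(\<cdot>) h, h'\<rangle>\<close>. Replacing the indicator functions in the formula for
  \<open>\<nu>\<close> on rectangles by bounded functions, one factor at a time, shows that
  \<open>\<langle>P\<^sub>1(f\<^sub>1) b\<^sub>1 \<cdots> b\<^sub>k P\<^sub>k\<^sub>+\<^sub>1(f\<^sub>k\<^sub>+\<^sub>1) h, h'\<rangle>\<close> is the \<open>\<nu>\<close>-integral of \<open>f\<^sub>1 \<otimes> \<cdots> \<otimes> f\<^sub>k\<^sub>+\<^sub>1\<close>, which also
  gives the measurability of the integrand of \<open>I\<^sup>P\<phi>\<close> without any separability. The theorem is then
  Fubini's theorem for \<open>\<nu>\<close> and \<open>\<rho>\<close>, since \<open>\<nu>\<close> vanishes on \<open>P\<close>-null sets. For the latter, the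
  Hilbert--Schmidt operators are truncated to finite rank. Then \<open>\<nu>\<close> becomes a finite combination of
  measures \<open>\<langle>P(\<cdot>) \<xi>, \<eta>\<rangle>\<close>, and the error is small uniformly on all measurable sets: on unions of
  cells of a grid of rectangles it is bounded by a product of matrices of block norms of the \<open>b\<^sub>j\<close>,
  one of which has a small Hilbert--Schmidt norm.
\<close>

section \<open>Complex inner product spaces\<close>

text \<open>The hard point is absolute continuity: \<open>is_sharp\<close> prescribes
  \<open>\<mu>\<close> only on rectangles, and smallness on rectangles says nothing about a general
  product-measurable set. Smallness on finite unions of cells does, because these unions form a
  generating algebra that is dense for every finite measure; hence the estimates are absolute sums
  over all cells of a grid. Such sums stay bounded independently of the grid because disjoint
  projections are square summable on each vector and the block norms of a Hilbert-Schmidt operator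
  are square summable, so that Cauchy-Schwarz applies at every link of the chain. Finite rank is
  what makes contact with \<open>PT\<close>: it cuts the chain into one scalar coefficient per
  factor, and their product is a coefficient of \<open>PT\<close> between elementary tensors.

  Operators are compared through their coefficients, and each resulting complex measure is split
  into four finite positive measures, to which dominated convergence and Fubini's theorem apply
  separately. Functions in \<open>Linf\<close> are bounded only off null sets, hence the truncations
  at the essential norm.\<close>

lemma scaleC_zero_left [simp]: "0 *\<^sub>C (x::'a::complex_inner) = 0"
  using scaleR_scaleC[of 0 x] by simp

lemma scaleC_zero_right [simp]: "a *\<^sub>C (0::'a::complex_inner) = 0"
  using scaleC_add_right[of a 0 0] by simp

lemma scaleC_one [simp]: "1 *\<^sub>C (x::'a::complex_inner) = x"
  using scaleR_scaleC[of 1 x] by simp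

lemma scaleC_minus1: "(-1) *\<^sub>C (x::'a::complex_inner) = - x"
  using scaleR_scaleC[of "-1" x] by simp

lemma scaleC_sum_right: "a *\<^sub>C (\<Sum>i\<in>I. f i) = (\<Sum>i\<in>I. a *\<^sub>C (f i :: 'a::complex_inner))"
  by (induction I rule: infinite_finite_induct) (auto simp: scaleC_add_right)

lemma cinner_add_right: "cinner x (y + z) = cinner x y + cinner x (z::'a::complex_inner)"
  by (subst (1 2 3) cinner_commute) (simp add: cinner_add_left)

lemma cinner_scaleC_right: "cinner x (a *\<^sub>C y) = cnj a * cinner x (y::'a::complex_inner)"
  by (subst (1 2) cinner_commute) (simp add: cinner_scaleC_left)

lemma cinner_zero_left [simp]: "cinner 0 (y::'a::complex_inner) = 0"
  using cinner_add_left[of 0 0 y] by simp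

lemma cinner_zero_right [simp]: "cinner (y::'a::complex_inner) 0 = 0"
  using cinner_add_right[of y 0 0] by simp

lemma cinner_minus_left: "cinner (- x) (y::'a::complex_inner) = - cinner x y"
  using cinner_add_left[of x "-x" y] by (simp add: add_eq_0_iff)

lemma cinner_minus_right: "cinner x (- y) = - cinner x (y::'a::complex_inner)"
  using cinner_add_right[of x y "-y"] by (simp add: add_eq_0_iff)

lemma cinner_diff_left: "cinner (x - y) z = cinner x z - cinner y (z::'a::complex_inner)"
  using cinner_add_left[of x "-y" z] by (simp add: cinner_minus_left)

lemma cinner_diff_right: "cinner x (y - z) = cinner x y - cinner x (z::'a::complex_inner)"
  using cinner_add_right[of x y "-z"] by (simp add: cinner_minus_right)

lemma cinner_sum_left: "cinner (\<Sum>i\<in>I. f i) y = (\<Sum>i\<in>I. cinner (f i) (y::'a::complex_inner))"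
  by (induction I rule: infinite_finite_induct) (auto simp: cinner_add_left)

lemma cinner_sum_right: "cinner y (\<Sum>i\<in>I. f i) = (\<Sum>i\<in>I. cinner (y::'a::complex_inner) (f i))"
  by (induction I rule: infinite_finite_induct) (auto simp: cinner_add_right)

lemma cinner_self: "cinner x x = complex_of_real ((norm (x::'a::complex_inner))\<^sup>2)"
proof -
  have "Im (cinner x x) = 0"
    using arg_cong[OF cinner_commute[of x x], of Im] by simp
  moreover have "Re (cinner x x) = (norm x)\<^sup>2"
    by (simp add: inner_cinner[symmetric] power2_norm_eq_inner)
  ultimately show ?thesis by (simp add: complex_eq_iff)
qed

lemma norm_scaleC: "norm (a *\<^sub>C (x::'a::complex_inner)) = cmod a * norm x"
proof -
  have "complex_of_real ((norm (a *\<^sub>C x))\<^sup>2) = complex_of_real ((cmod a * norm x)\<^sup>2)"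
    unfolding cinner_self[symmetric] cinner_scaleC_left cinner_scaleC_right
    by (simp add: cinner_self complex_norm_square power_mult_distrib mult.assoc mult.left_commute
        del: of_real_power)
  then have "(norm (a *\<^sub>C x))\<^sup>2 = (cmod a * norm x)\<^sup>2" by (simp only: of_real_eq_iff)
  then show ?thesis by (simp add: power2_eq_iff_nonneg)
qed

lemma Cauchy_Schwarz_cinner: "cmod (cinner x y) \<le> norm x * norm (y::'a::complex_inner)"
proof (cases "cinner x y = 0")
  case False
  \<comment> \<open>This phase makes \<open>cinner (a *\<^sub>C x) y\<close> real and nonnegative,
    so that it equals the real inner product.\<close>
  define a where "a = cnj (sgn (cinner x y))"
  have a: "cmod a = 1" using False by (simp add: a_def norm_sgn)
  have "a * cinner x y = cmod (cinner x y)"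
    using False complex_norm_square[of "cinner x y"]
    by (simp add: a_def sgn_eq field_simps power2_eq_square)
  then have "cmod (cinner x y) = Re (cinner (a *\<^sub>C x) y)"
    by (simp add: cinner_scaleC_left)
  also have "\<dots> = inner (a *\<^sub>C x) y" by (simp add: inner_cinner)
  also have "\<dots> \<le> norm (a *\<^sub>C x) * norm y" by (rule norm_cauchy_schwarz)
  finally show ?thesis using a by (simp add: norm_scaleC)
qed auto

lemma bounded_bilinear_scaleC: "bounded_bilinear (scaleC :: complex \<Rightarrow> 'a::complex_inner \<Rightarrow> 'a)"
proof
  show "\<exists>K. \<forall>a. \<forall>b::'a. norm (a *\<^sub>C b) \<le> norm a * norm b * K"
    by (intro exI[of _ 1]) (auto simp: norm_scaleC)
qed (auto simp: scaleC_add_right scaleC_add_left scaleR_scaleC scaleC_scaleC scaleC_complex_def mult.commute)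

lemmas tendsto_scaleC = bounded_bilinear.tendsto[OF bounded_bilinear_scaleC]

section \<open>Subspaces, the Riesz representation theorem and orthonormal bases\<close>

lemma csubspaceD:
  assumes "csubspace (S::'a::complex_inner set)"
  shows "0 \<in> S" "x \<in> S \<Longrightarrow> y \<in> S \<Longrightarrow> x + y \<in> S" "x \<in> S \<Longrightarrow> c *\<^sub>C x \<in> S"
    "x \<in> S \<Longrightarrow> r *\<^sub>R x \<in> S" "x \<in> S \<Longrightarrow> - x \<in> S" "x \<in> S \<Longrightarrow> y \<in> S \<Longrightarrow> x - y \<in> S"
proof -
  have sc: "c *\<^sub>C x \<in> S" if "x \<in> S" for c x using assms that by (auto simp: csubspace_def)
  have ad: "x + y \<in> S" if "x \<in> S" "y \<in> S" for x y using assms that by (auto simp: csubspace_def)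
  have mi: "- x \<in> S" if "x \<in> S" for x using sc[OF that, of "-1"] by (simp add: scaleC_minus1)
  show "0 \<in> S" "x \<in> S \<Longrightarrow> y \<in> S \<Longrightarrow> x + y \<in> S" "x \<in> S \<Longrightarrow> c *\<^sub>C x \<in> S"
    "x \<in> S \<Longrightarrow> r *\<^sub>R x \<in> S" "x \<in> S \<Longrightarrow> - x \<in> S"
    using assms sc ad mi by (auto simp: csubspace_def scaleR_scaleC)
  show "x \<in> S \<Longrightarrow> y \<in> S \<Longrightarrow> x - y \<in> S"
    using ad[of x "-y"] mi[of y] by simp
qed

lemma csubspace_sum:
  assumes "csubspace (S::'a::complex_inner set)" "\<And>i. i \<in> I \<Longrightarrow> f i \<in> S"
  shows "(\<Sum>i\<in>I. f i) \<in> S"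
  using assms(2) by (induction I rule: infinite_finite_induct) (auto intro: csubspaceD[OF assms(1)])

lemma hilbert_space_csubspace: "hilbert_space H \<Longrightarrow> csubspace H"
  and hilbert_space_complete: "hilbert_space H \<Longrightarrow> complete H"
  and hilbert_space_closed: "hilbert_space H \<Longrightarrow> closed H"
  by (auto simp: hilbert_space_def complete_imp_closed)

lemma parallelogram: "(norm (u - v))\<^sup>2 = 2 * (norm u)\<^sup>2 + 2 * (norm v)\<^sup>2 - (norm (u + v :: 'a::real_inner))\<^sup>2"
  by (simp add: power2_norm_eq_inner inner_simps inner_commute)

text \<open>The representing vector is found as a minimiser, which exists because minimising
  sequences are Cauchy by the parallelogram law and \<open>S\<close> is complete. Orthogonal
  projections are later obtained from this lemma, and not conversely.\<close>

lemma Riesz_representation: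
  fixes S :: "'a::complex_inner set"
  assumes S: "csubspace S" "complete S"
    and add: "\<And>x y. x \<in> S \<Longrightarrow> y \<in> S \<Longrightarrow> f (x + y) = f x + f y"
    and scale: "\<And>c x. x \<in> S \<Longrightarrow> f (c *\<^sub>C x) = c * f x"
    and bound: "\<And>x. x \<in> S \<Longrightarrow> cmod (f x) \<le> B * norm x"
  obtains u where "u \<in> S" "\<And>x. x \<in> S \<Longrightarrow> f x = cinner x u"
proof -
  note [intro] = csubspaceD[OF S(1)]
  \<comment> \<open>If \<open>f\<close> is represented by \<open>u\<close>, then \<open>J x\<close>
    is \<open>(norm (x - u))\<^sup>2 - (norm u)\<^sup>2\<close>, so \<open>u\<close> is the only
    point where the minimum can lie.\<close>
  define J where "J x = (norm x)\<^sup>2 - 2 * Re (f x)" for x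
  have Jlow: "- B\<^sup>2 \<le> J x" if "x \<in> S" for x
  proof -
    have "Re (f x) \<le> B * norm x" using bound[OF that] complex_Re_le_cmod[of "f x"] by linarith
    moreover have "0 \<le> (norm x - B)\<^sup>2" by simp
    ultimately show ?thesis unfolding J_def by (simp add: power2_diff algebra_simps)
  qed
  have bdd: "bdd_below (J ` S)" using Jlow by (intro bdd_belowI2) auto
  define I where "I = (INF x\<in>S. J x)"
  have I_le: "I \<le> J x" if "x \<in> S" for x unfolding I_def by (rule cINF_lower[OF bdd that])
  have "\<exists>x\<in>S. J x < I + 1 / real (Suc n)" for n
  proof (rule ccontr)
    assume "\<not> ?thesis"
    then have "I + 1 / real (Suc n) \<le> I" unfolding I_def using csubspaceD(1)[OF S(1)]
      by (intro cINF_greatest) (auto simp: I_def not_less)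
    moreover have "0 < 1 / real (Suc n)" by simp
    ultimately show False by linarith
  qed
  then obtain u where u: "\<And>n. u n \<in> S" "\<And>n. J (u n) < I + 1 / real (Suc n)" by metis
  \<comment> \<open>The parallelogram law at the midpoint of \<open>x\<close> and \<open>y\<close>,
    where \<open>J\<close> is at least \<open>I\<close>: two almost minimal points are close to each
    other.\<close>
  have diff: "(norm (x - y))\<^sup>2 \<le> 2 * (J x - I) + 2 * (J y - I)" if "x \<in> S" "y \<in> S" for x y
  proof -
    have "I \<le> J ((1/2) *\<^sub>R (x + y))" using that by (intro I_le) auto
    also have "\<dots> = (norm (x + y))\<^sup>2 / 4 - Re (f x) - Re (f y)"
      using that by (simp add: J_def power_mult_distrib power_divide scaleR_scaleC scale add
          csubspaceD[OF S(1)] norm_scaleC field_simps)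
    finally show ?thesis unfolding parallelogram J_def by simp
  qed
  have "Cauchy u"
  proof (rule metric_CauchyI)
    fix e :: real assume e: "e > 0"
    \<comment> \<open>Both excesses over \<open>I\<close> are below \<open>1 / N\<close> and each
      enters \<open>diff\<close> with the factor 2, which gives 4.\<close>
    then obtain N where N: "4 / e\<^sup>2 < real N" using reals_Archimedean2 by blast
    then have N0: "real N > 0" using e by (smt (verit) divide_pos_pos zero_less_power)
    have "dist (u m) (u n) < e" if mn: "m \<ge> N" "n \<ge> N" for m n
    proof -
      have *: "J (u i) - I < 1 / real N" if "i \<ge> N" for i
      proof -
        have "1 / real (Suc i) \<le> 1 / real N" using that N0 by (intro divide_left_mono) auto
        then show ?thesis using u(2)[of i] by linarith
      qed
      have "(norm (u m - u n))\<^sup>2 < 4 / real N"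
        using diff[OF u(1)[of m] u(1)[of n]] *[OF mn(1)] *[OF mn(2)] by (simp add: add_divide_distrib)
      also have "\<dots> < e\<^sup>2" using N N0 e by (simp add: field_simps)
      finally show ?thesis using e by (simp add: dist_norm power_less_imp_less_base)
    qed
    then show "\<exists>N. \<forall>m\<ge>N. \<forall>n\<ge>N. dist (u m) (u n) < e" by blast
  qed
  then obtain w where w: "w \<in> S" "u \<longlonglongrightarrow> w" using S(2) u(1) unfolding complete_def by blast
  have fdiff: "f (x - y) = f x - f y" if "x \<in> S" "y \<in> S" for x y
    using add[of x "(-1) *\<^sub>C y"] scale[of y "-1"] that
    by (auto simp: scaleC_minus1 csubspaceD[OF S(1)])
  have "(\<lambda>n. f (u n)) \<longlonglongrightarrow> f w"
  proof (rule LIM_zero_cancel, rule Lim_null_comparison)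
    show "\<forall>\<^sub>F n in sequentially. norm (f (u n) - f w) \<le> B * norm (u n - w)"
      using u(1) w(1) bound by (intro always_eventually) (simp add: fdiff[symmetric] csubspaceD[OF S(1)])
    show "(\<lambda>n. B * norm (u n - w)) \<longlonglongrightarrow> 0"
      using w(2) by (auto intro!: tendsto_mult_right_zero tendsto_norm_zero LIM_zero)
  qed
  then have "(\<lambda>n. J (u n)) \<longlonglongrightarrow> J w" unfolding J_def using w(2) by (intro tendsto_intros)
  moreover have "(\<lambda>n. I + 1 / real (Suc n)) \<longlonglongrightarrow> I + 0"
    by (intro tendsto_intros LIMSEQ_Suc[OF lim_1_over_n])
  ultimately have Jw: "J w \<le> I"
    using u(2) by (intro LIMSEQ_le[where X="\<lambda>n. J (u n)" and Y="\<lambda>n. I + 1 / real (Suc n)"]) (auto intro: less_imp_le)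
  have Re_eq: "Re (f x) = Re (cinner x w)" if x: "x \<in> S" for x
  proof -
    define d where "d = inner w x - Re (f x)"
    \<comment> \<open>Minimality of \<open>w\<close> along the line through \<open>w\<close> in
      direction \<open>x\<close>; the linear coefficient \<open>d\<close> of this quadratic in
      \<open>t\<close> must vanish.\<close>
    have q: "0 \<le> 2 * t * d + t\<^sup>2 * (norm x)\<^sup>2" for t :: real
    proof -
      have "J w \<le> J (w + t *\<^sub>R x)" using Jw I_le[of "w + t *\<^sub>R x"] w(1) x by fastforce
      moreover have "f (t *\<^sub>R x) = of_real t * f x" using x by (simp add: scaleR_scaleC scale)
      moreover have "(norm (w + t *\<^sub>R x))\<^sup>2 = (norm w)\<^sup>2 + 2 * t * inner w x + t\<^sup>2 * (norm x)\<^sup>2"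
        unfolding power2_norm_eq_inner by (simp add: inner_simps inner_commute power2_eq_square algebra_simps)
      ultimately show ?thesis using x w(1)
        by (simp add: J_def d_def add csubspaceD[OF S(1)] algebra_simps)
    qed
    have "d = 0"
    proof (rule ccontr)
      assume d: "d \<noteq> 0"
      \<comment> \<open>The quadratic would be minimal at \<open>t = - d / (norm x)\<^sup>2\<close>;
        the added 1 keeps the denominator positive when \<open>x = 0\<close>.\<close>
      define a where "a = (norm x)\<^sup>2 + 1"
      have a: "a > 0" "(norm x)\<^sup>2 < a" by (auto simp: a_def add_nonneg_pos)
      have "0 \<le> 2 * (- d / a) * d + (- d / a)\<^sup>2 * (norm x)\<^sup>2" by (rule q)
      also have "\<dots> \<le> 2 * (- d / a) * d + (- d / a)\<^sup>2 * a" using a by (intro add_left_mono mult_left_mono) auto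
      also have "\<dots> = - d\<^sup>2 / a" using a by (simp add: field_simps power2_eq_square)
      also have "\<dots> < 0" using d a by (simp add: divide_neg_pos)
      finally show False by simp
    qed
    then show ?thesis by (simp add: d_def inner_cinner[symmetric] inner_commute)
  qed
  have "f x = cinner x w" if "x \<in> S" for x
  proof (rule complex_eqI)
    show "Re (f x) = Re (cinner x w)" by (rule Re_eq[OF that])
    \<comment> \<open>The imaginary part of a linear functional at \<open>x\<close> is, up to sign,
      its real part at \<open>\<i> *\<^sub>C x\<close>.\<close>
    have "Re (f (\<i> *\<^sub>C x)) = Re (cinner (\<i> *\<^sub>C x) w)" using that by (intro Re_eq) auto
    then show "Im (f x) = Im (cinner x w)" using that by (simp add: scale cinner_scaleC_left)
  qed
  then show ?thesis using that w(1) by blast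
qed

section \<open>Closed spans and orthonormal bases\<close>

lemma csubspace_hull: "csubspace (csubspace hull (E::'a::complex_inner set))"
  by (rule hull_in) (auto simp: csubspace_def)

lemma csubspace_closure:
  assumes "csubspace (S::'a::complex_inner set)"
  shows "csubspace (closure S)"
  unfolding csubspace_def
proof (intro conjI ballI allI)
  show "0 \<in> closure S" using csubspaceD(1)[OF assms] closure_subset by blast
next
  fix x y assume "x \<in> closure S" "y \<in> closure S"
  then obtain a b where a: "\<And>n. a n \<in> S" "a \<longlonglongrightarrow> x" and b: "\<And>n. b n \<in> S" "b \<longlonglongrightarrow> y"
    unfolding closure_sequential by metis
  have "(\<lambda>n. a n + b n) \<longlonglongrightarrow> x + y" using a b by (intro tendsto_intros)
  then show "x + y \<in> closure S" unfolding closure_sequential using a b csubspaceD[OF assms]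
    by (intro exI[of _ "\<lambda>n. a n + b n"]) auto
next
  fix c x assume "x \<in> closure S"
  then obtain a where a: "\<And>n. a n \<in> S" "a \<longlonglongrightarrow> x"
    unfolding closure_sequential by metis
  have "(\<lambda>n. c *\<^sub>C a n) \<longlonglongrightarrow> c *\<^sub>C x" using a by (intro tendsto_scaleC tendsto_const)
  then show "c *\<^sub>C x \<in> closure S" unfolding closure_sequential using a csubspaceD[OF assms]
    by (intro exI[of _ "\<lambda>n. c *\<^sub>C a n"]) auto
qed

definition ortho_set :: "'a::complex_inner set \<Rightarrow> bool" where
  "ortho_set E \<longleftrightarrow> (\<forall>e\<in>E. norm e = 1) \<and> (\<forall>e\<in>E. \<forall>f\<in>E. e \<noteq> f \<longrightarrow> cinner e f = 0)"

text \<open>Zorn's lemma gives a maximal orthonormal subset. If its closed span missed a vector of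
  \<open>H\<close>, the normalised component orthogonal to that span could be added.\<close>

lemma ex_onb:
  assumes H: "hilbert_space (H::'a::complex_inner set)"
  shows "\<exists>E. onb H E"
proof -
  define \<O> where "\<O> = {E. E \<subseteq> H \<and> ortho_set E}"
  have "\<exists>E\<in>\<O>. \<forall>X\<in>\<O>. E \<subseteq> X \<longrightarrow> X = E"
  proof (rule subset_Zorn')
    fix C assume "subset.chain \<O> C"
    then have C: "C \<subseteq> \<O>" "\<And>X Y. X \<in> C \<Longrightarrow> Y \<in> C \<Longrightarrow> X \<subseteq> Y \<or> Y \<subseteq> X"
      by (auto simp: subset.chain_def)
    have "cinner e f = 0" if e: "e \<in> X" "X \<in> C" and f: "f \<in> Y" "Y \<in> C" and "e \<noteq> f" for e f X Y
    proof -
      have "\<exists>Z\<in>C. e \<in> Z \<and> f \<in> Z" using C(2)[OF e(2) f(2)] e f by blast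
      then obtain Z where "Z \<in> C" "e \<in> Z" "f \<in> Z" by blast
      then show ?thesis using C(1) \<open>e \<noteq> f\<close> by (auto simp: \<O>_def ortho_set_def)
    qed
    then have "\<forall>e\<in>\<Union>C. \<forall>f\<in>\<Union>C. e \<noteq> f \<longrightarrow> cinner e f = 0" by (metis UnionE)
    moreover have "\<Union>C \<subseteq> H" "\<forall>e\<in>\<Union>C. norm e = 1" using C(1) by (auto simp: \<O>_def ortho_set_def)
    ultimately show "\<Union>C \<in> \<O>" by (simp add: \<O>_def ortho_set_def)
  qed
  then obtain E where E: "E \<in> \<O>" and max: "\<And>X. X \<in> \<O> \<Longrightarrow> E \<subseteq> X \<Longrightarrow> X = E" by blast
  have EH: "E \<subseteq> H" and oE: "ortho_set E" using E by (auto simp: \<O>_def)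
  define S where "S = closure (csubspace hull E)"
  have "csubspace hull E \<subseteq> H" using EH H by (intro hull_minimal) (auto simp: hilbert_space_csubspace)
  then have SH: "S \<subseteq> H" unfolding S_def using closure_minimal hilbert_space_closed[OF H] by blast
  have "H \<inter> S = S" using SH by blast
  moreover have "closed S" unfolding S_def by simp
  ultimately have "complete S"
    using complete_Int_closed[OF hilbert_space_complete[OF H], of S] by simp
  moreover have "csubspace S" unfolding S_def by (rule csubspace_closure[OF csubspace_hull])
  ultimately have S: "csubspace S" "complete S" by auto
  have ES: "E \<subseteq> S" unfolding S_def by (rule order_trans[OF hull_subset closure_subset])
  have "H \<subseteq> S"
  proof
    fix x assume x: "x \<in> H"
    \<comment> \<open>\<open>u\<close> is the orthogonal projection of \<open>x\<close> to
      \<open>S\<close>: it represents the functional \<open>cinner y x\<close> restricted to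
      \<open>y\<close> in \<open>S\<close>.\<close>
    obtain u where u: "u \<in> S" "\<And>y. y \<in> S \<Longrightarrow> cinner y x = cinner y u"
    proof (rule Riesz_representation[OF S, of "\<lambda>y. cinner y x" "norm x"])
      show "cmod (cinner y x) \<le> norm x * norm y" for y
        using Cauchy_Schwarz_cinner[of y x] by (simp add: mult.commute)
    qed (auto simp: cinner_add_left cinner_scaleC_left)
    show "x \<in> S"
    proof (rule ccontr)
      assume "x \<notin> S"
      then have ne: "x - u \<noteq> 0" using u(1) by auto
      define w where "w = complex_of_real (1 / norm (x - u)) *\<^sub>C (x - u)"
      have w1: "norm w = 1" using ne by (simp add: w_def norm_scaleC norm_divide)
      have wH: "w \<in> H" using x u(1) SH by (auto simp: w_def intro!: csubspaceD[OF hilbert_space_csubspace[OF H]])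
      have orth: "cinner e w = 0" if "e \<in> E" for e
        using u(2)[of e] that ES by (auto simp: w_def cinner_scaleC_right cinner_diff_right)
      have orth': "cinner w e = 0" if "e \<in> E" for e
        using orth[OF that] cinner_commute[of w e] by simp
      have "insert w E \<in> \<O>" unfolding \<O>_def ortho_set_def using EH wH w1 orth orth' oE
        by (auto simp: ortho_set_def)
      then have "w \<in> E" using max[of "insert w E"] by blast
      then show False using orth[of w] w1 by (simp add: cinner_self)
    qed
  qed
  then have "onb H E" using EH oE by (auto simp: onb_def ortho_set_def S_def)
  then show ?thesis by blast
qed

lemma onb_some_onb: "hilbert_space H \<Longrightarrow> onb H (some_onb H)"
  unfolding some_onb_def by (rule someI_ex[OF ex_onb])

lemma onb_ortho_set: "onb H E \<Longrightarrow> ortho_set E" and onb_subset: "onb H E \<Longrightarrow> E \<subseteq> H"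
  by (auto simp: onb_def ortho_set_def)

lemma cinner_ortho_sum:
  assumes "ortho_set E" "finite F" "F \<subseteq> E" "e \<in> F"
  shows "cinner (\<Sum>f\<in>F. a f *\<^sub>C f) e = a e"
proof -
  have "cinner (\<Sum>f\<in>F. a f *\<^sub>C f) e = (\<Sum>f\<in>F. if f = e then a e else 0)"
    unfolding cinner_sum_left using assms
    by (intro sum.cong) (auto simp: ortho_set_def cinner_scaleC_left cinner_self)
  then show ?thesis using assms by simp
qed

lemma norm_ortho_sum:
  assumes "ortho_set E" "finite F" "F \<subseteq> E"
  shows "(norm (\<Sum>f\<in>F. a f *\<^sub>C f))\<^sup>2 = (\<Sum>f\<in>F. (cmod (a f))\<^sup>2)"
proof -
  have "complex_of_real ((norm (\<Sum>f\<in>F. a f *\<^sub>C f))\<^sup>2) = (\<Sum>f\<in>F. cnj (a f) * a f)"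
    unfolding cinner_self[symmetric]
    by (subst cinner_sum_right) (auto intro!: sum.cong simp: cinner_scaleC_right cinner_ortho_sum[OF assms])
  also have "\<dots> = complex_of_real (\<Sum>f\<in>F. (cmod (a f))\<^sup>2)"
    by (simp add: complex_norm_square[symmetric] mult.commute)
  finally show ?thesis by (simp only: of_real_eq_iff)
qed

text \<open>Pythagoras: the remainder of the Fourier sum is orthogonal to the span of
  \<open>F\<close>, in which the difference of the two sums lies. With all coefficients 0 this is
  Bessel's inequality together with its remainder term.\<close>

lemma ortho_best_approx:
  assumes "ortho_set E" "finite F" "F \<subseteq> E"
  shows "(norm (x - (\<Sum>f\<in>F. a f *\<^sub>C f)))\<^sup>2 =
     (norm (x - (\<Sum>f\<in>F. cinner x f *\<^sub>C f)))\<^sup>2 + (\<Sum>f\<in>F. (cmod (cinner x f - a f))\<^sup>2)"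
proof -
  define p where "p = (\<Sum>f\<in>F. cinner x f *\<^sub>C f)"
  define q where "q = (\<Sum>f\<in>F. (cinner x f - a f) *\<^sub>C f)"
  have pa: "x - (\<Sum>f\<in>F. a f *\<^sub>C f) = (x - p) + q"
  proof -
    have "cinner x f *\<^sub>C f = (cinner x f - a f) *\<^sub>C f + a f *\<^sub>C f" for f
      by (simp add: scaleC_add_left[symmetric])
    then have "p = q + (\<Sum>f\<in>F. a f *\<^sub>C f)" unfolding p_def q_def by (simp add: sum.distrib[symmetric])
    then show ?thesis by simp
  qed
  have "cinner (x - p) f = 0" if "f \<in> F" for f
    unfolding cinner_diff_left p_def using cinner_ortho_sum[OF assms that] by simp
  then have "cinner (x - p) q = 0" unfolding q_def cinner_sum_right
    by (intro sum.neutral) (auto simp: cinner_scaleC_right)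
  then have "inner (x - p) q = 0" by (simp add: inner_cinner)
  then have "(norm ((x - p) + q))\<^sup>2 = (norm (x - p))\<^sup>2 + (norm q)\<^sup>2"
    by (simp add: power2_norm_eq_inner inner_add_left inner_add_right inner_commute)
  then show ?thesis unfolding pa using norm_ortho_sum[OF assms, of "\<lambda>f. cinner x f - a f"]
    by (simp add: p_def q_def)
qed

lemma Bessel:
  assumes "ortho_set E" "finite F" "F \<subseteq> E"
  shows "(\<Sum>f\<in>F. (cmod (cinner x f))\<^sup>2) \<le> (norm x)\<^sup>2"
  using ortho_best_approx[OF assms, of x "\<lambda>_. 0"] by simp

lemma csubspace_hull_finite_sum:
  assumes "y \<in> csubspace hull (E::'a::complex_inner set)"
  obtains F a where "finite F" "F \<subseteq> E" "y = (\<Sum>f\<in>F. a f *\<^sub>C f)"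
proof -
  define S where "S = {\<Sum>f\<in>F. a f *\<^sub>C f |F a. finite F \<and> F \<subseteq> E}"
  have ext: "(\<Sum>f\<in>F. a f *\<^sub>C f) = (\<Sum>f\<in>F \<union> G. (if f \<in> F then a f else 0) *\<^sub>C f)"
    if "finite F" "finite G" for F G and a :: "'a \<Rightarrow> complex"
    using that by (intro sum.mono_neutral_cong_left) auto
  have SI: "(\<Sum>f\<in>F. a f *\<^sub>C f) \<in> S" if "finite F" "F \<subseteq> E" for F a
    using that unfolding S_def by blast
  have SE: "\<exists>F a. finite F \<and> F \<subseteq> E \<and> y = (\<Sum>f\<in>F. a f *\<^sub>C f)" if "y \<in> S" for y
    using that unfolding S_def by blast
  have "csubspace S" unfolding csubspace_def
  proof (intro conjI ballI allI)
    show "0 \<in> S" using SI[of "{}"] by simp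
  next
    fix x y assume "x \<in> S" "y \<in> S"
    then obtain F a G b where F: "finite F" "F \<subseteq> E" "x = (\<Sum>f\<in>F. a f *\<^sub>C f)"
      and G: "finite G" "G \<subseteq> E" "y = (\<Sum>f\<in>G. b f *\<^sub>C f)" by (metis SE)
    have "x + y = (\<Sum>f\<in>F \<union> G. ((if f \<in> F then a f else 0) + (if f \<in> G then b f else 0)) *\<^sub>C f)"
      unfolding F(3) G(3) ext[OF F(1) G(1)] ext[OF G(1) F(1)]
      by (simp add: scaleC_add_left sum.distrib Un_commute)
    then show "x + y \<in> S" using SI[of "F \<union> G"] F(1,2) G(1,2) by simp
  next
    fix c x assume "x \<in> S"
    then obtain F a where F: "finite F" "F \<subseteq> E" "x = (\<Sum>f\<in>F. a f *\<^sub>C f)" by (metis SE)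
    have "c *\<^sub>C x = (\<Sum>f\<in>F. (c * a f) *\<^sub>C f)" unfolding F(3) by (simp add: scaleC_sum_right scaleC_scaleC)
    then show "c *\<^sub>C x \<in> S" using SI F(1,2) by simp
  qed
  moreover have "E \<subseteq> S"
  proof
    fix e assume "e \<in> E"
    then show "e \<in> S" using SI[of "{e}" "\<lambda>_. 1"] by simp
  qed
  ultimately have "csubspace hull E \<subseteq> S" by (intro hull_minimal)
  then have "y \<in> S" using assms by blast
  then show ?thesis using SE that by metis
qed

text \<open>The estimate holds for every larger finite set as well, so that one set can serve
  finitely many vectors at the same time.\<close>

lemma onb_approx:
  assumes E: "onb H E" and x: "x \<in> H" and e: "e > 0"
  shows "\<exists>F. finite F \<and> F \<subseteq> E \<and> (\<forall>G. finite G \<longrightarrow> F \<subseteq> G \<longrightarrow> G \<subseteq> E \<longrightarrow>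
       norm (x - (\<Sum>f\<in>G. cinner x f *\<^sub>C f)) < e)"
proof -
  have "x \<in> closure (csubspace hull E)" using E x by (auto simp: onb_def)
  then obtain y where y: "y \<in> csubspace hull E" "dist y x < e" using e unfolding closure_approachable by blast
  obtain F a where F: "finite F" "F \<subseteq> E" "y = (\<Sum>f\<in>F. a f *\<^sub>C f)"
    using csubspace_hull_finite_sum[OF y(1)] .
  have "norm (x - (\<Sum>f\<in>G. cinner x f *\<^sub>C f)) < e" if G: "finite G" "F \<subseteq> G" "G \<subseteq> E" for G
  proof -
    have "y = (\<Sum>f\<in>G. (if f \<in> F then a f else 0) *\<^sub>C f)"
      unfolding F(3) using G by (intro sum.mono_neutral_cong_left) auto
    then have "(norm (x - y))\<^sup>2 \<ge> (norm (x - (\<Sum>f\<in>G. cinner x f *\<^sub>C f)))\<^sup>2"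
      using ortho_best_approx[OF onb_ortho_set[OF E] G(1,3), of x "\<lambda>f. if f \<in> F then a f else 0"]
      by (simp add: sum_nonneg)
    then have "norm (x - (\<Sum>f\<in>G. cinner x f *\<^sub>C f)) \<le> norm (x - y)" by (rule power2_le_imp_le) simp
    then show ?thesis using y(2) by (simp add: dist_norm norm_minus_commute)
  qed
  then show ?thesis using F(1,2) by (intro exI[of _ F]) simp
qed

text \<open>The nontrivial half of Parseval's identity for finitely many vectors. Since the
  hypothesis mentions only finite sums of coefficients, sums can be reordered and limits taken
  coefficient by coefficient before returning to norms.\<close>

lemma Parseval_le:
  assumes E: "onb H E" and A: "finite A" "\<And>a. a \<in> A \<Longrightarrow> x a \<in> H"
    and le: "\<And>F. finite F \<Longrightarrow> F \<subseteq> E \<Longrightarrow> (\<Sum>a\<in>A. \<Sum>f\<in>F. (cmod (cinner (x a) f))\<^sup>2) \<le> C"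
  shows "(\<Sum>a\<in>A. (norm (x a))\<^sup>2) \<le> C"
proof (rule field_le_epsilon)
  fix d :: real assume d: "d > 0"
  \<comment> \<open>Each of the \<open>card A\<close> vectors contributes an error
    \<open>e\<^sup>2\<close>, in total at most \<open>d\<close>; the added 1 covers an empty
    \<open>A\<close>.\<close>
  define e where "e = sqrt (d / (card A + 1))"
  have e: "e > 0" using d by (simp add: e_def)
  have "\<forall>a\<in>A. \<exists>F. finite F \<and> F \<subseteq> E \<and> (\<forall>G. finite G \<longrightarrow> F \<subseteq> G \<longrightarrow> G \<subseteq> E \<longrightarrow>
       norm (x a - (\<Sum>f\<in>G. cinner (x a) f *\<^sub>C f)) < e)"
    using onb_approx[OF E A(2) e] by (intro ballI)
  then obtain F where F0: "\<forall>a\<in>A. finite (F a) \<and> F a \<subseteq> E \<and> (\<forall>G. finite G \<longrightarrow> F a \<subseteq> G \<longrightarrow> G \<subseteq> E \<longrightarrow>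
       norm (x a - (\<Sum>f\<in>G. cinner (x a) f *\<^sub>C f)) < e)"
    unfolding bchoice_iff by (rule exE)
  then have F: "\<And>a. a \<in> A \<Longrightarrow> finite (F a) \<and> F a \<subseteq> E"
     "\<And>a G. a \<in> A \<Longrightarrow> finite G \<Longrightarrow> F a \<subseteq> G \<Longrightarrow> G \<subseteq> E \<Longrightarrow> norm (x a - (\<Sum>f\<in>G. cinner (x a) f *\<^sub>C f)) < e"
    by simp_all
  define G where "G = (\<Union>a\<in>A. F a)"
  have G: "finite G" "G \<subseteq> E" using F A by (auto simp: G_def)
  have "(norm (x a))\<^sup>2 \<le> (\<Sum>f\<in>G. (cmod (cinner (x a) f))\<^sup>2) + e\<^sup>2" if a: "a \<in> A" for a
  proof -
    have "norm (x a - (\<Sum>f\<in>G. cinner (x a) f *\<^sub>C f)) < e" using a G by (intro F(2)) (auto simp: G_def)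
    then have "(norm (x a - (\<Sum>f\<in>G. cinner (x a) f *\<^sub>C f)))\<^sup>2 \<le> e\<^sup>2" by (intro power_mono) auto
    then show ?thesis using ortho_best_approx[OF onb_ortho_set[OF E] G, of "x a" "\<lambda>_. 0"] by simp
  qed
  then have "(\<Sum>a\<in>A. (norm (x a))\<^sup>2) \<le> (\<Sum>a\<in>A. (\<Sum>f\<in>G. (cmod (cinner (x a) f))\<^sup>2) + e\<^sup>2)" by (rule sum_mono)
  also have "\<dots> \<le> C + card A * e\<^sup>2" using le[OF G] by (simp add: sum.distrib)
  also have "card A * e\<^sup>2 \<le> d" using d by (simp add: e_def field_simps)
  finally show "(\<Sum>a\<in>A. (norm (x a))\<^sup>2) \<le> C + d" by simp
qed

section \<open>Complex measures\<close>

text \<open>Boundedness is recorded explicitly so that the suprema defining the variations are at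
  once finite; it is immediate for the measures that occur, from contractivity of projections or
  from the semivariation.\<close>

definition cmeas :: "'w measure \<Rightarrow> ('w set \<Rightarrow> complex) \<Rightarrow> bool" where
  "cmeas M \<nu> \<longleftrightarrow>
     (\<forall>A :: nat \<Rightarrow> 'w set. range A \<subseteq> sets M \<and> disjoint_family A \<longrightarrow> (\<lambda>n. \<nu> (A n)) sums \<nu> (\<Union>n. A n)) \<and>
     (\<exists>B. \<forall>G\<in>sets M. cmod (\<nu> G) \<le> B)"

lemma cmeas_sums:
  "cmeas M \<nu> \<Longrightarrow> range A \<subseteq> sets M \<Longrightarrow> disjoint_family A \<Longrightarrow> (\<lambda>n. \<nu> (A n)) sums \<nu> (\<Union>n. A n)"
  by (auto simp: cmeas_def)

lemma cmeas_empty: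
  assumes "cmeas M \<nu>"
  shows "\<nu> {} = 0"
proof -
  have "(\<lambda>n::nat. \<nu> {}) sums \<nu> (\<Union>n::nat. {})"
    by (rule cmeas_sums[OF assms]) (auto simp: disjoint_family_on_def)
  then have "(\<lambda>n::nat. \<nu> {}) \<longlonglongrightarrow> 0" by (intro summable_LIMSEQ_zero sums_summable)
  then show ?thesis by (simp add: LIMSEQ_const_iff)
qed

lemma cmeas_Un:
  assumes \<nu>: "cmeas M \<nu>" and "A \<in> sets M" "B \<in> sets M" "A \<inter> B = {}"
  shows "\<nu> (A \<union> B) = \<nu> A + \<nu> B"
proof -
  have "(\<lambda>n. \<nu> (binaryset A B n)) sums \<nu> (\<Union>n. binaryset A B n)"
    using assms by (intro cmeas_sums[OF \<nu>]) (auto simp: range_binaryset_eq disjoint_family_on_def binaryset_def)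
  moreover have "(\<lambda>n. \<nu> (binaryset A B n)) sums (\<nu> A + \<nu> B)"
    by (rule binaryset_sums) (rule cmeas_empty[OF \<nu>])
  ultimately show ?thesis unfolding UN_binaryset_eq by (rule sums_unique2)
qed

lemma cmeas_Diff:
  assumes \<nu>: "cmeas M \<nu>" and "A \<in> sets M" "B \<in> sets M" "B \<subseteq> A"
  shows "\<nu> (A - B) = \<nu> A - \<nu> B"
  using cmeas_Un[OF \<nu>, of B "A - B"] assms by (simp add: Un_absorb1)

lemma cmeas_finite_UN:
  assumes \<nu>: "cmeas M \<nu>" and "finite I" "\<And>i. i \<in> I \<Longrightarrow> A i \<in> sets M" "disjoint_family_on A I"
  shows "\<nu> (\<Union>i\<in>I. A i) = (\<Sum>i\<in>I. \<nu> (A i))"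
  using assms(2-)
proof (induction I rule: finite_induct)
  case empty
  then show ?case by (simp add: cmeas_empty[OF \<nu>])
next
  case (insert i I)
  have "\<nu> (A i \<union> (\<Union>i\<in>I. A i)) = \<nu> (A i) + \<nu> (\<Union>i\<in>I. A i)"
    using insert by (intro cmeas_Un[OF \<nu>]) (auto simp: disjoint_family_on_def)
  then show ?case using insert by (auto simp: disjoint_family_on_def)
qed

lemma cmeas_cmult:
  assumes "cmeas M \<nu>"
  shows "cmeas M (\<lambda>G. c * \<nu> G)"
proof -
  obtain B where B: "\<And>G. G \<in> sets M \<Longrightarrow> cmod (\<nu> G) \<le> B" using assms by (auto simp: cmeas_def)
  have "\<exists>B. \<forall>G\<in>sets M. cmod (c * \<nu> G) \<le> B"
    using B by (intro exI[of _ "cmod c * B"]) (auto simp: norm_mult intro!: mult_left_mono)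
  then show ?thesis using assms unfolding cmeas_def by (auto intro: sums_mult)
qed

lemma cmeas_add:
  assumes "cmeas M \<nu>" "cmeas M \<kappa>"
  shows "cmeas M (\<lambda>G. \<nu> G + \<kappa> G)"
proof -
  obtain B C where B: "\<And>G. G \<in> sets M \<Longrightarrow> cmod (\<nu> G) \<le> B" and C: "\<And>G. G \<in> sets M \<Longrightarrow> cmod (\<kappa> G) \<le> C"
    using assms unfolding cmeas_def by blast
  have "\<exists>B. \<forall>G\<in>sets M. cmod (\<nu> G + \<kappa> G) \<le> B"
    using B C by (intro exI[of _ "B + C"]) (metis norm_triangle_mono)
  then show ?thesis using assms unfolding cmeas_def by (auto intro: sums_add)
qed

lemma cmeas_diff: "cmeas M \<nu> \<Longrightarrow> cmeas M \<kappa> \<Longrightarrow> cmeas M (\<lambda>G. \<nu> G - \<kappa> G)"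
  using cmeas_add[of M \<nu> "\<lambda>G. (-1) * \<kappa> G"] cmeas_cmult[of M \<kappa> "-1"] by simp

subsection \<open>Jordan decomposition\<close>

definition finite_measure_of :: "'w measure \<Rightarrow> ('w set \<Rightarrow> real) \<Rightarrow> 'w measure" where
  "finite_measure_of M p = measure_of (space M) (sets M) (\<lambda>A. ennreal (p A))"

lemma finite_measure_of:
  assumes nonneg: "\<And>A. A \<in> sets M \<Longrightarrow> 0 \<le> p A"
    and sums: "\<And>A :: nat \<Rightarrow> _. range A \<subseteq> sets M \<Longrightarrow> disjoint_family A \<Longrightarrow> (\<lambda>n. p (A n)) sums p (\<Union>n. A n)"
  shows "finite_measure (finite_measure_of M p)" "sets (finite_measure_of M p) = sets M"
    "A \<in> sets M \<Longrightarrow> measure (finite_measure_of M p) A = p A"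
proof -
  have "p {} = 0"
  proof -
    have "(\<lambda>n::nat. p {}) sums p (\<Union>n::nat. {})" by (rule sums) (auto simp: disjoint_family_on_def)
    then have "(\<lambda>n::nat. p {}) \<longlonglongrightarrow> 0" by (intro summable_LIMSEQ_zero sums_summable)
    then show ?thesis by (simp add: LIMSEQ_const_iff)
  qed
  then have pos: "positive (sets M) (\<lambda>A. ennreal (p A))" by (simp add: positive_def)
  have ca: "countably_additive (sets M) (\<lambda>A. ennreal (p A))"
  proof (rule countably_additiveI)
    fix A :: "nat \<Rightarrow> _" assume A: "range A \<subseteq> sets M" "disjoint_family A"
    have "(\<lambda>n. ennreal (p (A n))) sums ennreal (p (\<Union>n. A n))"
      using A nonneg sums[OF A] by (subst sums_ennreal) auto
    then show "(\<Sum>n. ennreal (p (A n))) = ennreal (p (\<Union>n. A n))" by (simp add: sums_iff)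
  qed
  have em: "emeasure (finite_measure_of M p) A = ennreal (p A)" if "A \<in> sets M" for A
    unfolding finite_measure_of_def
    by (rule emeasure_measure_of_sigma[OF sets.sigma_algebra_axioms pos ca that])
  show se: "sets (finite_measure_of M p) = sets M" by (simp add: finite_measure_of_def)
  then have "space (finite_measure_of M p) = space M" by (rule sets_eq_imp_space_eq)
  then show "finite_measure (finite_measure_of M p)"
    by (intro finite_measureI) (simp add: em)
  show "A \<in> sets M \<Longrightarrow> measure (finite_measure_of M p) A = p A"
    by (simp add: measure_def em nonneg)
qed

text \<open>The positive variation of the real part, defined without a Hahn decomposition.\<close>

definition upper_var :: "'w measure \<Rightarrow> ('w set \<Rightarrow> complex) \<Rightarrow> 'w set \<Rightarrow> real" where
  "upper_var M \<nu> A = (SUP G\<in>{G\<in>sets M. G \<subseteq> A}. Re (\<nu> G))"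

lemma upper_var_upper:
  assumes "cmeas M \<nu>" "G \<in> sets M" "G \<subseteq> A"
  shows "Re (\<nu> G) \<le> upper_var M \<nu> A"
proof -
  obtain B where "\<And>G. G \<in> sets M \<Longrightarrow> cmod (\<nu> G) \<le> B" using assms by (auto simp: cmeas_def)
  then have "bdd_above ((\<lambda>G. Re (\<nu> G)) ` {G\<in>sets M. G \<subseteq> A})"
    using complex_Re_le_cmod order_trans by (intro bdd_aboveI2[of _ _ B]) blast
  then show ?thesis unfolding upper_var_def using assms by (intro cSUP_upper) auto
qed

lemma upper_var_least:
  "(\<And>G. G \<in> sets M \<Longrightarrow> G \<subseteq> A \<Longrightarrow> Re (\<nu> G) \<le> c) \<Longrightarrow> upper_var M \<nu> A \<le> c"
  unfolding upper_var_def by (rule cSUP_least) (auto intro!: exI[of _ "{}"])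

lemma upper_var_nonneg: "cmeas M \<nu> \<Longrightarrow> 0 \<le> upper_var M \<nu> A"
  using upper_var_upper[of M \<nu> "{}" A] by (simp add: cmeas_empty)

lemma upper_var_approx:
  assumes "d > 0"
  shows "\<exists>G. G \<in> sets M \<and> G \<subseteq> A \<and> upper_var M \<nu> A - d < Re (\<nu> G)"
proof (rule ccontr)
  assume "\<not> ?thesis"
  then have "\<And>G. G \<in> sets M \<Longrightarrow> G \<subseteq> A \<Longrightarrow> Re (\<nu> G) \<le> upper_var M \<nu> A - d" by (auto simp: not_less)
  then have "upper_var M \<nu> A \<le> upper_var M \<nu> A - d" by (rule upper_var_least)
  then show False using assms by simp
qed

text \<open>One inequality unites nearly optimal subsets of the first \<open>n\<close> sets, each
  with error \<open>d / (n + 1)\<close> so that the errors add up to at most \<open>d\<close>. The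
  other one cuts a subset of the union along the \<open>A n\<close>.\<close>

lemma upper_var_sums:
  assumes \<nu>: "cmeas M \<nu>" and A: "range A \<subseteq> sets M" "disjoint_family (A :: nat \<Rightarrow> _)"
  shows "(\<lambda>n. upper_var M \<nu> (A n)) sums upper_var M \<nu> (\<Union>n. A n)"
proof -
  let ?p = "upper_var M \<nu>"
  have le: "(\<Sum>i<n. ?p (A i)) \<le> ?p (\<Union>n. A n)" for n
  proof (rule field_le_epsilon)
    fix d :: real assume d: "d > 0"
    have "\<exists>G. G \<in> sets M \<and> G \<subseteq> A i \<and> ?p (A i) - d / (n + 1) < Re (\<nu> G)" for i
      using d by (intro upper_var_approx) simp
    then obtain G where G: "\<And>i. G i \<in> sets M" "\<And>i. G i \<subseteq> A i" "\<And>i. ?p (A i) - d / (n + 1) < Re (\<nu> (G i))"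
      by metis
    have "(\<Sum>i<n. ?p (A i)) \<le> (\<Sum>i<n. Re (\<nu> (G i)) + d / (n + 1))"
      using G(3) by (intro sum_mono) (smt (verit))
    also have "\<dots> = Re (\<Sum>i<n. \<nu> (G i)) + n * (d / (n + 1))" by (simp add: sum.distrib)
    also have "(\<Sum>i<n. \<nu> (G i)) = \<nu> (\<Union>i<n. G i)"
      using G A(2) by (intro cmeas_finite_UN[OF \<nu>, symmetric]) (auto simp: disjoint_family_on_def, blast)
    also have "Re (\<nu> (\<Union>i<n. G i)) \<le> ?p (\<Union>n. A n)"
      using G by (intro upper_var_upper[OF \<nu>]) auto
    also have "n * (d / (n + 1)) \<le> d" using d by (simp add: field_simps)
    finally show "(\<Sum>i<n. ?p (A i)) \<le> ?p (\<Union>n. A n) + d" by simp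
  qed
  have sm: "summable (\<lambda>n. ?p (A n))"
    by (rule summableI_nonneg_bounded[OF upper_var_nonneg[OF \<nu>] le])
  have "?p (\<Union>n. A n) \<le> (\<Sum>n. ?p (A n))"
  proof (rule upper_var_least)
    fix G assume G: "G \<in> sets M" "G \<subseteq> (\<Union>n. A n)"
    have "(\<lambda>n. \<nu> (G \<inter> A n)) sums \<nu> (\<Union>n. G \<inter> A n)"
      using G A by (intro cmeas_sums[OF \<nu>]) (auto simp: disjoint_family_on_def, blast)
    also have "(\<Union>n. G \<inter> A n) = G" using G by auto
    finally have "(\<lambda>n. Re (\<nu> (G \<inter> A n))) sums Re (\<nu> G)" by (rule sums_Re)
    moreover have "Re (\<nu> (G \<inter> A n)) \<le> ?p (A n)" for n
      using G A by (intro upper_var_upper[OF \<nu>]) auto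
    ultimately show "Re (\<nu> G) \<le> (\<Sum>n. ?p (A n))" by (intro sums_le[OF _ _ summable_sums[OF sm]])
  qed
  moreover have "(\<Sum>n. ?p (A n)) \<le> ?p (\<Union>n. A n)" by (rule suminf_le_const[OF sm le])
  ultimately show ?thesis using sm by (simp add: sums_iff)
qed

text \<open>The complement \<open>A - G\<close> exchanges the roles of \<open>\<nu>\<close> and its
  negative, because the two values add up to \<open>\<nu> A\<close>.\<close>

lemma upper_var_minus:
  assumes \<nu>: "cmeas M \<nu>" and A: "A \<in> sets M"
  shows "upper_var M \<nu> A - upper_var M (\<lambda>G. - \<nu> G) A = Re (\<nu> A)"
proof -
  have \<nu>': "cmeas M (\<lambda>G. - \<nu> G)" using cmeas_cmult[OF \<nu>, of "-1"] by simp
  have "upper_var M \<nu> A \<le> Re (\<nu> A) + upper_var M (\<lambda>G. - \<nu> G) A"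
  proof (rule upper_var_least)
    fix G assume G: "G \<in> sets M" "G \<subseteq> A"
    show "Re (\<nu> G) \<le> Re (\<nu> A) + upper_var M (\<lambda>G. - \<nu> G) A"
      using upper_var_upper[OF \<nu>', of "A - G" A] cmeas_Diff[OF \<nu> A G] G A by auto
  qed
  moreover have "upper_var M (\<lambda>G. - \<nu> G) A \<le> - Re (\<nu> A) + upper_var M \<nu> A"
  proof (rule upper_var_least)
    fix G assume G: "G \<in> sets M" "G \<subseteq> A"
    show "Re (- \<nu> G) \<le> - Re (\<nu> A) + upper_var M \<nu> A"
      using upper_var_upper[OF \<nu>, of "A - G" A] cmeas_Diff[OF \<nu> A G] G A by auto
  qed
  ultimately show ?thesis by simp
qed

text \<open>For \<open>i = 0, 1, 2, 3\<close> the factor \<open>cnj (\<i> ^ i)\<close> selects the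
  positive variation of Re, Im, -Re and -Im, in the order required by
  \<open>has_cmeasure_integral\<close>.\<close>

definition jordan :: "'w measure \<Rightarrow> ('w set \<Rightarrow> complex) \<Rightarrow> nat \<Rightarrow> 'w measure" where
  "jordan M \<nu> i = finite_measure_of M (upper_var M (\<lambda>G. cnj (\<i> ^ i) * \<nu> G))"

lemma
  assumes \<nu>: "cmeas M \<nu>"
  shows finite_measure_jordan: "finite_measure (jordan M \<nu> i)"
    and measure_jordan: "A \<in> sets M \<Longrightarrow> measure (jordan M \<nu> i) A = upper_var M (\<lambda>G. cnj (\<i> ^ i) * \<nu> G) A"
  using cmeas_cmult[OF \<nu>] unfolding jordan_def
  by (auto intro!: finite_measure_of upper_var_nonneg upper_var_sums)

lemma sets_jordan [simp]: "sets (jordan M \<nu> i) = sets M"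
  by (simp add: jordan_def finite_measure_of_def)

lemma space_jordan [simp]: "space (jordan M \<nu> i) = space M"
  by (rule sets_eq_imp_space_eq) simp

lemma measurable_jordan [simp]: "measurable (jordan M \<nu> i) N = measurable M N"
  by (rule measurable_cong_sets) auto

lemma simple_function_jordan [simp]: "simple_function (jordan M \<nu> i) f = simple_function M f"
  by (simp add: simple_function_def)

lemma jordan_decomposition:
  assumes \<nu>: "cmeas M \<nu>" and A: "A \<in> sets M"
  shows "\<nu> A = (\<Sum>i<4. \<i> ^ i * complex_of_real (measure (jordan M \<nu> i) A))"
proof -
  have "upper_var M \<nu> A - upper_var M (\<lambda>G. - \<nu> G) A = Re (\<nu> A)"
    by (rule upper_var_minus[OF \<nu> A])
  moreover have "upper_var M (\<lambda>G. - \<i> * \<nu> G) A - upper_var M (\<lambda>G. - (- \<i> * \<nu> G)) A = Re (- \<i> * \<nu> A)"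
    by (rule upper_var_minus[OF cmeas_cmult[OF \<nu>] A])
  ultimately show ?thesis
    by (simp add: measure_jordan[OF \<nu> A] eval_nat_numeral complex_eq_iff)
qed

text \<open>The value at \<open>N\<close> itself could vanish by cancellation. A Jordan part is a
  supremum over measurable subsets, so all of them must be null.\<close>

lemma jordan_null:
  assumes \<nu>: "cmeas M \<nu>" and N: "N \<in> sets M" and null: "\<And>G. G \<in> sets M \<Longrightarrow> G \<subseteq> N \<Longrightarrow> \<nu> G = 0"
  shows "N \<in> null_sets (jordan M \<nu> i)"
proof -
  interpret finite_measure "jordan M \<nu> i" by (rule finite_measure_jordan[OF \<nu>])
  have "upper_var M (\<lambda>G. cnj (\<i> ^ i) * \<nu> G) N \<le> 0"
    using null by (intro upper_var_least) simp
  then have "measure (jordan M \<nu> i) N = 0"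
    using measure_jordan[OF \<nu> N, of i] by (metis measure_le_0_iff)
  then show ?thesis using N by (simp add: null_sets_def emeasure_eq_measure)
qed

text \<open>The sum of the four Jordan parts serves as a substitute for the total variation
  measure.\<close>

lemma cmeas_dominated:
  assumes \<nu>: "cmeas M \<nu>"
  shows "\<exists>m. finite_measure m \<and> sets m = sets M \<and> (\<forall>A\<in>sets M. cmod (\<nu> A) \<le> measure m A)"
proof -
  define p where "p A = (\<Sum>i<4. measure (jordan M \<nu> i) A)" for A
  have s: "(\<lambda>n. p (A n)) sums p (\<Union>n. A n)" if A: "range A \<subseteq> sets M" "disjoint_family A" for A :: "nat \<Rightarrow> _"
    unfolding p_def
  proof (rule sums_sum)
    fix i
    interpret finite_measure "jordan M \<nu> i" by (rule finite_measure_jordan[OF \<nu>])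
    show "(\<lambda>n. measure (jordan M \<nu> i) (A n)) sums measure (jordan M \<nu> i) (\<Union>n. A n)"
      using A by (intro finite_measure_UNION) auto
  qed
  have le: "cmod (\<nu> A) \<le> p A" if "A \<in> sets M" for A
    unfolding jordan_decomposition[OF \<nu> that] p_def
    by (rule order_trans[OF norm_sum]) (simp add: norm_mult norm_power)
  have nn: "0 \<le> p A" for A unfolding p_def by (simp add: sum_nonneg)
  show ?thesis
    using finite_measure_of[of M p] s le nn by (intro exI[of _ "finite_measure_of M p"]) auto
qed

subsection \<open>Estimates on a generating algebra\<close>

text \<open>The sets that can be approximated form a sigma-algebra: complements have the same
  symmetric difference, and a countable union is replaced by a finite one at the cost of a small
  tail.\<close>

lemma algebra_approx:
  assumes m: "finite_measure m" and sets: "sets m = sigma_sets (space m) \<A>" and alg: "algebra (space m) \<A>"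
    and X: "X \<in> sets m" and d: "(d::real) > 0"
  shows "\<exists>A\<in>\<A>. measure m ((X - A) \<union> (A - X)) < d"
proof -
  interpret finite_measure m by (rule m)
  interpret algebra "space m" \<A> by (rule alg)
  have A_sets: "A \<in> sets m" if "A \<in> \<A>" for A using that unfolding sets by (rule sigma_sets.Basic)
  have "X \<in> sigma_sets (space m) \<A>" using X sets by simp
  then show ?thesis using d
  proof (induction X arbitrary: d rule: sigma_sets.induct)
    case (Basic a)
    then show ?case by (intro bexI[of _ a]) auto
  next
    case Empty
    then show ?case by (intro bexI[of _ "{}"]) auto
  next
    case (Compl a)
    then obtain A where A: "A \<in> \<A>" "measure m ((a - A) \<union> (A - a)) < d" by blast
    have "((space m - a) - (space m - A)) \<union> ((space m - A) - (space m - a)) = (a - A) \<union> (A - a)"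
      using Compl.hyps A(1) sets.sets_into_space A_sets unfolding sets[symmetric] by blast
    then show ?case using A by (intro bexI[of _ "space m - A"]) auto
  next
    case (Union a)
    have a: "a i \<in> sets m" for i using Union.hyps unfolding sets .
    have "(\<lambda>n. measure m (\<Union>i<n. a i)) \<longlonglongrightarrow> measure m (\<Union>n. \<Union>i<n. a i)"
      using a by (intro finite_Lim_measure_incseq) (auto simp: incseq_def, force)
    moreover have U: "(\<Union>n. \<Union>i<n. a i) = (\<Union>i. a i)" by auto
    ultimately have "\<forall>\<^sub>F n in sequentially. measure m (\<Union>i. a i) - d / 2 < measure m (\<Union>i<n. a i)"
      using Union.prems by (intro order_tendstoD(1)) auto
    then obtain n where n: "measure m (\<Union>i. a i) - d / 2 < measure m (\<Union>i<n. a i)"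
      by (auto simp: eventually_sequentially)
    \<comment> \<open>The tail of the union uses up \<open>d / 2\<close>; the \<open>n\<close>
      approximation errors share the other half.\<close>
    have "\<exists>A\<in>\<A>. measure m ((a i - A) \<union> (A - a i)) < d / (2 * (n + 1))" for i
      using Union.prems by (intro Union.IH) auto
    then obtain A where A: "\<And>i. A i \<in> \<A>" "\<And>i. measure m ((a i - A i) \<union> (A i - a i)) < d / (2 * (n + 1))"
      by metis
    define D where "D i = (a i - A i) \<union> (A i - a i)" for i
    have D: "D i \<in> sets m" for i using a A_sets[OF A(1)] by (auto simp: D_def)
    define R where "R = (\<Union>i. a i) - (\<Union>i<n. a i)"
    have R: "R \<in> sets m" using a by (auto simp: R_def)
    have "measure m R = measure m (\<Union>i. a i) - measure m (\<Union>i<n. a i)"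
      unfolding R_def using a by (intro finite_measure_Diff) auto
    then have R2: "measure m R < d / 2" using n by simp
    have "measure m (((\<Union>i. a i) - (\<Union>i<n. A i)) \<union> ((\<Union>i<n. A i) - (\<Union>i. a i))) \<le> measure m (R \<union> (\<Union>i<n. D i))"
      using R D by (intro finite_measure_mono) (auto simp: R_def D_def)
    also have "\<dots> \<le> measure m R + measure m (\<Union>i<n. D i)"
      using R D by (intro measure_Un_le) auto
    also have "measure m (\<Union>i<n. D i) \<le> (\<Sum>i<n. measure m (D i))"
      using D by (intro measure_UNION_le) auto
    also have "\<dots> \<le> (\<Sum>i<n. d / (2 * (n + 1)))"
      using A(2) by (intro sum_mono) (auto simp: D_def intro: less_imp_le)
    also have "\<dots> \<le> d / 2" using Union.prems by (simp add: field_simps)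
    finally have "measure m (((\<Union>i. a i) - (\<Union>i<n. A i)) \<union> ((\<Union>i<n. A i) - (\<Union>i. a i))) < d"
      using R2 by simp
    moreover have "(\<Union>i<n. A i) \<in> \<A>" using A(1) by auto
    ultimately show ?case by blast
  qed
qed

text \<open>\<open>\<nu> X\<close> and \<open>\<nu> A\<close> differ by
  \<open>\<nu> (X - A) - \<nu> (A - X)\<close>, which is small under a dominating finite measure
  once \<open>A\<close> approximates \<open>X\<close>. The constant \<open>c\<close> is thus
  preserved.\<close>

lemma cmeas_bound_algebra:
  assumes \<nu>: "cmeas M \<nu>" and sets: "sets M = sigma_sets (space M) \<A>" and alg: "algebra (space M) \<A>"
    and le: "\<And>A. A \<in> \<A> \<Longrightarrow> cmod (\<nu> A) \<le> c" and X: "X \<in> sets M"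
  shows "cmod (\<nu> X) \<le> c"
proof (rule field_le_epsilon)
  fix d :: real assume d: "d > 0"
  obtain m where m: "finite_measure m" "sets m = sets M" "\<forall>A\<in>sets M. cmod (\<nu> A) \<le> measure m A"
    using cmeas_dominated[OF \<nu>] by (elim exE conjE)
  interpret finite_measure m by (rule m(1))
  have sp: "space m = space M" by (rule sets_eq_imp_space_eq[OF m(2)])
  obtain A where A: "A \<in> \<A>" "measure m ((X - A) \<union> (A - X)) < d"
    using algebra_approx[OF m(1) _ _ _ d, of \<A> X] sets alg X m(2) sp by auto
  have As: "A \<in> sets M" unfolding sets using A(1) by (rule sigma_sets.Basic)
  have split: "\<nu> X = \<nu> (X - A) + \<nu> (X \<inter> A)" if "X \<in> sets M" "A \<in> sets M" for X A
  proof -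
    have "X - A \<union> X \<inter> A = X" "(X - A) \<inter> (X \<inter> A) = {}" by blast+
    then show ?thesis using cmeas_Un[OF \<nu>, of "X - A" "X \<inter> A"] that by simp
  qed
  have "\<nu> X = \<nu> (X - A) + \<nu> (X \<inter> A)" "\<nu> A = \<nu> (A - X) + \<nu> (X \<inter> A)"
    using split[OF X As] split[OF As X] by (simp_all add: Int_commute)
  then have "\<nu> X = \<nu> A + \<nu> (X - A) - \<nu> (A - X)" by (simp add: algebra_simps)
  then have "cmod (\<nu> X) \<le> cmod (\<nu> A) + cmod (\<nu> (X - A)) + cmod (\<nu> (A - X))"
    using norm_triangle_ineq4[of "\<nu> A + \<nu> (X - A)" "\<nu> (A - X)"] norm_triangle_ineq[of "\<nu> A" "\<nu> (X - A)"]
    by simp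
  moreover have "cmod (\<nu> A) \<le> c" by (rule le[OF A(1)])
  moreover have "cmod (\<nu> (X - A)) \<le> measure m (X - A)" using X As by (intro m(3)[rule_format]) auto
  moreover have "cmod (\<nu> (A - X)) \<le> measure m (A - X)" using X As by (intro m(3)[rule_format]) auto
  moreover have "measure m (X - A) + measure m (A - X) = measure m ((X - A) \<union> (A - X))"
    using X As m(2) by (intro finite_measure_Union[symmetric]) auto
  ultimately show "cmod (\<nu> X) \<le> c + d" using A(2) by linarith
qed

subsection \<open>Integration\<close>

lemma integral_simple_function_sum:
  fixes s :: "'w \<Rightarrow> complex"
  assumes m: "finite_measure m" and s: "simple_function m s"
  shows "(\<integral>x. s x \<partial>m) = (\<Sum>z\<in>s ` space m. z * complex_of_real (measure m (s -` {z} \<inter> space m)))"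
proof -
  interpret finite_measure m by (rule m)
  have fin: "finite (s ` space m)" and meas: "\<And>z. s -` {z} \<inter> space m \<in> sets m"
    by (rule simple_functionD[OF s])+
  have "(\<integral>x. s x \<partial>m) = (\<integral>x. (\<Sum>z\<in>s ` space m. indicator (s -` {z} \<inter> space m) x *\<^sub>R z) \<partial>m)"
  proof (rule Bochner_Integration.integral_cong[OF refl])
    fix x assume x: "x \<in> space m"
    have "(\<Sum>z\<in>s ` space m. indicator (s -` {z} \<inter> space m) x *\<^sub>R z) = (\<Sum>z\<in>s ` space m. if z = s x then z else 0)"
      using x by (intro sum.cong) (auto simp: indicator_def)
    then show "s x = (\<Sum>z\<in>s ` space m. indicator (s -` {z} \<inter> space m) x *\<^sub>R z)" using fin x by simp
  qed
  also have "\<dots> = (\<Sum>z\<in>s ` space m. \<integral>x. indicator (s -` {z} \<inter> space m) x *\<^sub>R z \<partial>m)"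
    using meas by (intro Bochner_Integration.integral_sum integrable_scaleR_left) (auto simp: emeasure_eq_measure)
  also have "\<dots> = (\<Sum>z\<in>s ` space m. z * complex_of_real (measure m (s -` {z} \<inter> space m)))"
    using meas by (intro sum.cong) (auto simp: scaleR_conv_of_real mult.commute)
  finally show ?thesis .
qed

text \<open>For simple functions the value is determined by \<open>\<nu>\<close> alone. A single
  approximating sequence dominated by \<open>2 * cmod (f x)\<close> therefore yields the same
  numbers for both decompositions, and the majorant is integrable for each measure that occurs in
  them.\<close>

lemma has_cmeasure_integral_unique:
  assumes "has_cmeasure_integral M \<nu> f I" "has_cmeasure_integral M \<nu> f I'"
  shows "I = I'"
proof -
  have *: "\<exists>s. (\<forall>n. simple_function M (s n)) \<and> (\<forall>x\<in>space M. (\<lambda>n. s n x) \<longlonglongrightarrow> f x) \<and>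
      (\<forall>n. \<forall>x\<in>space M. cmod (s n x) \<le> 2 * cmod (f x))"
  proof -
    obtain m where "sets (m 0) = sets M" "integrable (m (0::nat)) f"
      using assms(1) unfolding has_cmeasure_integral_def by force
    then have "f \<in> borel_measurable M"
      using measurable_cong_sets[of "m 0" M borel borel] by (auto dest: borel_measurable_integrable)
    then show ?thesis using borel_measurable_implies_sequence_metric[of f M 0] by simp
  qed
  then obtain s where s: "\<And>n. simple_function M (s n)" "\<And>x. x \<in> space M \<Longrightarrow> (\<lambda>n. s n x) \<longlonglongrightarrow> f x"
    "\<And>n x. x \<in> space M \<Longrightarrow> cmod (s n x) \<le> 2 * cmod (f x)" by blast
  have "(\<lambda>n. \<Sum>z\<in>s n ` space M. z * \<nu> (s n -` {z} \<inter> space M)) \<longlonglongrightarrow> J"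
    if "has_cmeasure_integral M \<nu> f J" for J
  proof -
    from that obtain m where m0: "(\<forall>i<4. finite_measure (m i) \<and> sets (m i) = sets M \<and> integrable (m (i::nat)) f) \<and>
        (\<forall>G\<in>sets M. \<nu> G = (\<Sum>i<4. \<i> ^ i * complex_of_real (measure (m i) G))) \<and>
        J = (\<Sum>i<4. \<i> ^ i * (\<integral>x. f x \<partial>m i))"
      unfolding has_cmeasure_integral_def by (rule exE)
    have m: "\<And>i. i < 4 \<Longrightarrow> finite_measure (m i)" "\<And>i. i < 4 \<Longrightarrow> sets (m i) = sets M"
      "\<And>i. i < (4::nat) \<Longrightarrow> integrable (m i) f"
      and \<nu>: "\<And>G. G \<in> sets M \<Longrightarrow> \<nu> G = (\<Sum>i<4. \<i> ^ i * complex_of_real (measure (m i) G))"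
      and J: "J = (\<Sum>i<4. \<i> ^ i * (\<integral>x. f x \<partial>m i))"
      using m0 by simp_all
    have sp: "space (m i) = space M" if "i < 4" for i by (rule sets_eq_imp_space_eq[OF m(2)[OF that]])
    have simp: "simple_function (m i) (s n)" if "i < 4" for i n
      using s(1)[of n] sp[OF that] m(2)[OF that] by (simp add: simple_function_def)
    have "(\<Sum>z\<in>s n ` space M. z * \<nu> (s n -` {z} \<inter> space M)) = (\<Sum>i<4. \<i> ^ i * (\<integral>x. s n x \<partial>m i))" for n
    proof -
      have "(\<Sum>z\<in>s n ` space M. z * \<nu> (s n -` {z} \<inter> space M)) =
        (\<Sum>z\<in>s n ` space M. \<Sum>i<4. \<i> ^ i * (z * complex_of_real (measure (m i) (s n -` {z} \<inter> space M))))"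
        using simple_functionD(2)[OF s(1)] by (intro sum.cong) (auto simp: \<nu> sum_distrib_left mult_ac)
      also have "\<dots> = (\<Sum>i<4. \<i> ^ i * (\<integral>x. s n x \<partial>m i))"
        by (subst sum.swap) (auto intro!: sum.cong
          simp: integral_simple_function_sum[OF m(1) simp] sp sum_distrib_left)
      finally show ?thesis .
    qed
    moreover have "(\<lambda>n. \<Sum>i<4. \<i> ^ i * (\<integral>x. s n x \<partial>m i)) \<longlonglongrightarrow> J"
      unfolding J
    proof (intro tendsto_sum tendsto_mult tendsto_const)
      fix i :: nat assume "i \<in> {..<4}"
      then have i: "i < 4" by simp
      show "(\<lambda>n. \<integral>x. s n x \<partial>m i) \<longlonglongrightarrow> (\<integral>x. f x \<partial>m i)"
        using m(3)[OF i] s sp[OF i] simp[OF i]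
        by (intro integral_dominated_convergence[where w="\<lambda>x. 2 * cmod (f x)"])
          (auto intro: borel_measurable_simple_function)
    qed
    ultimately show ?thesis by simp
  qed
  then show ?thesis using assms LIMSEQ_unique by blast
qed

text \<open>The integral with the Jordan decomposition fixed: an explicit sum, which can be
  rewritten without first proving that a value of \<open>cmeasure_integral\<close> exists.\<close>

definition cint :: "'w measure \<Rightarrow> ('w set \<Rightarrow> complex) \<Rightarrow> ('w \<Rightarrow> complex) \<Rightarrow> complex" where
  "cint M \<nu> f = (\<Sum>i<4. \<i> ^ i * (\<integral>x. f x \<partial>jordan M \<nu> i))"

lemma cmeasure_integral_eq_cint:
  assumes "cmeas M \<nu>" and "\<And>i. integrable (jordan M \<nu> i) f"
  shows "cmeasure_integral M \<nu> f = cint M \<nu> f"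
proof -
  have "has_cmeasure_integral M \<nu> f (cint M \<nu> f)"
    unfolding has_cmeasure_integral_def cint_def
    using assms by (intro exI[of _ "jordan M \<nu>"]) (auto simp: finite_measure_jordan jordan_decomposition)
  then show ?thesis unfolding cmeasure_integral_def
    by (intro the_equality has_cmeasure_integral_unique)
qed

lemma cint_simple:
  assumes \<nu>: "cmeas M \<nu>" and s: "simple_function M s"
  shows "cint M \<nu> s = (\<Sum>z\<in>s ` space M. z * \<nu> (s -` {z} \<inter> space M))"
proof -
  have "(\<Sum>z\<in>s ` space M. z * \<nu> (s -` {z} \<inter> space M)) =
    (\<Sum>z\<in>s ` space M. \<Sum>i<4. \<i> ^ i * (z * complex_of_real (measure (jordan M \<nu> i) (s -` {z} \<inter> space M))))"
    using simple_functionD(2)[OF s]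
    by (intro sum.cong) (auto simp: jordan_decomposition[OF \<nu>] sum_distrib_left mult_ac)
  also have "\<dots> = cint M \<nu> s" unfolding cint_def
    by (subst sum.swap) (auto intro!: sum.cong
      simp: integral_simple_function_sum[OF finite_measure_jordan[OF \<nu>]] s sum_distrib_left)
  finally show ?thesis by simp
qed

lemma integrable_jordan_bounded:
  assumes \<nu>: "cmeas M \<nu>" and f: "f \<in> borel_measurable M" and c: "\<And>x. x \<in> space M \<Longrightarrow> cmod (f x) \<le> c"
  shows "integrable (jordan M \<nu> i) f"
proof -
  interpret finite_measure "jordan M \<nu> i" by (rule finite_measure_jordan[OF \<nu>])
  show ?thesis using f c by (intro integrable_const_bound[where B=c]) auto
qed

lemma cint_tendsto:
  assumes \<nu>: "cmeas M \<nu>" and s: "\<And>n. s n \<in> borel_measurable M"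
    and lim: "\<And>x. x \<in> space M \<Longrightarrow> (\<lambda>n. s n x) \<longlonglongrightarrow> f x"
    and c: "\<And>n x. x \<in> space M \<Longrightarrow> cmod (s n x) \<le> c"
  shows "(\<lambda>n. cint M \<nu> (s n)) \<longlonglongrightarrow> cint M \<nu> f"
  unfolding cint_def
proof (intro tendsto_sum tendsto_mult tendsto_const)
  fix i
  interpret finite_measure "jordan M \<nu> i" by (rule finite_measure_jordan[OF \<nu>])
  have f: "f \<in> borel_measurable M" by (rule borel_measurable_LIMSEQ_metric[OF s lim])
  show "(\<lambda>n. \<integral>x. s n x \<partial>jordan M \<nu> i) \<longlonglongrightarrow> (\<integral>x. f x \<partial>jordan M \<nu> i)"
    using s f lim c by (intro integral_dominated_convergence[where w="\<lambda>x. c"]) auto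
qed

lemma cint_AE_cong:
  assumes "f \<in> borel_measurable M" "g \<in> borel_measurable M" "\<And>i. AE x in jordan M \<nu> i. f x = g x"
  shows "cint M \<nu> f = cint M \<nu> g"
  unfolding cint_def using assms by (intro sum.cong arg_cong2[of _ _ _ _ "(*)"] integral_cong_AE) auto

section \<open>Bounded operators\<close>

lemma bounded_opsD:
  assumes "T \<in> bounded_ops H K"
  shows "x \<in> H \<Longrightarrow> T x \<in> K" "x \<notin> H \<Longrightarrow> T x = 0"
    "x \<in> H \<Longrightarrow> y \<in> H \<Longrightarrow> T (x + y) = T x + T y" "x \<in> H \<Longrightarrow> T (c *\<^sub>C x) = c *\<^sub>C T x"
  using assms by (simp_all add: bounded_ops_def)

lemma bounded_ops_bound:
  assumes "T \<in> bounded_ops H K"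
  shows "\<exists>B\<ge>0. \<forall>x. norm (T x) \<le> B * norm x"
proof -
  obtain B where "\<forall>x\<in>H. norm (T x) \<le> B * norm x" using assms by (auto simp: bounded_ops_def)
  moreover have "B * norm x \<le> max B 0 * norm x" for x :: 'a by (intro mult_right_mono) auto
  ultimately have "norm (T x) \<le> max B 0 * norm x" for x
    using bounded_opsD(2)[OF assms, of x] by (cases "x \<in> H") (auto intro: order_trans)
  then show ?thesis by (intro exI[of _ "max B 0"]) auto
qed

lemma bounded_opsI:
  assumes "\<And>x. x \<in> H \<Longrightarrow> T x \<in> K" "\<And>x. x \<notin> H \<Longrightarrow> T x = 0"
    "\<And>x y. x \<in> H \<Longrightarrow> y \<in> H \<Longrightarrow> T (x + y) = T x + T y" "\<And>c x. x \<in> H \<Longrightarrow> T (c *\<^sub>C x) = c *\<^sub>C T x"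
    "\<And>x. x \<in> H \<Longrightarrow> norm (T x) \<le> B * norm x"
  shows "T \<in> bounded_ops H K"
  using assms unfolding bounded_ops_def by (intro CollectI conjI exI[of _ B]) simp_all

lemma bounded_ops_0: "T \<in> bounded_ops H K \<Longrightarrow> T 0 = 0"
  using bounded_opsD(2)[of T H K 0] bounded_opsD(4)[of T H K 0 0] by (cases "0 \<in> H") auto

lemma bounded_ops_diff:
  assumes T: "T \<in> bounded_ops H K" and H: "csubspace H" and "x \<in> H" "y \<in> H"
  shows "T (x - y) = T x - T y"
  using bounded_opsD(3)[OF T, of x "(-1) *\<^sub>C y"] bounded_opsD(4)[OF T, of y "-1"] csubspaceD(5)[OF H] assms(3,4)
  by (simp add: scaleC_minus1)

lemma bounded_ops_sum:
  assumes T: "T \<in> bounded_ops H K" and H: "csubspace H" and f: "\<And>i. i \<in> I \<Longrightarrow> f i \<in> H"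
  shows "T (\<Sum>i\<in>I. f i) = (\<Sum>i\<in>I. T (f i))"
  using f by (induction I rule: infinite_finite_induct)
    (simp_all add: bounded_ops_0[OF T] bounded_opsD(3)[OF T] csubspace_sum[OF H])

lemma bounded_ops_lincomb:
  assumes T: "T \<in> bounded_ops H K" and H: "csubspace H" and f: "\<And>i. i \<in> I \<Longrightarrow> f i \<in> H"
  shows "T (\<Sum>i\<in>I. a i *\<^sub>C f i) = (\<Sum>i\<in>I. a i *\<^sub>C T (f i))"
  using bounded_ops_sum[OF T H, of I "\<lambda>i. a i *\<^sub>C f i"] f
  by (simp add: csubspaceD[OF H] bounded_opsD[OF T])

lemma bounded_ops_comp:
  assumes S: "S \<in> bounded_ops K L" and T: "T \<in> bounded_ops H K"
  shows "S \<circ> T \<in> bounded_ops H L"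
proof -
  obtain B where B: "B \<ge> 0" "\<forall>x. norm (S x) \<le> B * norm x" using bounded_ops_bound[OF S] by auto
  obtain C where C: "C \<ge> 0" "\<forall>x. norm (T x) \<le> C * norm x" using bounded_ops_bound[OF T] by auto
  have "norm (S (T x)) \<le> (B * C) * norm x" for x
  proof -
    have "norm (S (T x)) \<le> B * norm (T x)" using B by blast
    also have "\<dots> \<le> B * (C * norm x)" using B C by (intro mult_left_mono) auto
    finally show ?thesis by (simp add: mult.assoc)
  qed
  then show ?thesis
    by (intro bounded_opsI[where B="B * C"])
      (simp_all add: bounded_opsD[OF S] bounded_opsD[OF T] bounded_ops_0[OF S])
qed

lemma bounded_ops_add:
  assumes S: "S \<in> bounded_ops H K" and T: "T \<in> bounded_ops H K" and K: "csubspace K"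
  shows "(\<lambda>x. S x + T x) \<in> bounded_ops H K"
proof -
  obtain B where B: "B \<ge> 0" "\<forall>x. norm (S x) \<le> B * norm x" using bounded_ops_bound[OF S] by auto
  obtain C where C: "C \<ge> 0" "\<forall>x. norm (T x) \<le> C * norm x" using bounded_ops_bound[OF T] by auto
  have "norm (S x + T x) \<le> (B + C) * norm x" for x
    using norm_triangle_ineq[of "S x" "T x"] B(2)[rule_format, of x] C(2)[rule_format, of x]
    by (simp add: distrib_right)
  then show ?thesis
    by (intro bounded_opsI[where B="B + C"])
      (simp_all add: bounded_opsD[OF S] bounded_opsD[OF T] csubspaceD[OF K] scaleC_add_right)
qed

lemma bounded_ops_scaleC:
  assumes T: "T \<in> bounded_ops H K" and K: "csubspace K"
  shows "(\<lambda>x. c *\<^sub>C T x) \<in> bounded_ops H K"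
proof -
  obtain B where B: "B \<ge> 0" "\<forall>x. norm (T x) \<le> B * norm x" using bounded_ops_bound[OF T] by auto
  have "norm (c *\<^sub>C T x) \<le> (cmod c * B) * norm x" for x
    using B by (simp add: norm_scaleC mult.assoc mult_left_mono)
  then show ?thesis
    by (intro bounded_opsI[where B="cmod c * B"])
      (simp_all add: bounded_opsD[OF T] csubspaceD[OF K] scaleC_add_right scaleC_scaleC mult.commute)
qed

lemma bounded_ops_zero: "csubspace K \<Longrightarrow> (\<lambda>x. 0) \<in> bounded_ops H K"
  by (intro bounded_opsI[where B=0]) (auto simp: csubspaceD)

lemma eq_if_cinner_eq:
  assumes K: "csubspace K" and "x \<in> K" "y \<in> K" and eq: "\<And>k. k \<in> K \<Longrightarrow> cinner x k = cinner y k"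
  shows "x = y"
proof -
  have "cinner (x - y) (x - y) = 0"
    using eq[of "x - y"] csubspaceD(6)[OF K] assms(2,3) by (simp add: cinner_diff_left)
  then show ?thesis by (simp add: cinner_self)
qed

lemma bounded_ops_eqI:
  assumes K: "csubspace K" and S: "S \<in> bounded_ops H K" and T: "T \<in> bounded_ops H K"
    and eq: "\<And>h k. h \<in> H \<Longrightarrow> k \<in> K \<Longrightarrow> cinner (S h) k = cinner (T h) k"
  shows "S = T"
proof
  fix x show "S x = T x"
    by (cases "x \<in> H") (use eq bounded_opsD[OF S] bounded_opsD[OF T] in \<open>auto intro: eq_if_cinner_eq[OF K]\<close>)
qed

text \<open>Riesz representation of \<open>B x\<close> for each \<open>x\<close>. The form is
  conjugate linear in its second argument, so it is the conjugate that is represented.\<close>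

lemma bounded_ops_of_form:
  assumes H: "csubspace H" and K: "hilbert_space K" and C: "C \<ge> 0"
    and addl: "\<And>x y k. x \<in> H \<Longrightarrow> y \<in> H \<Longrightarrow> k \<in> K \<Longrightarrow> B (x + y) k = B x k + B y k"
    and addr: "\<And>x k l. x \<in> H \<Longrightarrow> k \<in> K \<Longrightarrow> l \<in> K \<Longrightarrow> B x (k + l) = B x k + B x l"
    and scl: "\<And>c x k. x \<in> H \<Longrightarrow> k \<in> K \<Longrightarrow> B (c *\<^sub>C x) k = c * B x k"
    and scr: "\<And>c x k. x \<in> H \<Longrightarrow> k \<in> K \<Longrightarrow> B x (c *\<^sub>C k) = cnj c * B x k"
    and bound: "\<And>x k. x \<in> H \<Longrightarrow> k \<in> K \<Longrightarrow> cmod (B x k) \<le> C * norm x * norm k"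
  shows "\<exists>T\<in>bounded_ops H K. \<forall>x\<in>H. \<forall>k\<in>K. cinner (T x) k = B x k"
proof -
  note sK = hilbert_space_csubspace[OF K]
  have "\<exists>u. u \<in> K \<and> (\<forall>k\<in>K. cinner u k = B x k)" if x: "x \<in> H" for x
  proof (rule Riesz_representation[OF sK hilbert_space_complete[OF K], of "\<lambda>k. cnj (B x k)" "C * norm x"])
    fix u assume u: "u \<in> K" "\<And>k. k \<in> K \<Longrightarrow> cnj (B x k) = cinner k u"
    have "cinner u k = B x k" if "k \<in> K" for k
      using u(2)[OF that] cinner_commute[of u k] by (metis complex_cnj_cnj)
    then show ?thesis using u(1) by blast
  qed (use x addr scr bound in auto)
  then obtain t where t: "\<And>x. x \<in> H \<Longrightarrow> t x \<in> K" "\<And>x k. x \<in> H \<Longrightarrow> k \<in> K \<Longrightarrow> cinner (t x) k = B x k"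
    by metis
  define T where "T x = (if x \<in> H then t x else 0)" for x
  have "T \<in> bounded_ops H K"
  proof (rule bounded_opsI[where B=C])
    fix x y assume xy: "x \<in> H" "y \<in> H"
    show "T (x + y) = T x + T y"
      using xy t by (intro eq_if_cinner_eq[OF sK])
        (auto simp: T_def csubspaceD[OF H] csubspaceD[OF sK] cinner_add_left addl)
  next
    fix c x assume x: "x \<in> H"
    show "T (c *\<^sub>C x) = c *\<^sub>C T x"
      using x t by (intro eq_if_cinner_eq[OF sK])
        (auto simp: T_def csubspaceD[OF H] csubspaceD[OF sK] cinner_scaleC_left scl)
    \<comment> \<open>The norm bound comes from evaluating the form at its own representing
      vector.\<close>
    have "cinner (t x) (t x) = B x (t x)" using x t by auto
    then have "(norm (t x))\<^sup>2 = cmod (B x (t x))" unfolding cinner_self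
      by (metis norm_of_real abs_of_nonneg zero_le_power2)
    also have "\<dots> \<le> C * norm x * norm (t x)" using x t by (intro bound)
    finally have "norm (t x) * norm (t x) \<le> (C * norm x) * norm (t x)" by (simp add: power2_eq_square)
    then have "norm (t x) \<le> C * norm x"
      using C by (cases "norm (t x) = 0") auto
    then show "norm (T x) \<le> C * norm x" using x by (simp add: T_def)
  qed (auto simp: T_def t)
  then show ?thesis using t(2) by (intro bexI[of _ T]) (auto simp: T_def)
qed

lemma adjoint_exists:
  assumes T: "T \<in> bounded_ops H K" and H: "hilbert_space H" and K: "csubspace K"
  shows "\<exists>S\<in>bounded_ops K H. \<forall>h\<in>H. \<forall>k\<in>K. cinner (T h) k = cinner h (S k)"
proof -
  obtain B where B: "B \<ge> 0" "\<forall>x. norm (T x) \<le> B * norm x" using bounded_ops_bound[OF T] by auto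
  have "\<exists>S\<in>bounded_ops K H. \<forall>k\<in>K. \<forall>h\<in>H. cinner (S k) h = cinner k (T h)"
  proof (rule bounded_ops_of_form[OF K H B(1)])
    fix k h
    have "cmod (cinner k (T h)) \<le> norm k * norm (T h)" by (rule Cauchy_Schwarz_cinner)
    also have "\<dots> \<le> norm k * (B * norm h)" using B by (intro mult_left_mono) auto
    finally show "cmod (cinner k (T h)) \<le> B * norm k * norm h" by (simp add: mult_ac)
  qed (simp_all add: cinner_add_left cinner_add_right cinner_scaleC_left cinner_scaleC_right bounded_opsD[OF T])
  then obtain S where S: "S \<in> bounded_ops K H" "\<forall>k\<in>K. \<forall>h\<in>H. cinner (S k) h = cinner k (T h)" by blast
  have "cinner (T h) k = cinner h (S k)" if "h \<in> H" "k \<in> K" for h k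
    using S(2) that cinner_commute[of h "S k"] cinner_commute[of "T h" k] by simp
  then show ?thesis using S(1) by blast
qed

section \<open>Hilbert--Schmidt operators\<close>

text \<open>A bound for the Hilbert-Schmidt norm in terms of finite partial sums. It yields
  summability as a consequence, whereas \<open>hs_norm\<close> is meaningful only when summability
  is known.\<close>

definition hs_bound :: "'a::complex_inner set \<Rightarrow> ('a \<Rightarrow> 'b::complex_inner) \<Rightarrow> real \<Rightarrow> bool" where
  "hs_bound H b C \<longleftrightarrow> C \<ge> 0 \<and> (\<forall>F. finite F \<and> F \<subseteq> some_onb H \<longrightarrow> (\<Sum>e\<in>F. (norm (b e))\<^sup>2) \<le> C\<^sup>2)"

lemma hs_boundD: "hs_bound H b C \<Longrightarrow> C \<ge> 0"
  "hs_bound H b C \<Longrightarrow> finite F \<Longrightarrow> F \<subseteq> some_onb H \<Longrightarrow> (\<Sum>e\<in>F. (norm (b e))\<^sup>2) \<le> C\<^sup>2"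
  by (auto simp: hs_bound_def)

lemma hs_bound_summable:
  assumes "hs_bound H b C"
  shows "(\<lambda>e. (norm (b e))\<^sup>2) summable_on some_onb H"
  using hs_boundD(2)[OF assms] by (intro nonneg_bdd_above_summable_on bdd_aboveI2) auto

lemma hs_norm_nonneg: "hs_norm H b \<ge> 0"
  by (simp add: hs_norm_def infsum_nonneg)

lemma hs_norm_le:
  assumes "hs_bound H b C"
  shows "hs_norm H b \<le> C"
  unfolding hs_norm_def using hs_boundD[OF assms] hs_bound_summable[OF assms]
  by (intro real_le_lsqrt infsum_le_finite_sums) auto

lemma hs_bound_hs_norm:
  assumes "(\<lambda>e. (norm (b e))\<^sup>2) summable_on some_onb H"
  shows "hs_bound H b (hs_norm H b)"
  unfolding hs_bound_def hs_norm_def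
  using assms by (auto simp: infsum_nonneg intro!: finite_sum_le_infsum)

lemma hilbert_schmidt_hs_bound: "b \<in> hilbert_schmidt H K \<Longrightarrow> hs_bound H b (hs_norm H b)"
  by (intro hs_bound_hs_norm) (simp add: hilbert_schmidt_def)

lemma hilbert_schmidt_bounded_ops: "b \<in> hilbert_schmidt H K \<Longrightarrow> b \<in> bounded_ops H K"
  by (simp add: hilbert_schmidt_def)

lemma hilbert_schmidtI: "b \<in> bounded_ops H K \<Longrightarrow> hs_bound H b C \<Longrightarrow> b \<in> hilbert_schmidt H K"
  by (simp add: hilbert_schmidt_def hs_bound_summable)

lemma hs_bound_L2_set: "hs_bound H b C \<longleftrightarrow>
    C \<ge> 0 \<and> (\<forall>F. finite F \<and> F \<subseteq> some_onb H \<longrightarrow> L2_set (\<lambda>e. norm (b e)) F \<le> C)"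
proof -
  have "C \<ge> 0 \<Longrightarrow> sqrt (\<Sum>e\<in>F. (norm (b e))\<^sup>2) \<le> C \<longleftrightarrow> (\<Sum>e\<in>F. (norm (b e))\<^sup>2) \<le> C\<^sup>2" for F
    by (metis real_sqrt_le_iff real_sqrt_abs abs_of_nonneg)
  then show ?thesis unfolding hs_bound_def L2_set_def by auto
qed

lemma hs_bound_add:
  assumes "hs_bound H b C" "hs_bound H c D"
  shows "hs_bound H (\<lambda>x. b x + c x) (C + D)"
  unfolding hs_bound_L2_set
proof (intro conjI allI impI)
  show "0 \<le> C + D" using assms by (auto simp: hs_bound_def)
  fix F assume F: "finite F \<and> F \<subseteq> some_onb H"
  have "L2_set (\<lambda>e. norm (b e + c e)) F \<le> L2_set (\<lambda>e. norm (b e) + norm (c e)) F"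
    by (intro L2_set_mono norm_triangle_ineq) auto
  also have "\<dots> \<le> L2_set (\<lambda>e. norm (b e)) F + L2_set (\<lambda>e. norm (c e)) F" by (rule L2_set_triangle_ineq)
  also have "\<dots> \<le> C + D" using assms F unfolding hs_bound_L2_set by (intro add_mono) auto
  finally show "L2_set (\<lambda>e. norm (b e + c e)) F \<le> C + D" .
qed

lemma hs_bound_scaleC:
  assumes "hs_bound H b C"
  shows "hs_bound H (\<lambda>x. a *\<^sub>C b x) (cmod a * C)"
  using assms unfolding hs_bound_def norm_scaleC power_mult_distrib sum_distrib_left[symmetric]
  by (auto intro!: mult_left_mono)

lemma hs_bound_diff:
  assumes "hs_bound H b C" "hs_bound H c D"
  shows "hs_bound H (\<lambda>x. b x - c x) (C + D)"
  using hs_bound_add[OF assms(1) hs_bound_scaleC[OF assms(2), of "-1"]] by (simp add: scaleC_minus1)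

lemma hilbert_schmidt_add:
  assumes "b \<in> hilbert_schmidt H K" "c \<in> hilbert_schmidt H K" "csubspace K"
  shows "(\<lambda>x. b x + c x) \<in> hilbert_schmidt H K"
  using assms hs_bound_add[OF hilbert_schmidt_hs_bound hilbert_schmidt_hs_bound]
  by (intro hilbert_schmidtI bounded_ops_add) (auto intro: hilbert_schmidt_bounded_ops)

lemma hilbert_schmidt_scaleC:
  assumes "b \<in> hilbert_schmidt H K" "csubspace K"
  shows "(\<lambda>x. a *\<^sub>C b x) \<in> hilbert_schmidt H K"
  using assms hs_bound_scaleC[OF hilbert_schmidt_hs_bound]
  by (intro hilbert_schmidtI bounded_ops_scaleC) (auto intro: hilbert_schmidt_bounded_ops)

lemma hilbert_schmidt_diff:
  assumes "b \<in> hilbert_schmidt H K" "c \<in> hilbert_schmidt H K" "csubspace K"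
  shows "(\<lambda>x. b x - c x) \<in> hilbert_schmidt H K"
  using hilbert_schmidt_add[OF assms(1) hilbert_schmidt_scaleC[OF assms(2,3), of "-1"] assms(3)]
  by (simp add: scaleC_minus1)

lemma hilbert_schmidt_sum:
  assumes K: "csubspace K" and "\<And>i. i \<in> I \<Longrightarrow> b i \<in> hilbert_schmidt H K"
  shows "(\<lambda>x. \<Sum>i\<in>I. b i x) \<in> hilbert_schmidt H K"
  using assms(2)
proof (induction I rule: infinite_finite_induct)
  case (insert i I)
  then show ?case using hilbert_schmidt_add[OF _ _ K, of "b i" H "\<lambda>x. \<Sum>i\<in>I. b i x"] by simp
qed (auto intro!: hilbert_schmidtI[where C=0] bounded_ops_zero[OF K] simp: hs_bound_def)

text \<open>The operator norm is at most the Hilbert-Schmidt norm. On Fourier sums this is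
  Cauchy-Schwarz between Bessel's inequality and the bound for \<open>b\<close>; boundedness of
  \<open>b\<close> handles the remainder.\<close>

lemma norm_le_hs_bound:
  assumes b: "b \<in> bounded_ops H K" and H: "hilbert_space H" and C: "hs_bound H b C"
  shows "norm (b x) \<le> C * norm x"
proof (cases "x \<in> H")
  case True
  obtain B where B: "B \<ge> 0" "\<forall>x. norm (b x) \<le> B * norm x" using bounded_ops_bound[OF b] by auto
  note E = onb_some_onb[OF H] and sH = hilbert_space_csubspace[OF H]
  have C0: "C \<ge> 0" by (rule hs_boundD(1)[OF C])
  show ?thesis
  proof (rule field_le_epsilon)
    fix d :: real assume d: "d > 0"
    \<comment> \<open>A remainder of this size is enlarged by \<open>b\<close> to at most
      \<open>d\<close>; the added 1 covers \<open>B = 0\<close>.\<close>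
    have "d / (B + 1) > 0" using d B by simp
    from onb_approx[OF E True this] obtain F where F0: "finite F \<and> F \<subseteq> some_onb H \<and> (\<forall>G. finite G \<longrightarrow> F \<subseteq> G \<longrightarrow> G \<subseteq> some_onb H \<longrightarrow>
       norm (x - (\<Sum>f\<in>G. cinner x f *\<^sub>C f)) < d / (B + 1))" by (rule exE)
    then have F: "finite F" "F \<subseteq> some_onb H" "norm (x - (\<Sum>f\<in>F. cinner x f *\<^sub>C f)) < d / (B + 1)" by auto
    define p where "p = (\<Sum>f\<in>F. cinner x f *\<^sub>C f)"
    have FH: "f \<in> H" if "f \<in> F" for f using that F(2) onb_subset[OF E] by blast
    then have pH: "p \<in> H" unfolding p_def by (intro csubspace_sum[OF sH] csubspaceD[OF sH])
    have "b p = (\<Sum>f\<in>F. cinner x f *\<^sub>C b f)"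
      unfolding p_def by (rule bounded_ops_lincomb[OF b sH FH])
    then have "norm (b p) \<le> (\<Sum>f\<in>F. norm (cinner x f *\<^sub>C b f))" by (simp add: norm_sum)
    also have "\<dots> = (\<Sum>f\<in>F. \<bar>cmod (cinner x f)\<bar> * \<bar>norm (b f)\<bar>)" by (simp add: norm_scaleC)
    also have "\<dots> \<le> L2_set (\<lambda>f. cmod (cinner x f)) F * L2_set (\<lambda>f. norm (b f)) F"
      by (rule L2_set_mult_ineq)
    also have "\<dots> \<le> norm x * C"
    proof (intro mult_mono)
      show "L2_set (\<lambda>f. cmod (cinner x f)) F \<le> norm x"
        unfolding L2_set_def using Bessel[OF onb_ortho_set[OF E] F(1,2), of x] by (intro real_le_lsqrt) auto
      show "L2_set (\<lambda>f. norm (b f)) F \<le> C" using C F unfolding hs_bound_L2_set by blast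
    qed auto
    finally have 1: "norm (b p) \<le> C * norm x" by (simp add: mult.commute)
    have "norm (b (x - p)) \<le> B * norm (x - p)" using B by blast
    also have "\<dots> \<le> B * (d / (B + 1))" using F(3) B by (intro mult_left_mono) (auto simp: p_def)
    also have "\<dots> \<le> d" using B d by (simp add: field_simps)
    finally have 2: "norm (b (x - p)) \<le> d" .
    have "b x = b p + b (x - p)" using bounded_ops_diff[OF b sH True pH] by simp
    then show "norm (b x) \<le> C * norm x + d" using 1 2 norm_triangle_ineq[of "b p" "b (x - p)"] by simp
  qed
qed (use bounded_opsD(2)[OF b, of x] hs_boundD(1)[OF C] in auto)

text \<open>For orthonormal \<open>F\<close> this is \<open>b\<close> after the orthogonal
  projection to the span of \<open>F\<close>.\<close>

definition finite_rank_part :: "'a::complex_inner set \<Rightarrow> 'a set \<Rightarrow> ('a \<Rightarrow> 'b::complex_inner) \<Rightarrow> 'a \<Rightarrow> 'b" where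
  "finite_rank_part H F b x = (if x \<in> H then \<Sum>e\<in>F. cinner x e *\<^sub>C b e else 0)"

lemma finite_rank_part_bounded_ops:
  assumes b: "b \<in> bounded_ops H K" and H: "csubspace H" and K: "csubspace K" and F: "F \<subseteq> H"
  shows "finite_rank_part H F b \<in> bounded_ops H K"
proof (rule bounded_opsI)
  fix x assume "x \<in> H"
  then show "finite_rank_part H F b x \<in> K" unfolding finite_rank_part_def
    using F by (auto intro!: csubspace_sum[OF K] csubspaceD[OF K] bounded_opsD[OF b])
  have "norm (finite_rank_part H F b x) \<le> (\<Sum>e\<in>F. norm (cinner x e *\<^sub>C b e))"
    using \<open>x \<in> H\<close> by (simp add: finite_rank_part_def norm_sum)
  also have "\<dots> \<le> (\<Sum>e\<in>F. (norm x * norm e) * norm (b e))"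
    by (intro sum_mono) (simp add: norm_scaleC mult_right_mono Cauchy_Schwarz_cinner)
  also have "\<dots> = (\<Sum>e\<in>F. norm e * norm (b e)) * norm x"
    by (simp add: sum_distrib_left mult_ac)
  finally show "norm (finite_rank_part H F b x) \<le> (\<Sum>e\<in>F. norm e * norm (b e)) * norm x" .
qed (simp_all add: finite_rank_part_def csubspaceD[OF H] cinner_add_left cinner_scaleC_left
    scaleC_add_left sum.distrib scaleC_sum_right scaleC_scaleC)

text \<open>The difference vanishes on \<open>F\<close> and equals \<open>b\<close> on the other
  basis vectors, so its square norm is a tail of a convergent sum.\<close>

lemma hs_bound_finite_rank_approx:
  assumes b: "b \<in> hilbert_schmidt H K" and H: "hilbert_space H" and d: "d > 0"
  shows "\<exists>F. finite F \<and> F \<subseteq> some_onb H \<and> hs_bound H (\<lambda>x. b x - finite_rank_part H F b x) d"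
proof -
  note E = onb_some_onb[OF H]
  have "((\<lambda>e. (norm (b e))\<^sup>2) has_sum (\<Sum>\<^sub>\<infinity>e\<in>some_onb H. (norm (b e))\<^sup>2)) (some_onb H)"
    using b by (simp add: hilbert_schmidt_def)
  then obtain F where F: "finite F" "F \<subseteq> some_onb H"
    "dist (\<Sum>e\<in>F. (norm (b e))\<^sup>2) (\<Sum>\<^sub>\<infinity>e\<in>some_onb H. (norm (b e))\<^sup>2) \<le> d\<^sup>2"
    using has_sum_finite_approximation[where f="\<lambda>e. (norm (b e))\<^sup>2" and A="some_onb H" and \<epsilon>="d\<^sup>2"] d by auto
  have fr: "finite_rank_part H F b e = (if e \<in> F then b e else 0)" if e: "e \<in> some_onb H" for e
  proof -
    have "finite_rank_part H F b e = (\<Sum>f\<in>F. if f = e then b e else 0)"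
      unfolding finite_rank_part_def using e onb_subset[OF E] onb_ortho_set[OF E] F(2)
      by (auto intro!: sum.cong simp: ortho_set_def cinner_self subset_iff)
    then show ?thesis using F(1) by simp
  qed
  have "(\<Sum>e\<in>G. (norm (b e - finite_rank_part H F b e))\<^sup>2) \<le> d\<^sup>2" if G: "finite G" "G \<subseteq> some_onb H" for G
  proof -
    have "(\<Sum>e\<in>G. (norm (b e - finite_rank_part H F b e))\<^sup>2) = (\<Sum>e\<in>G - F. (norm (b e))\<^sup>2)"
      using G fr by (intro sum.mono_neutral_cong_right) auto
    moreover have "(\<Sum>e\<in>G - F. (norm (b e))\<^sup>2) + (\<Sum>e\<in>F. (norm (b e))\<^sup>2) = (\<Sum>e\<in>(G - F) \<union> F. (norm (b e))\<^sup>2)"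
      using G F by (intro sum.union_disjoint[symmetric]) auto
    moreover have "\<dots> \<le> (\<Sum>\<^sub>\<infinity>e\<in>some_onb H. (norm (b e))\<^sup>2)"
      using b G F by (intro finite_sum_le_infsum) (auto simp: hilbert_schmidt_def)
    ultimately show ?thesis using F(3) by (simp add: dist_real_def)
  qed
  then show ?thesis using F d by (intro exI[of _ F]) (auto simp: hs_bound_def)
qed

section \<open>Projection valued measures\<close>

lemma pvm_spaceD:
  assumes "pvm_space M K Q"
  shows "hilbert_space K" "csubspace K" "G \<in> sets M \<Longrightarrow> Q G \<in> bounded_ops K K" "Q (space M) = id_op K"
    "G \<in> sets M \<Longrightarrow> Q G (Q G x) = Q G x"
    "G \<in> sets M \<Longrightarrow> h \<in> K \<Longrightarrow> k \<in> K \<Longrightarrow> cinner (Q G h) k = cinner h (Q G k)"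
  using assms hilbert_space_csubspace[of K] by (auto simp: pvm_space_def fun_eq_iff)

lemma pvm_in: "pvm_space M K Q \<Longrightarrow> G \<in> sets M \<Longrightarrow> h \<in> K \<Longrightarrow> Q G h \<in> K"
  by (rule bounded_opsD(1)[OF pvm_spaceD(3)])

lemma pvm_cinner_self:
  assumes Q: "pvm_space M K Q" and G: "G \<in> sets M" and h: "h \<in> K"
  shows "cinner (Q G h) h = complex_of_real ((norm (Q G h))\<^sup>2)"
  using pvm_spaceD(6)[OF Q G pvm_in[OF Q G h] h] pvm_spaceD(5)[OF Q G, of h]
  by (simp add: cinner_self del: of_real_power)

lemma pvm_norm_le:
  assumes Q: "pvm_space M K Q" and G: "G \<in> sets M"
  shows "norm (Q G h) \<le> norm h"
proof (cases "h \<in> K")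
  case True
  have "(norm (Q G h))\<^sup>2 = cmod (cinner (Q G h) h)"
    unfolding pvm_cinner_self[OF Q G True] by (simp add: norm_power)
  also have "\<dots> \<le> norm (Q G h) * norm h" by (rule Cauchy_Schwarz_cinner)
  finally have "norm (Q G h) * norm (Q G h) \<le> norm (Q G h) * norm h" by (simp add: power2_eq_square)
  then show ?thesis by (cases "norm (Q G h) = 0") auto
qed (simp add: bounded_opsD(2)[OF pvm_spaceD(3)[OF Q G]])

lemma cmeas_pvm:
  assumes Q: "pvm_space M K Q" and hk: "h \<in> K" "k \<in> K"
  shows "cmeas M (\<lambda>G. cinner (Q G h) k)"
  unfolding cmeas_def
proof
  show "\<forall>A :: nat \<Rightarrow> _. range A \<subseteq> sets M \<and> disjoint_family A \<longrightarrow> (\<lambda>n. cinner (Q (A n) h) k) sums cinner (Q (\<Union>n. A n) h) k"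
    using Q hk by (simp add: pvm_space_def)
  have "cmod (cinner (Q G h) k) \<le> norm h * norm k" if "G \<in> sets M" for G
    using Cauchy_Schwarz_cinner[of "Q G h" k] mult_right_mono[OF pvm_norm_le[OF Q that, of h], of "norm k"] by simp
  then show "\<exists>B. \<forall>G\<in>sets M. cmod (cinner (Q G h) k) \<le> B" by blast
qed

text \<open>The squares are values of the positive measure \<open>cinner (Q G h) h\<close>, so
  additivity of that measure expresses the orthogonality of the ranges.\<close>

lemma pvm_sum_norm_le:
  assumes Q: "pvm_space M K Q" and I: "finite I" "\<And>i. i \<in> I \<Longrightarrow> A i \<in> sets M" "disjoint_family_on A I"
  shows "(\<Sum>i\<in>I. (norm (Q (A i) h))\<^sup>2) \<le> (norm h)\<^sup>2"
proof (cases "h \<in> K")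
  case True
  have U: "(\<Union>i\<in>I. A i) \<in> sets M" using I by auto
  have "complex_of_real (\<Sum>i\<in>I. (norm (Q (A i) h))\<^sup>2) = (\<Sum>i\<in>I. cinner (Q (A i) h) h)"
    using I(2) by (simp add: pvm_cinner_self[OF Q _ True])
  also have "\<dots> = cinner (Q (\<Union>i\<in>I. A i) h) h"
    by (rule cmeas_finite_UN[OF cmeas_pvm[OF Q True True] I, symmetric])
  also have "\<dots> = complex_of_real ((norm (Q (\<Union>i\<in>I. A i) h))\<^sup>2)" by (rule pvm_cinner_self[OF Q U True])
  finally have "(\<Sum>i\<in>I. (norm (Q (A i) h))\<^sup>2) = (norm (Q (\<Union>i\<in>I. A i) h))\<^sup>2" by (simp only: of_real_eq_iff)
  then show ?thesis using pvm_norm_le[OF Q U, of h] by simp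
qed (use I bounded_opsD(2)[OF pvm_spaceD(3)[OF Q]] in simp)

text \<open>\<open>(norm (Q G h))\<^sup>2\<close> and \<open>(norm (Q (N - G) h))\<^sup>2\<close>
  add up to \<open>(norm (Q N h))\<^sup>2\<close>, which is 0.\<close>

lemma pvm_zero_op_mono:
  assumes Q: "pvm_space M K Q" and N: "N \<in> sets M" "Q N = zero_op" and G: "G \<in> sets M" "G \<subseteq> N"
  shows "Q G = zero_op"
proof -
  have "Q G h = 0" if h: "h \<in> K" for h
  proof -
    have "cinner (Q (N - G) h) h = cinner (Q N h) h - cinner (Q G h) h"
      by (rule cmeas_Diff[OF cmeas_pvm[OF Q h h] N(1) G])
    then have "complex_of_real ((norm (Q (N - G) h))\<^sup>2 + (norm (Q G h))\<^sup>2) = 0"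
      using N G by (simp add: pvm_cinner_self[OF Q _ h] zero_op_def)
    then have "(norm (Q (N - G) h))\<^sup>2 + (norm (Q G h))\<^sup>2 = 0" by (simp only: of_real_eq_0_iff)
    then show ?thesis by (simp add: sum_power2_eq_zero_iff)
  qed
  then show ?thesis using bounded_opsD(2)[OF pvm_spaceD(3)[OF Q G(1)]] by (fastforce simp: zero_op_def)
qed

lemma pvm_zero_opI:
  assumes Q: "pvm_space M K Q" and N: "N \<in> sets M" "\<And>h. h \<in> K \<Longrightarrow> cinner (Q N h) h = 0"
  shows "Q N = zero_op"
proof -
  have "Q N h = 0" if "h \<in> K" for h
    using N(2)[OF that] unfolding pvm_cinner_self[OF Q N(1) that] by simp
  then show ?thesis using bounded_opsD(2)[OF pvm_spaceD(3)[OF Q N(1)]] by (fastforce simp: zero_op_def)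
qed

lemma pvm_zero_op_UN:
  assumes Q: "pvm_space M K Q" and N: "\<And>n::nat. N n \<in> sets M" "\<And>n. Q (N n) = zero_op"
  shows "Q (\<Union>n. N n) = zero_op"
proof (rule pvm_zero_opI[OF Q])
  fix h assume h: "h \<in> K"
  have D: "disjointed N n \<in> sets M" for n using N sets.range_disjointed_sets[of N M] by blast
  have "(\<lambda>n. cinner (Q (disjointed N n) h) h) sums cinner (Q (\<Union>n. disjointed N n) h) h"
    using D by (intro cmeas_sums[OF cmeas_pvm[OF Q h h]]) (auto simp: disjoint_family_disjointed)
  moreover have "Q (disjointed N n) = zero_op" for n
    by (rule pvm_zero_op_mono[OF Q N D disjointed_subset])
  ultimately have "(\<lambda>n. 0) sums cinner (Q (\<Union>n. N n) h) h"
    by (simp add: UN_disjointed_eq zero_op_def)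
  then show "cinner (Q (\<Union>n. N n) h) h = 0" using sums_unique2[OF sums_zero] by metis
qed (use N in auto)

section \<open>Block decompositions of Hilbert-Schmidt operators\<close>

lemma has_sum_finite_sum:
  fixes f :: "'i \<Rightarrow> 'e \<Rightarrow> real"
  assumes "finite X" "\<And>x. x \<in> X \<Longrightarrow> (f x has_sum l x) E"
  shows "((\<lambda>e. \<Sum>x\<in>X. f x e) has_sum (\<Sum>x\<in>X. l x)) E"
  using assms by (induction X rule: finite_induct) (auto intro: has_sum_add)

text \<open>The numbers \<open>\<beta> i j\<close> are the Hilbert-Schmidt norms of the blocks,
  which dominate their operator norms. Cutting by disjoint projections does not increase the sum of
  squares: on the left this is \<open>pvm_sum_norm_le\<close>, on the right it is the same fact for
  the adjoint.\<close>

lemma hs_bound_blocks: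
  assumes Q1: "pvm_space M1 K1 Q1" and Q2: "pvm_space M2 K2 Q2"
    and b: "b \<in> bounded_ops K2 K1" and C: "hs_bound K2 b C"
    and I: "finite I" "\<And>i. i \<in> I \<Longrightarrow> A i \<in> sets M1" "disjoint_family_on A I"
    and J: "finite J" "\<And>j. j \<in> J \<Longrightarrow> B j \<in> sets M2" "disjoint_family_on B J"
  shows "\<exists>\<beta>. (\<forall>i j. 0 \<le> \<beta> i j) \<and> (\<forall>i\<in>I. \<forall>j\<in>J. \<forall>v. norm (Q1 (A i) (b (Q2 (B j) v))) \<le> \<beta> i j * norm v) \<and>
     (\<Sum>i\<in>I. \<Sum>j\<in>J. (\<beta> i j)\<^sup>2) \<le> C\<^sup>2"
proof -
  note K1 = pvm_spaceD(1,2)[OF Q1] and K2 = pvm_spaceD(1,2)[OF Q2]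
  note E1 = onb_some_onb[OF K1(1)] and E2 = onb_some_onb[OF K2(1)]
  obtain c where c: "c \<in> bounded_ops K1 K2" "\<forall>h\<in>K2. \<forall>k\<in>K1. cinner (b h) k = cinner h (c k)"
    using adjoint_exists[OF b K2(1) K1(2)] by blast
  define T where "T i j v = Q1 (A i) (b (Q2 (B j) v))" for i j v
  have T: "T i j \<in> bounded_ops K2 K1" if "i \<in> I" "j \<in> J" for i j
    using bounded_ops_comp[OF pvm_spaceD(3)[OF Q1 I(2)[OF that(1)]] bounded_ops_comp[OF b pvm_spaceD(3)[OF Q2 J(2)[OF that(2)]]]]
    unfolding T_def comp_def by simp
  \<comment> \<open>The adjoint satisfies the same bound, since the squared moduli of the matrix
    entries can be summed in either order.\<close>
  have adj: "(\<Sum>f\<in>F. (norm (c f))\<^sup>2) \<le> C\<^sup>2" if F: "finite F" "F \<subseteq> some_onb K1" for F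
  proof (rule Parseval_le[OF E2 F(1)])
    have FK: "f \<in> K1" if "f \<in> F" for f using that F onb_subset[OF E1] by blast
    then show "c f \<in> K2" if "f \<in> F" for f using that by (intro bounded_opsD(1)[OF c(1)])
    fix G assume G: "finite G" "G \<subseteq> some_onb K2"
    have "(\<Sum>f\<in>F. \<Sum>e\<in>G. (cmod (cinner (c f) e))\<^sup>2) = (\<Sum>e\<in>G. \<Sum>f\<in>F. (cmod (cinner (b e) f))\<^sup>2)"
    proof (subst sum.swap, intro sum.cong refl)
      fix e f assume "e \<in> G" "f \<in> F"
      then have "cinner (b e) f = cinner e (c f)" using c(2) FK G onb_subset[OF E2] by blast
      then show "(cmod (cinner (c f) e))\<^sup>2 = (cmod (cinner (b e) f))\<^sup>2"
        using cinner_commute[of e "c f"] by simp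
    qed
    also have "\<dots> \<le> (\<Sum>e\<in>G. (norm (b e))\<^sup>2)"
      by (intro sum_mono Bessel[OF onb_ortho_set[OF E1] F])
    also have "\<dots> \<le> C\<^sup>2" by (rule hs_boundD(2)[OF C G])
    finally show "(\<Sum>f\<in>F. \<Sum>e\<in>G. (cmod (cinner (c f) e))\<^sup>2) \<le> C\<^sup>2" .
  qed
  \<comment> \<open>Here the projections act on the argument of \<open>b\<close>. Moving them
    through the adjoint lets them act on the vectors \<open>c f\<close>, where disjointness can be
    used.\<close>
  have right: "(\<Sum>(j, e)\<in>J \<times> G. (norm (b (Q2 (B j) e)))\<^sup>2) \<le> C\<^sup>2" if G: "finite G" "G \<subseteq> some_onb K2" for G
  proof (rule order_trans[OF eq_refl Parseval_le[OF E1, of "J \<times> G" "\<lambda>(j, e). b (Q2 (B j) e)"]])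
    show "finite (J \<times> G)" using J G by simp
    have GK: "e \<in> K2" if "e \<in> G" for e using that G onb_subset[OF E2] by blast
    then show "(case a of (j, e) \<Rightarrow> b (Q2 (B j) e)) \<in> K1" if "a \<in> J \<times> G" for a
      using that J by (auto intro!: bounded_opsD(1)[OF b] pvm_in[OF Q2])
    fix F assume F: "finite F" "F \<subseteq> some_onb K1"
    have FK: "f \<in> K1" if "f \<in> F" for f using that F onb_subset[OF E1] by blast
    have "(\<Sum>a\<in>J \<times> G. \<Sum>f\<in>F. (cmod (cinner (case a of (j, e) \<Rightarrow> b (Q2 (B j) e)) f))\<^sup>2)
      = (\<Sum>j\<in>J. \<Sum>e\<in>G. \<Sum>f\<in>F. (cmod (cinner (b (Q2 (B j) e)) f))\<^sup>2)"
      unfolding sum.cartesian_product[of _ G J] by (intro sum.cong refl) auto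
    also have "\<dots> = (\<Sum>j\<in>J. \<Sum>e\<in>G. \<Sum>f\<in>F. (cmod (cinner (Q2 (B j) (c f)) e))\<^sup>2)"
    proof (intro sum.cong refl)
      fix j e f assume "j \<in> J" "e \<in> G" and f: "f \<in> F"
      then have je: "j \<in> J" "e \<in> K2" using GK by auto
      have "cinner (b (Q2 (B j) e)) f = cinner (Q2 (B j) e) (c f)"
        using c(2) FK[OF f] pvm_in[OF Q2 J(2)] je by blast
      also have "\<dots> = cinner e (Q2 (B j) (c f))"
        using je FK[OF f] by (intro pvm_spaceD(6)[OF Q2 J(2)] bounded_opsD(1)[OF c(1)])
      finally show "(cmod (cinner (b (Q2 (B j) e)) f))\<^sup>2 = (cmod (cinner (Q2 (B j) (c f)) e))\<^sup>2"
        using cinner_commute[of e "Q2 (B j) (c f)"] by simp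
    qed
    also have "\<dots> = (\<Sum>j\<in>J. \<Sum>f\<in>F. \<Sum>e\<in>G. (cmod (cinner (Q2 (B j) (c f)) e))\<^sup>2)"
      by (intro sum.cong refl sum.swap)
    also have "\<dots> \<le> (\<Sum>j\<in>J. \<Sum>f\<in>F. (norm (Q2 (B j) (c f)))\<^sup>2)"
      by (intro sum_mono Bessel[OF onb_ortho_set[OF E2] G])
    also have "\<dots> = (\<Sum>f\<in>F. \<Sum>j\<in>J. (norm (Q2 (B j) (c f)))\<^sup>2)" by (rule sum.swap)
    also have "\<dots> \<le> (\<Sum>f\<in>F. (norm (c f))\<^sup>2)" by (intro sum_mono pvm_sum_norm_le[OF Q2 J])
    also have "\<dots> \<le> C\<^sup>2" by (rule adj[OF F])
    finally show "(\<Sum>a\<in>J \<times> G. \<Sum>f\<in>F. (cmod (cinner (case a of (j, e) \<Rightarrow> b (Q2 (B j) e)) f))\<^sup>2) \<le> C\<^sup>2" .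
  qed (auto intro!: sum.cong)
  have blocks: "(\<Sum>i\<in>I. \<Sum>j\<in>J. \<Sum>e\<in>G. (norm (T i j e))\<^sup>2) \<le> C\<^sup>2" if G: "finite G" "G \<subseteq> some_onb K2" for G
  proof -
    have "(\<Sum>i\<in>I. \<Sum>j\<in>J. \<Sum>e\<in>G. (norm (T i j e))\<^sup>2) = (\<Sum>j\<in>J. \<Sum>e\<in>G. \<Sum>i\<in>I. (norm (T i j e))\<^sup>2)"
      by (subst sum.swap) (intro sum.cong refl sum.swap)
    also have "\<dots> \<le> (\<Sum>j\<in>J. \<Sum>e\<in>G. (norm (b (Q2 (B j) e)))\<^sup>2)"
      unfolding T_def by (intro sum_mono pvm_sum_norm_le[OF Q1 I])
    also have "\<dots> \<le> C\<^sup>2" using right[OF G] by (simp add: sum.cartesian_product)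
    finally show ?thesis .
  qed
  have bd: "hs_bound K2 (T i j) C" if ij: "i \<in> I" "j \<in> J" for i j
    unfolding hs_bound_def
  proof (intro conjI allI impI)
    show "0 \<le> C" by (rule hs_boundD(1)[OF C])
    fix F assume F: "finite F \<and> F \<subseteq> some_onb K2"
    have "(\<Sum>e\<in>F. (norm (T i j e))\<^sup>2) \<le> (\<Sum>j\<in>J. \<Sum>e\<in>F. (norm (T i j e))\<^sup>2)"
      using ij J by (intro member_le_sum[where f="\<lambda>j. \<Sum>e\<in>F. (norm (T i j e))\<^sup>2"]) (auto intro: sum_nonneg)
    also have "\<dots> \<le> (\<Sum>i\<in>I. \<Sum>j\<in>J. \<Sum>e\<in>F. (norm (T i j e))\<^sup>2)"
      using ij I by (intro member_le_sum[where f="\<lambda>i. \<Sum>j\<in>J. \<Sum>e\<in>F. (norm (T i j e))\<^sup>2"]) (auto intro!: sum_nonneg)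
    also have "\<dots> \<le> C\<^sup>2" using blocks F by blast
    finally show "(\<Sum>e\<in>F. (norm (T i j e))\<^sup>2) \<le> C\<^sup>2" .
  qed
  define \<beta> where "\<beta> i j = hs_norm K2 (T i j)" for i j
  have summ: "(\<lambda>e. (norm (T i j e))\<^sup>2) summable_on some_onb K2" if "i \<in> I" "j \<in> J" for i j
    by (rule hs_bound_summable[OF bd[OF that]])
  have "norm (T i j v) \<le> \<beta> i j * norm v" if "i \<in> I" "j \<in> J" for i j v
    unfolding \<beta>_def by (rule norm_le_hs_bound[OF T[OF that] K2(1) hs_bound_hs_norm[OF summ[OF that]]])
  moreover have "(\<Sum>i\<in>I. \<Sum>j\<in>J. (\<beta> i j)\<^sup>2) \<le> C\<^sup>2"
  proof -
    \<comment> \<open>As \<open>I\<close> and \<open>J\<close> are finite, the sum of the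
      \<open>(\<beta> i j)\<^sup>2\<close> is a single infinite sum over the basis, and its finite
      partial sums are bounded by \<open>blocks\<close>.\<close>
    have "((\<lambda>e. \<Sum>i\<in>I. \<Sum>j\<in>J. (norm (T i j e))\<^sup>2) has_sum (\<Sum>i\<in>I. \<Sum>j\<in>J. (\<beta> i j)\<^sup>2)) (some_onb K2)"
      using summ by (intro has_sum_finite_sum I J) (simp add: \<beta>_def hs_norm_def infsum_nonneg)
    then show ?thesis
    proof (rule has_sum_le_finite_sums)
      fix F assume F: "finite F" "F \<subseteq> some_onb K2"
      have "(\<Sum>e\<in>F. \<Sum>i\<in>I. \<Sum>j\<in>J. (norm (T i j e))\<^sup>2) = (\<Sum>i\<in>I. \<Sum>j\<in>J. \<Sum>e\<in>F. (norm (T i j e))\<^sup>2)"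
        by (subst sum.swap) (intro sum.cong refl sum.swap)
      then show "(\<Sum>e\<in>F. \<Sum>i\<in>I. \<Sum>j\<in>J. (norm (T i j e))\<^sup>2) \<le> C\<^sup>2" using blocks[OF F] by simp
    qed
  qed
  moreover have "0 \<le> \<beta> i j" for i j by (simp add: \<beta>_def hs_norm_nonneg)
  ultimately show ?thesis unfolding T_def by (intro exI[of _ \<beta>]) simp
qed

section \<open>Integration with respect to projection valued measures\<close>

lemma bounded_simple_approx:
  fixes f :: "'w \<Rightarrow> complex"
  assumes f: "f \<in> borel_measurable M" and c: "\<And>x. x \<in> space M \<Longrightarrow> cmod (f x) \<le> c"
  shows "\<exists>s. (\<forall>n. simple_function M (s n)) \<and> (\<forall>x\<in>space M. (\<lambda>n. s n x) \<longlonglongrightarrow> f x) \<and>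
    (\<forall>n. \<forall>x\<in>space M. cmod (s n x) \<le> 2 * c)"
proof -
  obtain s where s: "\<forall>n. simple_function M (s n)" "\<forall>x\<in>space M. (\<lambda>n. s n x) \<longlonglongrightarrow> f x"
    "\<forall>n. \<forall>x\<in>space M. dist (s n x) 0 \<le> 2 * dist (f x) 0"
    using borel_measurable_implies_sequence_metric[OF f, of 0] by blast
  have "cmod (s n x) \<le> 2 * c" if x: "x \<in> space M" for n x
    using s(3)[rule_format, OF x, of n] c[OF x] by (simp add: dist_norm)
  then show ?thesis using s(1,2) by blast
qed

text \<open>On a level set \<open>cinner (Q G h) k\<close> equals
  \<open>cinner (Q G h) (Q G k)\<close>. Cauchy-Schwarz over the disjoint level sets then gives a
  bound by the supremum of \<open>s\<close> without the total variation of the measure.\<close>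

lemma pvm_simple_bound:
  assumes Q: "pvm_space M K Q" and hk: "h \<in> K" "k \<in> K" and s: "simple_function M s"
    and c: "\<And>x. x \<in> space M \<Longrightarrow> cmod (s x) \<le> c" "c \<ge> 0"
  shows "cmod (cint M (\<lambda>G. cinner (Q G h) k) s) \<le> c * norm h * norm k"
proof -
  define G where "G z = s -` {z} \<inter> space M" for z
  have fin: "finite (s ` space M)" and G: "G z \<in> sets M" for z
    unfolding G_def by (rule simple_functionD[OF s])+
  have disj: "disjoint_family_on G (s ` space M)" by (auto simp: disjoint_family_on_def G_def)
  have L2: "L2_set (\<lambda>z. norm (Q (G z) x)) (s ` space M) \<le> norm x" for x
    unfolding L2_set_def using pvm_sum_norm_le[OF Q fin G disj, of x] by (intro real_le_lsqrt) (auto intro: sum_nonneg)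
  have "cmod (z * cinner (Q (G z) h) k) \<le> c * (\<bar>norm (Q (G z) h)\<bar> * \<bar>norm (Q (G z) k)\<bar>)"
    if "z \<in> s ` space M" for z
  proof -
    have "cinner (Q (G z) h) k = cinner (Q (G z) h) (Q (G z) k)"
      using pvm_spaceD(6)[OF Q G, of "Q (G z) h" k z] pvm_spaceD(5)[OF Q G] pvm_in[OF Q G] hk by metis
    then have "cmod (cinner (Q (G z) h) k) \<le> norm (Q (G z) h) * norm (Q (G z) k)"
      by (simp add: Cauchy_Schwarz_cinner)
    then show ?thesis using that c by (auto simp: norm_mult intro!: mult_mono)
  qed
  then have "cmod (\<Sum>z\<in>s ` space M. z * cinner (Q (G z) h) k) \<le>
      (\<Sum>z\<in>s ` space M. c * (\<bar>norm (Q (G z) h)\<bar> * \<bar>norm (Q (G z) k)\<bar>))"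
    by (intro order_trans[OF norm_sum] sum_mono)
  also have "\<dots> = c * (\<Sum>z\<in>s ` space M. \<bar>norm (Q (G z) h)\<bar> * \<bar>norm (Q (G z) k)\<bar>)"
    by (simp add: sum_distrib_left)
  also have "\<dots> \<le> c * (L2_set (\<lambda>z. norm (Q (G z) h)) (s ` space M) * L2_set (\<lambda>z. norm (Q (G z) k)) (s ` space M))"
    using c(2) by (intro mult_left_mono L2_set_mult_ineq)
  also have "\<dots> \<le> c * (norm h * norm k)"
    using c(2) L2 by (intro mult_left_mono mult_mono) auto
  finally show ?thesis
    unfolding cint_simple[OF cmeas_pvm[OF Q hk] s] G_def by (simp add: mult.assoc)
qed

text \<open>The Jordan parts of \<open>cinner (Q G h) k\<close> do not depend linearly on the
  vectors. Sesquilinearity is therefore read off from simple functions, where \<open>cint\<close> is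
  a finite sum in the measure itself, and passes to the limit.\<close>

lemma pvm_operator_exists:
  assumes Q: "pvm_space M K Q" and f: "f \<in> borel_measurable M"
    and c: "\<And>x. x \<in> space M \<Longrightarrow> cmod (f x) \<le> c" "c \<ge> 0"
  shows "\<exists>T\<in>bounded_ops K K. \<forall>h\<in>K. \<forall>k\<in>K. cinner (T h) k = cint M (\<lambda>G. cinner (Q G h) k) f"
proof -
  note K = pvm_spaceD(1,2)[OF Q]
  from bounded_simple_approx[OF f c(1)]
  obtain s where s0: "(\<forall>n. simple_function M (s n)) \<and> (\<forall>x\<in>space M. (\<lambda>n. s n x) \<longlonglongrightarrow> f x) \<and>
    (\<forall>n. \<forall>x\<in>space M. cmod (s n x) \<le> 2 * c)" by (rule exE)
  have s: "\<And>n. simple_function M (s n)" "\<And>x. x\<in>space M \<Longrightarrow> (\<lambda>n. s n x) \<longlonglongrightarrow> f x"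
    "\<And>n x. x\<in>space M \<Longrightarrow> cmod (s n x) \<le> 2 * c" using s0 by auto
  have G: "s n -` {z} \<inter> space M \<in> sets M" for n z by (rule simple_functionD(2)[OF s(1)])
  define B where "B h k = cint M (\<lambda>G. cinner (Q G h) k) f" for h k
  have lim: "(\<lambda>n. cint M (\<lambda>G. cinner (Q G h) k) (s n)) \<longlonglongrightarrow> B h k" if "h \<in> K" "k \<in> K" for h k
    unfolding B_def using s by (intro cint_tendsto[OF cmeas_pvm[OF Q that]] borel_measurable_simple_function)
  have lim': "(\<lambda>n. \<Sum>z\<in>s n ` space M. z * cinner (Q (s n -` {z} \<inter> space M) h) k) \<longlonglongrightarrow> B h k" if "h \<in> K" "k \<in> K" for h k
    using lim[OF that] by (simp add: cint_simple[OF cmeas_pvm[OF Q that] s(1)])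
  have "\<exists>T\<in>bounded_ops K K. \<forall>h\<in>K. \<forall>k\<in>K. cinner (T h) k = B h k"
  \<comment> \<open>The factor 2 is inherited from the simple approximations, which are bounded only
    by twice the bound of \<open>f\<close>.\<close>
  proof (rule bounded_ops_of_form[OF K(2,1), of "2 * c"])
    fix x y k assume *: "x \<in> K" "y \<in> K" "k \<in> K"
    have "(\<lambda>n. (\<Sum>z\<in>s n ` space M. z * cinner (Q (s n -` {z} \<inter> space M) x) k) +
        (\<Sum>z\<in>s n ` space M. z * cinner (Q (s n -` {z} \<inter> space M) y) k)) \<longlonglongrightarrow> B x k + B y k"
      using * by (intro tendsto_add lim')
    then show "B (x + y) k = B x k + B y k"
      using lim'[of "x + y" k] * csubspaceD[OF K(2)]
      by (intro LIMSEQ_unique[OF lim'[of "x + y" k]])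
        (auto simp: bounded_opsD(3)[OF pvm_spaceD(3)[OF Q G]] cinner_add_left distrib_left sum.distrib)
  next
    fix x y k assume *: "k \<in> K" "x \<in> K" "y \<in> K"
    have "(\<lambda>n. (\<Sum>z\<in>s n ` space M. z * cinner (Q (s n -` {z} \<inter> space M) k) x) +
        (\<Sum>z\<in>s n ` space M. z * cinner (Q (s n -` {z} \<inter> space M) k) y)) \<longlonglongrightarrow> B k x + B k y"
      using * by (intro tendsto_add lim')
    then show "B k (x + y) = B k x + B k y"
      using * csubspaceD[OF K(2)]
      by (intro LIMSEQ_unique[OF lim'[of k "x + y"]])
        (auto simp: cinner_add_right distrib_left sum.distrib)
  next
    fix a x k assume *: "x \<in> K" "k \<in> K"
    have "(\<lambda>n. a * (\<Sum>z\<in>s n ` space M. z * cinner (Q (s n -` {z} \<inter> space M) x) k)) \<longlonglongrightarrow> a * B x k"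
      using * by (intro tendsto_mult_left lim')
    then show "B (a *\<^sub>C x) k = a * B x k"
      using * csubspaceD[OF K(2)]
      by (intro LIMSEQ_unique[OF lim'[of "a *\<^sub>C x" k]])
        (auto simp: bounded_opsD(4)[OF pvm_spaceD(3)[OF Q G]] cinner_scaleC_left sum_distrib_left mult_ac)
    have "(\<lambda>n. cnj a * (\<Sum>z\<in>s n ` space M. z * cinner (Q (s n -` {z} \<inter> space M) x) k)) \<longlonglongrightarrow> cnj a * B x k"
      using * by (intro tendsto_mult_left lim')
    then show "B x (a *\<^sub>C k) = cnj a * B x k"
      using * csubspaceD[OF K(2)]
      by (intro LIMSEQ_unique[OF lim'[of x "a *\<^sub>C k"]])
        (auto simp: cinner_scaleC_right sum_distrib_left mult_ac)
    show "cmod (B x k) \<le> 2 * c * norm x * norm k"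
      using tendsto_norm[OF lim[OF *]] s(1,3) c(2) *
      by (intro LIMSEQ_le_const2[of "\<lambda>n. cmod (cint M (\<lambda>G. cinner (Q G x) k) (s n))"])
        (auto intro!: exI[of _ 0] pvm_simple_bound[OF Q])
  qed (use c in auto)
  then show ?thesis by (simp add: B_def)
qed

section \<open>Essentially bounded functions and almost everywhere statements\<close>

definition truncate :: "real \<Rightarrow> ('w \<Rightarrow> complex) \<Rightarrow> 'w \<Rightarrow> complex" where
  "truncate c f x = (if cmod (f x) \<le> c then f x else 0)"

lemma truncate_measurable:
  assumes [measurable]: "f \<in> borel_measurable M"
  shows "truncate c f \<in> borel_measurable M"
  unfolding truncate_def[abs_def] by measurable

lemma cmod_truncate: "c \<ge> 0 \<Longrightarrow> cmod (truncate c f x) \<le> c"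
  by (simp add: truncate_def)

lemma pvm_AE_truncate:
  assumes f: "f \<in> borel_measurable M" and c: "Q {x \<in> space M. cmod (f x) > c} = zero_op"
  shows "pvm_AE M Q (\<lambda>x. truncate c f x = f x)"
  unfolding pvm_AE_def using f c
  by (intro bexI[of _ "{x \<in> space M. cmod (f x) > c}"]) (auto simp: truncate_def)

text \<open>The hypothesis \<open>ac\<close> concerns single sets only. It passes to their
  measurable subsets, as the Jordan parts require, because subsets of sets with zero projection have
  zero projection.\<close>

lemma AE_jordan:
  assumes \<nu>: "cmeas M \<nu>" and Q: "pvm_space M K Q"
    and ac: "\<And>N. N \<in> sets M \<Longrightarrow> Q N = zero_op \<Longrightarrow> \<nu> N = 0"
    and R: "pvm_AE M Q R"
  shows "AE x in jordan M \<nu> i. R x"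
proof -
  obtain N where N: "N \<in> sets M" "Q N = zero_op" "{x \<in> space M. \<not> R x} \<subseteq> N"
    using R by (auto simp: pvm_AE_def)
  have "N \<in> null_sets (jordan M \<nu> i)"
    using N ac pvm_zero_op_mono[OF Q N(1,2)] by (intro jordan_null[OF \<nu>]) auto
  then show ?thesis using N(3) by (intro AE_I') auto
qed

text \<open>The representative \<open>f\<close> may be unbounded on a null set. Every coefficient
  measure ignores that set, so the operator of the truncated function has the defining property of
  \<open>pvm_integral\<close>.\<close>

lemma pvm_integral_eq:
  assumes Q: "pvm_space M K Q" and f: "f \<in> borel_measurable M"
    and c: "c \<ge> 0" "Q {x \<in> space M. cmod (f x) > c} = zero_op"
  shows "pvm_integral M K Q f \<in> bounded_ops K K"
    and "h \<in> K \<Longrightarrow> k \<in> K \<Longrightarrow> cinner (pvm_integral M K Q f h) k = cint M (\<lambda>G. cinner (Q G h) k) (truncate c f)"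
proof -
  note t = truncate_measurable[OF f] cmod_truncate[OF c(1)]
  obtain T where T: "T \<in> bounded_ops K K"
    "\<forall>h\<in>K. \<forall>k\<in>K. cinner (T h) k = cint M (\<lambda>G. cinner (Q G h) k) (truncate c f)"
    using pvm_operator_exists[OF Q t c(1)] by blast
  have eq: "cmeasure_integral M (\<lambda>G. cinner (Q G h) k) f = cint M (\<lambda>G. cinner (Q G h) k) (truncate c f)"
    if hk: "h \<in> K" "k \<in> K" for h k
  proof -
    note \<nu> = cmeas_pvm[OF Q hk]
    have ae: "AE x in jordan M (\<lambda>G. cinner (Q G h) k) i. truncate c f x = f x" for i
      by (rule AE_jordan[OF \<nu> Q _ pvm_AE_truncate[of f M Q c, OF f c(2)]]) (simp add: zero_op_def)
    have "integrable (jordan M (\<lambda>G. cinner (Q G h) k) i) f" for i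
    proof (rule integrable_cong_AE_imp[OF integrable_jordan_bounded[OF \<nu> t]])
      show "AE x in jordan M (\<lambda>G. cinner (Q G h) k) i. truncate c f x = f x" by (rule ae)
    qed (use f in auto)
    then have "cmeasure_integral M (\<lambda>G. cinner (Q G h) k) f = cint M (\<lambda>G. cinner (Q G h) k) f"
      by (intro cmeasure_integral_eq_cint[OF \<nu>])
    also have "\<dots> = cint M (\<lambda>G. cinner (Q G h) k) (truncate c f)"
      using ae by (intro cint_AE_cong[OF t(1) f, symmetric])
    finally show ?thesis .
  qed
  have "pvm_integral M K Q f = T"
    unfolding pvm_integral_def
  proof (rule the_equality)
    show "T \<in> bounded_ops K K \<and> (\<forall>h\<in>K. \<forall>k\<in>K. cinner (T h) k = cmeasure_integral M (\<lambda>G. cinner (Q G h) k) f)"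
      using T eq by simp
    fix S assume "S \<in> bounded_ops K K \<and> (\<forall>h\<in>K. \<forall>k\<in>K. cinner (S h) k = cmeasure_integral M (\<lambda>G. cinner (Q G h) k) f)"
    then show "S = T" using T eq by (intro bounded_ops_eqI[OF pvm_spaceD(2)[OF Q]]) auto
  qed
  then show "pvm_integral M K Q f \<in> bounded_ops K K"
    "h \<in> K \<Longrightarrow> k \<in> K \<Longrightarrow> cinner (pvm_integral M K Q f h) k = cint M (\<lambda>G. cinner (Q G h) k) (truncate c f)"
    using T by auto
qed

text \<open>The infimum is attained: the set where it is exceeded is the union of the sets
  \<open>N n\<close> where it is exceeded by \<open>1 / Suc n\<close>, and each of these lies in a
  null set. Functions can thus be truncated exactly at the essential norm.\<close>

lemma Linf_norm:
  assumes Q: "pvm_space M K Q" and f: "f \<in> Linf M Q"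
  shows "Linf_norm M Q f \<ge> 0" "Q {x \<in> space M. cmod (f x) > Linf_norm M Q f} = zero_op"
proof -
  define S where "S = {c. c \<ge> 0 \<and> Q {x \<in> space M. cmod (f x) > c} = zero_op}"
  have L: "Linf_norm M Q f = Inf S" by (simp add: Linf_norm_def S_def)
  have [measurable]: "f \<in> borel_measurable M" and ne: "S \<noteq> {}" using f by (auto simp: Linf_def S_def)
  show nn: "Linf_norm M Q f \<ge> 0" unfolding L using ne by (intro cInf_greatest) (auto simp: S_def)
  have bdd: "bdd_below S" by (intro bdd_belowI[of _ 0]) (auto simp: S_def)
  define N where "N n = {x \<in> space M. cmod (f x) > Linf_norm M Q f + 1 / real (Suc n)}" for n
  have N: "N n \<in> sets M" for n unfolding N_def by measurable
  have "Q (N n) = zero_op" for n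
  proof -
    have "Inf S < Linf_norm M Q f + 1 / real (Suc n)" by (simp add: L)
    then obtain c where c: "c \<in> S" "c < Linf_norm M Q f + 1 / real (Suc n)"
      using ne bdd by (meson cInf_less_iff)
    have "{x \<in> space M. cmod (f x) > c} \<in> sets M" by measurable
    then show ?thesis
      by (rule pvm_zero_op_mono[OF Q _ _ N]) (use c in \<open>auto simp: S_def N_def\<close>)
  qed
  then have "Q (\<Union>n. N n) = zero_op" using N by (intro pvm_zero_op_UN[OF Q])
  moreover have "(\<Union>n. N n) = {x \<in> space M. cmod (f x) > Linf_norm M Q f}"
  proof (intro set_eqI iffI)
    fix x assume "x \<in> (\<Union>n. N n)"
    then obtain n where n: "x \<in> space M" "Linf_norm M Q f + 1 / real (Suc n) < cmod (f x)" by (auto simp: N_def)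
    have "Linf_norm M Q f < Linf_norm M Q f + 1 / real (Suc n)" by simp
    also note n(2)
    finally show "x \<in> {x \<in> space M. cmod (f x) > Linf_norm M Q f}" using n(1) by simp
  next
    fix x assume x: "x \<in> {x \<in> space M. cmod (f x) > Linf_norm M Q f}"
    then obtain n where "1 / real (Suc n) < cmod (f x) - Linf_norm M Q f"
      using nat_approx_posE[of "cmod (f x) - Linf_norm M Q f"] by auto
    then show "x \<in> (\<Union>n. N n)" using x by (auto simp: N_def intro!: exI[of _ n])
  qed
  ultimately show "Q {x \<in> space M. cmod (f x) > Linf_norm M Q f} = zero_op" by simp
qed

section \<open>Operator products\<close>

lemma op_chain_bounded_ops:
  assumes "\<And>j. j \<in> {1..k+1} \<Longrightarrow> A j \<in> bounded_ops (H j) (H j)"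
    and "\<And>j. j \<in> {1..k} \<Longrightarrow> b j \<in> bounded_ops (H (j + 1)) (H j)"
  shows "op_chain k A b \<in> bounded_ops (H (k + 1)) (H 1)"
  using assms
proof (induction k)
  case (Suc k)
  have 1: "op_chain k A b \<in> bounded_ops (H (Suc k)) (H 1)" using Suc by auto
  have 2: "b (Suc k) \<in> bounded_ops (H (Suc (Suc k))) (H (Suc k))" using Suc.prems(2)[of "Suc k"] by auto
  have 3: "A (Suc (Suc k)) \<in> bounded_ops (H (Suc (Suc k))) (H (Suc (Suc k)))"
    using Suc.prems(1)[of "Suc (Suc k)"] by auto
  show ?case using bounded_ops_comp[OF bounded_ops_comp[OF 1 2] 3]
    unfolding op_chain.simps by (simp only: Suc_eq_plus1[symmetric])
qed auto

lemma op_chain_cong: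
  "(\<And>j. j \<in> {1..k+1} \<Longrightarrow> A j = A' j) \<Longrightarrow> op_chain k A b = op_chain k A' b"
  by (induction k) auto

text \<open>The factors to the right of the slot act on \<open>h\<close>, the adjoint of those to
  the left acts on \<open>h'\<close>. The vectors \<open>x\<close> and \<open>y\<close> are chosen
  before \<open>X\<close>, so the coefficient can be studied as a function of
  \<open>X\<close>.\<close>

lemma op_chain_slot:
  assumes "\<And>j. j \<in> {1..k+1} \<Longrightarrow> hilbert_space (H j)"
    and "\<And>j. j \<in> {1..k+1} \<Longrightarrow> A j \<in> bounded_ops (H j) (H j)"
    and "\<And>j. j \<in> {1..k} \<Longrightarrow> b j \<in> bounded_ops (H (j + 1)) (H j)"
    and "m \<in> {1..k+1}" "h \<in> H (k + 1)" "h' \<in> H 1"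
  shows "\<exists>x\<in>H m. \<exists>y\<in>H m. \<forall>X\<in>bounded_ops (H m) (H m). cinner (op_chain k (A(m := X)) b h) h' = cinner (X x) y"
  using assms
proof (induction k arbitrary: h)
  case 0
  then have "m = 1" by simp
  then show ?case using 0 by (intro bexI[of _ h] bexI[of _ h']) auto
next
  case (Suc k)
  have b: "b (Suc k) \<in> bounded_ops (H (k + 2)) (H (k + 1))" using Suc.prems(3)[of "Suc k"] by auto
  show ?case
  proof (cases "m = k + 2")
    case True
    have "op_chain k A b \<in> bounded_ops (H (k + 1)) (H 1)"
      using Suc.prems(2,3) by (intro op_chain_bounded_ops) auto
    then have "op_chain k A b \<circ> b (Suc k) \<in> bounded_ops (H (k + 2)) (H 1)"
      by (rule bounded_ops_comp[OF _ b])
    moreover have "hilbert_space (H (k + 2))" "csubspace (H 1)"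
      using Suc.prems(1)[of "k + 2"] hilbert_space_csubspace[OF Suc.prems(1)[of 1]] by auto
    ultimately obtain S where S: "S \<in> bounded_ops (H 1) (H (k + 2))"
      "\<forall>x\<in>H (k + 2). \<forall>y\<in>H 1. cinner ((op_chain k A b \<circ> b (Suc k)) x) y = cinner x (S y)"
      using adjoint_exists by blast
    have "cinner (op_chain (Suc k) (A(m := X)) b h) h' = cinner (X h) (S h')"
      if X: "X \<in> bounded_ops (H m) (H m)" for X
    proof -
      have "op_chain k (A(m := X)) b = op_chain k A b" using True by (intro op_chain_cong) auto
      moreover have "X h \<in> H (k + 2)" using bounded_opsD(1)[OF X] Suc.prems(5) True by simp
      ultimately show ?thesis using S(2) Suc.prems(6) True by simp
    qed
    moreover have "h \<in> H m" "S h' \<in> H m" using Suc.prems(5,6) True bounded_opsD(1)[OF S(1)] by auto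
    ultimately show ?thesis by blast
  next
    case False
    have "A (k + 2) \<in> bounded_ops (H (k + 2)) (H (k + 2))" using Suc.prems(2)[of "k + 2"] by auto
    \<comment> \<open>The last two operators are absorbed into the vector, for which the induction
      leaves \<open>h\<close> arbitrary.\<close>
    then have "b (Suc k) (A (k + 2) h) \<in> H (k + 1)"
      using bounded_opsD(1)[OF b] bounded_opsD(1)[of "A (k+2)"] Suc.prems(5) by auto
    then have "\<exists>x\<in>H m. \<exists>y\<in>H m. \<forall>X\<in>bounded_ops (H m) (H m).
        cinner (op_chain k (A(m := X)) b (b (Suc k) (A (k + 2) h))) h' = cinner (X x) y"
      using Suc.prems False by (intro Suc.IH) auto
    moreover have "op_chain (Suc k) (A(m := X)) b h = op_chain k (A(m := X)) b (b (Suc k) (A (k + 2) h))" for X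
      using False by simp
    ultimately show ?thesis by (simp only:)
  qed
qed

lemma cint_indicator:
  assumes \<nu>: "cmeas M \<nu>" and G: "G \<in> sets M"
  shows "cint M \<nu> (indicator G) = \<nu> G"
proof -
  have "integral\<^sup>L (jordan M \<nu> i) (indicator G) = complex_of_real (measure (jordan M \<nu> i) G)" for i
  proof -
    interpret finite_measure "jordan M \<nu> i" by (rule finite_measure_jordan[OF \<nu>])
    have "integral\<^sup>L (jordan M \<nu> i) (indicator G :: _ \<Rightarrow> complex) =
      integral\<^sup>L (jordan M \<nu> i) (\<lambda>x. complex_of_real (indicator G x))"
      by (intro Bochner_Integration.integral_cong) (auto simp: indicator_def)
    then show ?thesis using G by simp
  qed
  then show ?thesis unfolding cint_def jordan_decomposition[OF \<nu> G] by simp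
qed

lemma cint_lincomb:
  assumes "\<And>z i. z \<in> Z \<Longrightarrow> integrable (jordan M \<nu> i) (F z)"
  shows "cint M \<nu> (\<lambda>x. \<Sum>z\<in>Z. a z * F z x) = (\<Sum>z\<in>Z. a z * cint M \<nu> (F z))"
proof -
  have "cint M \<nu> (\<lambda>x. \<Sum>z\<in>Z. a z * F z x) = (\<Sum>i<4. \<Sum>z\<in>Z. a z * (\<i> ^ i * integral\<^sup>L (jordan M \<nu> i) (F z)))"
    unfolding cint_def using assms by (intro sum.cong refl) (simp add: sum_distrib_left mult_ac)
  also have "\<dots> = (\<Sum>z\<in>Z. a z * cint M \<nu> (F z))"
    by (subst sum.swap) (simp add: cint_def sum_distrib_left)
  finally show ?thesis .
qed

lemma cint_cong: "(\<And>x. x \<in> space M \<Longrightarrow> f x = g x) \<Longrightarrow> cint M \<nu> f = cint M \<nu> g"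
  unfolding cint_def by (intro sum.cong arg_cong2[of _ _ _ _ "(*)"] Bochner_Integration.integral_cong) auto

text \<open>Change of variables: \<open>\<kappa>\<close> is the image under \<open>p\<close> of
  \<open>\<nu>\<close> with density \<open>g\<close>. In the application \<open>p\<close> is a
  coordinate and \<open>g\<close> the product of the remaining factors.\<close>

lemma cint_transport:
  assumes \<nu>: "cmeas M \<nu>" and \<kappa>: "cmeas N \<kappa>" and p[measurable]: "p \<in> measurable M N"
    and g[measurable]: "g \<in> borel_measurable M" and gc: "\<And>x. x \<in> space M \<Longrightarrow> cmod (g x) \<le> C" "C \<ge> 0"
    and eq: "\<And>S. S \<in> sets N \<Longrightarrow> \<kappa> S = cint M \<nu> (\<lambda>x. g x * indicator S (p x))"
    and f: "f \<in> borel_measurable N" and fc: "\<And>x. x \<in> space N \<Longrightarrow> cmod (f x) \<le> c"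
  shows "cint N \<kappa> f = cint M \<nu> (\<lambda>x. g x * f (p x))"
proof -
  from bounded_simple_approx[OF f fc]
  obtain s where s0: "(\<forall>n. simple_function N (s n)) \<and> (\<forall>x\<in>space N. (\<lambda>n. s n x) \<longlonglongrightarrow> f x) \<and>
    (\<forall>n. \<forall>x\<in>space N. cmod (s n x) \<le> 2 * c)" by (rule exE)
  have s: "\<And>n. simple_function N (s n)" "\<And>x. x\<in>space N \<Longrightarrow> (\<lambda>n. s n x) \<longlonglongrightarrow> f x"
    "\<And>n x. x\<in>space N \<Longrightarrow> cmod (s n x) \<le> 2 * c" using s0 by auto
  have sm[measurable]: "s n \<in> borel_measurable N" for n by (rule borel_measurable_simple_function[OF s(1)])
  have pN: "p x \<in> space N" if "x \<in> space M" for x using that measurable_space[OF p] by blast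
  have "cint N \<kappa> (s n) = cint M \<nu> (\<lambda>x. g x * s n (p x))" for n
  proof -
    have fin: "finite (s n ` space N)" and G[measurable]: "\<And>z. s n -` {z} \<inter> space N \<in> sets N"
      by (rule simple_functionD[OF s(1)])+
    have "cint N \<kappa> (s n) = (\<Sum>z\<in>s n ` space N. z * cint M \<nu> (\<lambda>x. g x * indicator (s n -` {z} \<inter> space N) (p x)))"
      unfolding cint_simple[OF \<kappa> s(1)] using G by (simp add: eq)
    also have "\<dots> = cint M \<nu> (\<lambda>x. \<Sum>z\<in>s n ` space N. z * (g x * indicator (s n -` {z} \<inter> space N) (p x)))"
      by (intro cint_lincomb[symmetric] integrable_jordan_bounded[OF \<nu>, where c=C])
        (use gc in \<open>auto simp: norm_mult indicator_def\<close>)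
    also have "\<dots> = cint M \<nu> (\<lambda>x. g x * s n (p x))"
    proof (rule cint_cong)
      fix x assume "x \<in> space M"
      then have "(\<Sum>z\<in>s n ` space N. z * (g x * indicator (s n -` {z} \<inter> space N) (p x))) =
         (\<Sum>z\<in>s n ` space N. if z = s n (p x) then g x * z else 0)"
        using pN by (intro sum.cong) (auto simp: indicator_def)
      then show "(\<Sum>z\<in>s n ` space N. z * (g x * indicator (s n -` {z} \<inter> space N) (p x))) = g x * s n (p x)"
        using fin pN \<open>x \<in> space M\<close> by simp
    qed
    finally show ?thesis .
  qed
  moreover have "(\<lambda>n. cint N \<kappa> (s n)) \<longlonglongrightarrow> cint N \<kappa> f"
    using s by (intro cint_tendsto[OF \<kappa>, where c="2 * c"]) auto
  moreover have "(\<lambda>n. cint M \<nu> (\<lambda>x. g x * s n (p x))) \<longlonglongrightarrow> cint M \<nu> (\<lambda>x. g x * f (p x))"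
    using s pN gc by (intro cint_tendsto[OF \<nu>, where c="C * (2 * c)"])
      (auto simp: norm_mult intro!: mult_mono tendsto_mult)
  ultimately show ?thesis using LIMSEQ_unique by simp
qed

lemma op_chain_cint:
  fixes k :: nat
  defines "J \<equiv> {1..k+1}"
  assumes P: "\<And>j. j \<in> J \<Longrightarrow> pvm_space (M j) (H j) (P j)"
    and b: "\<And>j. j \<in> {1..k} \<Longrightarrow> b j \<in> bounded_ops (H (j + 1)) (H j)"
    and h: "h \<in> H (k + 1)" "h' \<in> H 1"
    and \<nu>: "cmeas (PiM J M) \<nu>"
    and rect: "\<And>G. G \<in> (\<Pi> j\<in>J. sets (M j)) \<Longrightarrow> \<nu> (PiE J G) = cinner (op_chain k (\<lambda>j. P j (G j)) b h) h'"
    and f: "\<And>j. j \<in> J \<Longrightarrow> f j \<in> borel_measurable (M j)"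
    and c: "\<And>j x. j \<in> J \<Longrightarrow> x \<in> space (M j) \<Longrightarrow> cmod (f j x) \<le> c j" "\<And>j. c j \<ge> 0"
    and A: "\<And>j. j \<in> J \<Longrightarrow> A j \<in> bounded_ops (H j) (H j)"
      "\<And>j x y. j \<in> J \<Longrightarrow> x \<in> H j \<Longrightarrow> y \<in> H j \<Longrightarrow> cinner (A j x) y = cint (M j) (\<lambda>G. cinner (P j G x) y) (f j)"
  shows "cinner (op_chain k A b h) h' = cint (PiM J M) \<nu> (\<lambda>\<omega>. \<Prod>j\<in>J. f j (\<omega> j))"
proof -
  have finJ: "finite J" by (simp add: J_def)
  \<comment> \<open>\<open>m\<close> counts the sides already replaced by functions.
    \<open>G\<close> varies in the induction because the step uses the hypothesis for every
    measurable set in side \<open>m + 1\<close>.\<close>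
  have claim: "cinner (op_chain k (\<lambda>j. if j \<le> m then A j else P j (G j)) b h) h' =
      cint (PiM J M) \<nu> (\<lambda>\<omega>. \<Prod>j\<in>J. if j \<le> m then f j (\<omega> j) else indicator (G j) (\<omega> j))"
    if "m \<le> k + 1" "G \<in> (\<Pi> j\<in>J. sets (M j))" for m G
    using that
  proof (induction m arbitrary: G)
    case 0
    have G: "PiE J G \<in> sets (PiM J M)" using 0 finJ by (intro sets_PiM_I_finite) auto
    have "cinner (op_chain k (\<lambda>j. if j \<le> 0 then A j else P j (G j)) b h) h' = \<nu> (PiE J G)"
      unfolding rect[OF 0(2)] by (subst op_chain_cong[where A'="\<lambda>j. P j (G j)"]) auto
    also have "\<dots> = cint (PiM J M) \<nu> (indicator (PiE J G))" by (rule cint_indicator[OF \<nu> G, symmetric])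
    also have "\<dots> = cint (PiM J M) \<nu> (\<lambda>\<omega>. \<Prod>j\<in>J. if j \<le> 0 then f j (\<omega> j) else indicator (G j) (\<omega> j))"
    proof (rule cint_cong)
      fix \<omega> assume \<omega>: "\<omega> \<in> space (PiM J M)"
      have "(\<Prod>j\<in>J. if j \<le> 0 then f j (\<omega> j) else indicator (G j) (\<omega> j)) = (\<Prod>j\<in>J. indicator (G j) (\<omega> j) :: complex)"
        by (intro prod.cong) (auto simp: J_def)
      also have "\<dots> = (if \<forall>j\<in>J. \<omega> j \<in> G j then 1 else 0)"
        using finJ by (auto simp: prod_zero_iff indicator_def)
      also have "\<dots> = indicator (PiE J G) \<omega>" using \<omega> by (auto simp: space_PiM PiE_iff indicator_def)
      finally show "indicator (PiE J G) \<omega> = (\<Prod>j\<in>J. if j \<le> 0 then f j (\<omega> j) else indicator (G j) (\<omega> j) :: complex)"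
        by simp
    qed
    finally show ?case .
  next
    case (Suc m)
    let ?n = "Suc m"
    have n: "?n \<in> J" using Suc.prems by (simp add: J_def)
    define A' where "A' j = (if j \<le> m then A j else P j (G j))" for j
    have A': "A' j \<in> bounded_ops (H j) (H j)" if "j \<in> J" for j
      using A(1)[OF that] pvm_spaceD(3)[OF P[OF that]] Suc.prems(2) that by (auto simp: A'_def)
    obtain x y where xy: "x \<in> H ?n" "y \<in> H ?n"
      "\<forall>X\<in>bounded_ops (H ?n) (H ?n). cinner (op_chain k (A'(?n := X)) b h) h' = cinner (X x) y"
      using op_chain_slot[where H=H and k=k and A=A' and b=b and m="?n" and h=h and h'=h'] pvm_spaceD(1)[OF P] A' b h n
      unfolding J_def by blast
    define g where "g \<omega> = (\<Prod>j\<in>J - {?n}. if j \<le> m then f j (\<omega> j) else indicator (G j) (\<omega> j))" for \<omega>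
    have gm: "g \<in> borel_measurable (PiM J M)" unfolding g_def
    proof (intro borel_measurable_prod)
      fix j assume j: "j \<in> J - {?n}"
      then have [measurable]: "f j \<in> borel_measurable (M j)" "G j \<in> sets (M j)" "j \<in> J" using f Suc.prems(2) by auto
      show "(\<lambda>\<omega>. if j \<le> m then f j (\<omega> j) else indicator (G j) (\<omega> j)) \<in> borel_measurable (PiM J M)"
        by measurable
    qed
    \<comment> \<open>The maximum with 1 bounds both kinds of factors, functions and
      indicators.\<close>
    have gc: "cmod (g \<omega>) \<le> (\<Prod>j\<in>J - {?n}. max 1 (c j))" if "\<omega> \<in> space (PiM J M)" for \<omega>
      unfolding g_def prod_norm[symmetric]
    proof (intro prod_mono conjI)
      fix j assume "j \<in> J - {?n}"
      then have "cmod (f j (\<omega> j)) \<le> c j" using that by (intro c) (auto simp: space_PiM)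
      then show "cmod (if j \<le> m then f j (\<omega> j) else indicator (G j) (\<omega> j)) \<le> max 1 (c j)"
        by (auto simp: indicator_def)
    qed auto
    have split: "(\<Prod>j\<in>J. F j) = (\<Prod>j\<in>J - {?n}. F j) * F ?n" for F :: "nat \<Rightarrow> complex"
      using finJ n by (simp add: prod.remove mult.commute)
    \<comment> \<open>As a function of the side \<open>S\<close> the coefficient is a scalar measure
      of one factor, and the induction hypothesis identifies it with the image of
      \<open>\<nu>\<close> with density \<open>g\<close>.\<close>
    have step: "cinner (P ?n S x) y = cint (PiM J M) \<nu> (\<lambda>\<omega>. g \<omega> * indicator S (\<omega> ?n))"
      if S: "S \<in> sets (M ?n)" for S
    proof -
      have "cinner (P ?n S x) y = cinner (op_chain k (A'(?n := P ?n S)) b h) h'"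
        using xy(3) pvm_spaceD(3)[OF P[OF n] S] by simp
      also have "A'(?n := P ?n S) = (\<lambda>j. if j \<le> m then A j else P j ((G(?n := S)) j))"
        by (auto simp: A'_def fun_eq_iff)
      also have "cinner (op_chain k (\<lambda>j. if j \<le> m then A j else P j ((G(?n := S)) j)) b h) h' =
        cint (PiM J M) \<nu> (\<lambda>\<omega>. \<Prod>j\<in>J. if j \<le> m then f j (\<omega> j) else indicator ((G(?n := S)) j) (\<omega> j))"
        using Suc.prems S by (intro Suc.IH) auto
      also have "\<dots> = cint (PiM J M) \<nu> (\<lambda>\<omega>. g \<omega> * indicator S (\<omega> ?n))"
        unfolding split g_def by (intro cint_cong arg_cong2[of _ _ _ _ "(*)"] prod.cong) auto
      finally show ?thesis .
    qed
    have "cinner (op_chain k (\<lambda>j. if j \<le> ?n then A j else P j (G j)) b h) h' = cinner (op_chain k (A'(?n := A ?n)) b h) h'"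
      by (intro arg_cong[of _ _ "\<lambda>T. cinner (T h) h'"] op_chain_cong) (auto simp: A'_def)
    also have "\<dots> = cinner (A ?n x) y" using xy(3) A(1)[OF n] by blast
    also have "\<dots> = cint (M ?n) (\<lambda>G. cinner (P ?n G x) y) (f ?n)" by (rule A(2)[OF n xy(1,2)])
    also have "\<dots> = cint (PiM J M) \<nu> (\<lambda>\<omega>. g \<omega> * f ?n (\<omega> ?n))"
    proof (rule cint_transport[OF \<nu> cmeas_pvm[OF P[OF n] xy(1,2)] _ gm gc _ step f[OF n] c(1)[OF n]])
      show "(\<lambda>\<omega>. \<omega> ?n) \<in> measurable (PiM J M) (M ?n)" by (rule measurable_component_singleton[OF n])
      show "0 \<le> (\<Prod>j\<in>J - {?n}. max 1 (c j))" by (intro prod_nonneg) auto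
    qed
    also have "\<dots> = cint (PiM J M) \<nu> (\<lambda>\<omega>. \<Prod>j\<in>J. if j \<le> ?n then f j (\<omega> j) else indicator (G j) (\<omega> j))"
      unfolding split g_def by (intro cint_cong arg_cong2[of _ _ _ _ "(*)"] prod.cong) auto
    finally show ?case .
  qed
  \<comment> \<open>With \<open>m = k + 1\<close> no indicator remains, so the whole spaces can
    stand in for the sides.\<close>
  have "cinner (op_chain k A b h) h' = cinner (op_chain k (\<lambda>j. if j \<le> k + 1 then A j else P j (space (M j))) b h) h'"
    by (intro arg_cong[of _ _ "\<lambda>T. cinner (T h) h'"] op_chain_cong) auto
  also have "\<dots> = cint (PiM J M) \<nu> (\<lambda>\<omega>. \<Prod>j\<in>J. if j \<le> k + 1 then f j (\<omega> j) else indicator (space (M j)) (\<omega> j))"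
    by (rule claim) auto
  also have "\<dots> = cint (PiM J M) \<nu> (\<lambda>\<omega>. \<Prod>j\<in>J. f j (\<omega> j))"
    by (intro cint_cong prod.cong) (auto simp: J_def)
  finally show ?thesis .
qed

section \<open>Absolute continuity of \<open>P#b\<close>\<close>

text \<open>Grids are given by functions \<open>q j\<close> with finitely many values on the factors, so that pairing
  two such functions gives a common refinement.\<close>

definition grid_sets :: "nat set \<Rightarrow> (nat \<Rightarrow> 'w measure) \<Rightarrow> (nat \<Rightarrow> 'w) set set" where
  "grid_sets J M = {{\<omega>\<in>space (PiM J M). R (\<lambda>j\<in>J. q j (\<omega> j))} | q R.
     \<forall>j\<in>J. q j \<in> measurable (M j) (count_space (UNIV::nat set)) \<and> finite (q j ` space (M j))}"

definition grid_cell :: "(nat \<Rightarrow> 'w measure) \<Rightarrow> (nat \<Rightarrow> 'w \<Rightarrow> nat) \<Rightarrow> nat \<Rightarrow> nat \<Rightarrow> 'w set" where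
  "grid_cell M q j i = q j -` {i} \<inter> space (M j)"

lemma grid_set_eq_UN:
  "{\<omega>\<in>space (PiM J M). R (\<lambda>j\<in>J. q j (\<omega> j))} =
     (\<Union>r\<in>{r\<in>PiE J (\<lambda>j. q j ` space (M j)). R r}. PiE J (\<lambda>j. grid_cell M q j (r j)))"
proof (intro set_eqI iffI)
  fix \<omega> assume \<omega>: "\<omega> \<in> {\<omega>\<in>space (PiM J M). R (\<lambda>j\<in>J. q j (\<omega> j))}"
  then have "(\<lambda>j\<in>J. q j (\<omega> j)) \<in> {r\<in>PiE J (\<lambda>j. q j ` space (M j)). R r}"
    by (auto simp: space_PiM PiE_iff)
  moreover have "\<omega> \<in> PiE J (\<lambda>j. grid_cell M q j ((\<lambda>j\<in>J. q j (\<omega> j)) j))"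
    using \<omega> by (auto simp: space_PiM PiE_iff grid_cell_def)
  ultimately show "\<omega> \<in> (\<Union>r\<in>{r\<in>PiE J (\<lambda>j. q j ` space (M j)). R r}. PiE J (\<lambda>j. grid_cell M q j (r j)))"
    by blast
next
  fix \<omega> assume "\<omega> \<in> (\<Union>r\<in>{r\<in>PiE J (\<lambda>j. q j ` space (M j)). R r}. PiE J (\<lambda>j. grid_cell M q j (r j)))"
  then obtain r where r: "r \<in> PiE J (\<lambda>j. q j ` space (M j))" "R r" "\<omega> \<in> PiE J (\<lambda>j. grid_cell M q j (r j))" by blast
  then have "(\<lambda>j\<in>J. q j (\<omega> j)) = r"
    by (intro ext) (auto simp: PiE_iff grid_cell_def extensional_def)
  then show "\<omega> \<in> {\<omega>\<in>space (PiM J M). R (\<lambda>j\<in>J. q j (\<omega> j))}"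
    using r by (auto simp: space_PiM PiE_iff grid_cell_def)
qed

lemma disjoint_grid_cells:
  "disjoint_family_on (\<lambda>r. PiE J (\<lambda>j. grid_cell M q j (r j))) (PiE J I)"
  unfolding disjoint_family_on_def
proof (intro ballI impI)
  fix r s assume rs: "r \<in> PiE J I" "s \<in> PiE J I" "r \<noteq> s"
  then obtain j where j: "j \<in> J" "r j \<noteq> s j" by (metis PiE_ext)
  have "\<omega> \<notin> PiE J (\<lambda>j. grid_cell M q j (s j))" if "\<omega> \<in> PiE J (\<lambda>j. grid_cell M q j (r j))" for \<omega>
    using PiE_mem[OF that j(1)] PiE_mem[of \<omega> J "\<lambda>j. grid_cell M q j (s j)", OF _ j(1)] j(2)
    by (auto simp: grid_cell_def)
  then show "PiE J (\<lambda>j. grid_cell M q j (r j)) \<inter> PiE J (\<lambda>j. grid_cell M q j (s j)) = {}" by blast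
qed

lemma grid_cell_sets:
  "q j \<in> measurable (M j) (count_space (UNIV::nat set)) \<Longrightarrow> grid_cell M q j i \<in> sets (M j)"
  unfolding grid_cell_def by (rule measurable_sets) auto

lemma algebra_grid_sets:
  "algebra (space (PiM J M)) (grid_sets J M)"
  unfolding algebra_iff_Un
proof (intro conjI ballI)
  show "grid_sets J M \<subseteq> Pow (space (PiM J M))" by (auto simp: grid_sets_def)
  show "{} \<in> grid_sets J M" unfolding grid_sets_def
    by (intro CollectI exI[of _ "\<lambda>_ _. 0"] exI[of _ "\<lambda>_. False"]) (auto intro: finite_subset[of _ "{0}"])
next
  fix a assume "a \<in> grid_sets J M"
  then obtain q R where q: "\<forall>j\<in>J. q j \<in> measurable (M j) (count_space (UNIV::nat set)) \<and> finite (q j ` space (M j))"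
    and a: "a = {\<omega>\<in>space (PiM J M). R (\<lambda>j\<in>J. q j (\<omega> j))}" unfolding grid_sets_def by auto
  have "space (PiM J M) - a = {\<omega>\<in>space (PiM J M). \<not> R (\<lambda>j\<in>J. q j (\<omega> j))}" using a by auto
  then show "space (PiM J M) - a \<in> grid_sets J M" unfolding grid_sets_def
    using q by (intro CollectI exI[of _ q] exI[of _ "\<lambda>r. \<not> R r"]) simp
next
  fix a b assume "a \<in> grid_sets J M" "b \<in> grid_sets J M"
  then obtain q R q' R' where q: "\<forall>j\<in>J. q j \<in> measurable (M j) (count_space (UNIV::nat set)) \<and> finite (q j ` space (M j))"
    and a: "a = {\<omega>\<in>space (PiM J M). R (\<lambda>j\<in>J. q j (\<omega> j))}"
    and q': "\<forall>j\<in>J. q' j \<in> measurable (M j) (count_space (UNIV::nat set)) \<and> finite (q' j ` space (M j))"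
    and b: "b = {\<omega>\<in>space (PiM J M). R' (\<lambda>j\<in>J. q' j (\<omega> j))}" unfolding grid_sets_def by auto
  define p where "p j x = prod_encode (q j x, q' j x)" for j x
  define S where "S r \<longleftrightarrow> R (\<lambda>j\<in>J. fst (prod_decode (r j))) \<or> R' (\<lambda>j\<in>J. snd (prod_decode (r j)))" for r
  have "S (\<lambda>j\<in>J. p j (\<omega> j)) \<longleftrightarrow> R (\<lambda>j\<in>J. q j (\<omega> j)) \<or> R' (\<lambda>j\<in>J. q' j (\<omega> j))" for \<omega>
  proof -
    have "(\<lambda>j\<in>J. fst (prod_decode ((\<lambda>j\<in>J. p j (\<omega> j)) j))) = (\<lambda>j\<in>J. q j (\<omega> j))"
      "(\<lambda>j\<in>J. snd (prod_decode ((\<lambda>j\<in>J. p j (\<omega> j)) j))) = (\<lambda>j\<in>J. q' j (\<omega> j))"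
      by (auto simp: p_def intro!: restrict_ext)
    then show ?thesis by (simp only: S_def)
  qed
  then have ab: "a \<union> b = {\<omega>\<in>space (PiM J M). S (\<lambda>j\<in>J. p j (\<omega> j))}" unfolding a b by auto
  have "p j \<in> measurable (M j) (count_space UNIV) \<and> finite (p j ` space (M j))" if j: "j \<in> J" for j
  proof
    have [measurable]: "q j \<in> measurable (M j) (count_space UNIV)" "q' j \<in> measurable (M j) (count_space UNIV)"
      using q q' j by auto
    show "p j \<in> measurable (M j) (count_space UNIV)" unfolding p_def[abs_def] by measurable
    have "p j ` space (M j) \<subseteq> prod_encode ` (q j ` space (M j) \<times> q' j ` space (M j))" by (auto simp: p_def)
    then show "finite (p j ` space (M j))" using q q' j by (elim finite_subset) auto
  qed
  then show "a \<union> b \<in> grid_sets J M" unfolding grid_sets_def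
    by (intro CollectI exI[of _ p] exI[of _ S]) (simp add: ab)
qed

lemma sets_PiM_grid_sets:
  assumes J: "finite J"
  shows "sets (PiM J M) = sigma_sets (space (PiM J M)) (grid_sets J M)"
proof
  show "sigma_sets (space (PiM J M)) (grid_sets J M) \<subseteq> sets (PiM J M)"
  proof (rule sets.sigma_sets_subset, rule subsetI)
    fix a assume "a \<in> grid_sets J M"
    then obtain q R where q: "\<forall>j\<in>J. q j \<in> measurable (M j) (count_space (UNIV::nat set)) \<and> finite (q j ` space (M j))"
      and a: "a = {\<omega>\<in>space (PiM J M). R (\<lambda>j\<in>J. q j (\<omega> j))}" unfolding grid_sets_def by auto
    have "finite (PiE J (\<lambda>j. q j ` space (M j)))" using q J by (intro finite_PiE) auto
    then show "a \<in> sets (PiM J M)" unfolding a grid_set_eq_UN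
      using q J by (intro sets.finite_UN sets_PiM_I_finite) (auto intro: grid_cell_sets)
  qed
  have "prod_algebra J M \<subseteq> grid_sets J M"
  proof
    fix a assume "a \<in> prod_algebra J M"
    then obtain X where X: "X \<in> (\<Pi> j\<in>J. sets (M j))" "a = PiE J X" unfolding prod_algebra_eq_finite[OF J] by auto
    \<comment> \<open>Membership in each side is the label, so the rectangle is the grid set on
      which all labels are 1.\<close>
    define q where "q j x = (if x \<in> X j then 1 else 0::nat)" for j x
    have "a = {\<omega>\<in>space (PiM J M). \<forall>j\<in>J. (\<lambda>j\<in>J. q j (\<omega> j)) j = 1}"
    proof (intro set_eqI iffI)
      fix \<omega> assume "\<omega> \<in> a"
      then have \<omega>: "\<omega> \<in> PiE J X" by (simp add: X)
      have "\<omega> j \<in> space (M j)" if "j \<in> J" for j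
        using PiE_mem[OF \<omega> that] X(1) that sets.sets_into_space[of "X j" "M j"] by blast
      then show "\<omega> \<in> {\<omega>\<in>space (PiM J M). \<forall>j\<in>J. (\<lambda>j\<in>J. q j (\<omega> j)) j = 1}"
        using \<omega> by (simp add: space_PiM PiE_iff q_def)
    next
      fix \<omega> assume \<omega>: "\<omega> \<in> {\<omega>\<in>space (PiM J M). \<forall>j\<in>J. (\<lambda>j\<in>J. q j (\<omega> j)) j = 1}"
      then have "\<omega> j \<in> X j" if "j \<in> J" for j using that by (auto simp: q_def split: if_splits)
      then show "\<omega> \<in> a" using \<omega> by (simp add: X space_PiM PiE_iff)
    qed
    moreover have "q j \<in> measurable (M j) (count_space UNIV) \<and> finite (q j ` space (M j))" if j: "j \<in> J" for j
    proof
      have [measurable]: "X j \<in> sets (M j)" using X j by auto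
      show "q j \<in> measurable (M j) (count_space UNIV)" unfolding q_def[abs_def] by measurable
      show "finite (q j ` space (M j))" by (rule finite_subset[of _ "{0,1}"]) (auto simp: q_def)
    qed
    ultimately show "a \<in> grid_sets J M" unfolding grid_sets_def
      by (intro CollectI exI[of _ q] exI[of _ "\<lambda>r. \<forall>j\<in>J. r j = 1"]) auto
  qed
  then show "sets (PiM J M) \<subseteq> sigma_sets (space (PiM J M)) (grid_sets J M)"
    unfolding sets_PiM space_PiM by (rule sigma_sets_subseteq)
qed

text \<open>Functions \<open>c\<close> of the sides \<open>G\<close> of a rectangle in \<open>n + 1\<close> factors and of a vector in the last
  space, as \<open>\<langle>P\<^sub>1(G\<^sub>1) b\<^sub>1 \<cdots> b\<^sub>n P\<^sub>n\<^sub>+\<^sub>1(G\<^sub>n\<^sub>+\<^sub>1) v, h'\<rangle>\<close>.\<close>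

definition rect_functional :: "(nat \<Rightarrow> 'w measure) \<Rightarrow> (nat \<Rightarrow> 'a::complex_inner set) \<Rightarrow>
    (nat \<Rightarrow> 'w set \<Rightarrow> 'a \<Rightarrow> 'a) \<Rightarrow> nat \<Rightarrow> ((nat \<Rightarrow> 'w set) \<Rightarrow> 'a \<Rightarrow> complex) \<Rightarrow> bool" where
  "rect_functional M H P n c \<longleftrightarrow>
     (\<forall>G G'. (\<forall>j\<in>{1..n+1}. G j = G' j) \<longrightarrow> c G = c G') \<and>
     (\<forall>G\<in>(\<Pi> j\<in>{1..n+1}. sets (M j)).
       (\<forall>x\<in>H (n+1). \<forall>y\<in>H (n+1). c G (x + y) = c G x + c G y) \<and>
       (\<forall>a. \<forall>x\<in>H (n+1). c G (a *\<^sub>C x) = a * c G x) \<and>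
       (\<forall>x\<in>H (n+1). c G (P (n+1) (G (n+1)) x) = c G x))"

text \<open>The variation bound of Pavlov and of Birman and Solomyak on grids, in a form that allows
  induction on \<open>n\<close>: the vector may depend on the cell, through a weight of its last index.\<close>

definition grid_bound :: "(nat \<Rightarrow> 'w measure) \<Rightarrow> (nat \<Rightarrow> 'a::complex_inner set) \<Rightarrow> nat \<Rightarrow>
    ((nat \<Rightarrow> 'w set) \<Rightarrow> 'a \<Rightarrow> complex) \<Rightarrow> real \<Rightarrow> bool" where
  "grid_bound M H n c C \<longleftrightarrow> C \<ge> 0 \<and>
     (\<forall>(I :: nat \<Rightarrow> nat set) D t v.
        (\<forall>j\<in>{1..n+1}. finite (I j) \<and> (\<forall>i\<in>I j. D j i \<in> sets (M j)) \<and> disjoint_family_on (D j) (I j)) \<longrightarrow>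
        (\<forall>r\<in>PiE {1..n+1} I. v r \<in> H (n+1) \<and> norm (v r) \<le> t (r (n+1))) \<longrightarrow>
        (\<Sum>r\<in>PiE {1..n+1} I. cmod (c (\<lambda>j. D j (r j)) (v r))) \<le> C * L2_set t (I (n+1)))"

lemma rect_functionalD:
  assumes "rect_functional M H P n c"
  shows "(\<And>j. j \<in> {1..n+1} \<Longrightarrow> G j = G' j) \<Longrightarrow> c G = c G'"
    and "G \<in> (\<Pi> j\<in>{1..n+1}. sets (M j)) \<Longrightarrow> x \<in> H (n+1) \<Longrightarrow> y \<in> H (n+1) \<Longrightarrow> c G (x + y) = c G x + c G y"
    and "G \<in> (\<Pi> j\<in>{1..n+1}. sets (M j)) \<Longrightarrow> x \<in> H (n+1) \<Longrightarrow> c G (a *\<^sub>C x) = a * c G x"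
    and "G \<in> (\<Pi> j\<in>{1..n+1}. sets (M j)) \<Longrightarrow> x \<in> H (n+1) \<Longrightarrow> c G (P (n+1) (G (n+1)) x) = c G x"
proof -
  note c1 = conjunct1[OF assms[unfolded rect_functional_def]]
    and c2 = bspec[OF conjunct2[OF assms[unfolded rect_functional_def]]]
  show "(\<And>j. j \<in> {1..n+1} \<Longrightarrow> G j = G' j) \<Longrightarrow> c G = c G'"
    by (rule c1[rule_format])
  assume "G \<in> (\<Pi> j\<in>{1..n+1}. sets (M j))"
  note c3 = c2[OF this]
  show "x \<in> H (n+1) \<Longrightarrow> y \<in> H (n+1) \<Longrightarrow> c G (x + y) = c G x + c G y" using c3 by blast
  show "x \<in> H (n+1) \<Longrightarrow> c G (a *\<^sub>C x) = a * c G x" using c3 by blast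
  show "x \<in> H (n+1) \<Longrightarrow> c G (P (n+1) (G (n+1)) x) = c G x" using c3 by blast
qed

lemma rect_functional_lincomb:
  assumes c: "rect_functional M H P n c" and G: "G \<in> (\<Pi> j\<in>{1..n+1}. sets (M j))"
    and H: "csubspace (H (n+1))" and x: "\<And>i. i \<in> I \<Longrightarrow> x i \<in> H (n+1)"
  shows "c G (\<Sum>i\<in>I. a i *\<^sub>C x i) = (\<Sum>i\<in>I. a i * c G (x i))"
  using x
proof (induction I rule: infinite_finite_induct)
  case (insert i I)
  have "c G (a i *\<^sub>C x i + (\<Sum>i\<in>I. a i *\<^sub>C x i)) = c G (a i *\<^sub>C x i) + c G (\<Sum>i\<in>I. a i *\<^sub>C x i)"
    using insert.prems by (intro rect_functionalD(2)[OF c G] csubspace_sum[OF H] csubspaceD[OF H]) auto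
  then show ?case using insert rect_functionalD(3)[OF c G, of "x i" "a i"] by simp
qed (use rect_functionalD(3)[OF c G csubspaceD(1)[OF H], of 0] in simp_all)

lemma grid_boundD:
  fixes I :: "nat \<Rightarrow> nat set"
  assumes "grid_bound M H n c C"
  shows "C \<ge> 0"
    and "\<lbrakk>\<And>j. j \<in> {1..n+1} \<Longrightarrow> finite (I j); \<And>j i. j \<in> {1..n+1} \<Longrightarrow> i \<in> I j \<Longrightarrow> D j i \<in> sets (M j);
      \<And>j. j \<in> {1..n+1} \<Longrightarrow> disjoint_family_on (D j) (I j);
      \<And>r. r \<in> PiE {1..n+1} I \<Longrightarrow> v r \<in> H (n+1); \<And>r. r \<in> PiE {1..n+1} I \<Longrightarrow> norm (v r) \<le> t (r (n+1))\<rbrakk>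
      \<Longrightarrow> (\<Sum>r\<in>PiE {1..n+1} I. cmod (c (\<lambda>j. D j (r j)) (v r))) \<le> C * L2_set t (I (n+1))"
proof -
  show "C \<ge> 0" using assms by (simp add: grid_bound_def)
  assume *: "\<And>j. j \<in> {1..n+1} \<Longrightarrow> finite (I j)" "\<And>j i. j \<in> {1..n+1} \<Longrightarrow> i \<in> I j \<Longrightarrow> D j i \<in> sets (M j)"
      "\<And>j. j \<in> {1..n+1} \<Longrightarrow> disjoint_family_on (D j) (I j)"
      "\<And>r. r \<in> PiE {1..n+1} I \<Longrightarrow> v r \<in> H (n+1)" "\<And>r. r \<in> PiE {1..n+1} I \<Longrightarrow> norm (v r) \<le> t (r (n+1))"
  show "(\<Sum>r\<in>PiE {1..n+1} I. cmod (c (\<lambda>j. D j (r j)) (v r))) \<le> C * L2_set t (I (n+1))"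
    by (rule mp[OF mp[OF spec[OF spec[OF spec[OF spec[OF
      conjunct2[OF assms[unfolded grid_bound_def]], of I], of D], of t], of v]]]) (use * in simp_all)
qed

lemma grid_boundI:
  assumes "C \<ge> 0"
    and "\<And>(I :: nat \<Rightarrow> nat set) D t v. \<lbrakk>\<And>j. j \<in> {1..n+1} \<Longrightarrow> finite (I j); \<And>j i. j \<in> {1..n+1} \<Longrightarrow> i \<in> I j \<Longrightarrow> D j i \<in> sets (M j);
      \<And>j. j \<in> {1..n+1} \<Longrightarrow> disjoint_family_on (D j) (I j);
      \<And>r. r \<in> PiE {1..n+1} I \<Longrightarrow> v r \<in> H (n+1); \<And>r. r \<in> PiE {1..n+1} I \<Longrightarrow> norm (v r) \<le> t (r (n+1))\<rbrakk>
      \<Longrightarrow> (\<Sum>r\<in>PiE {1..n+1} I. cmod (c (\<lambda>j. D j (r j)) (v r))) \<le> C * L2_set t (I (n+1))"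
  shows "grid_bound M H n c C"
  unfolding grid_bound_def
proof (intro conjI allI impI)
  fix I :: "nat \<Rightarrow> nat set" and D t v
  assume *: "\<forall>j\<in>{1..n+1}. finite (I j) \<and> (\<forall>i\<in>I j. D j i \<in> sets (M j)) \<and> disjoint_family_on (D j) (I j)"
    "\<forall>r\<in>PiE {1..n+1} I. v r \<in> H (n+1) \<and> norm (v r) \<le> t (r (n+1))"
  show "(\<Sum>r\<in>PiE {1..n+1} I. cmod (c (\<lambda>j. D j (r j)) (v r))) \<le> C * L2_set t (I (n+1))"
    by (rule assms(2)) (use * in blast)+
qed (rule assms(1))

lemma grid_bound_add:
  assumes "grid_bound M H n c C" "grid_bound M H n d B"
    and eq: "\<And>G v. G \<in> (\<Pi> j\<in>{1..n+1}. sets (M j)) \<Longrightarrow> v \<in> H (n+1) \<Longrightarrow> cmod (e G v) \<le> cmod (c G v) + cmod (d G v)"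
  shows "grid_bound M H n e (C + B)"
proof (rule grid_boundI)
  show "C + B \<ge> 0" using assms(1,2) by (simp add: grid_bound_def)
  fix I :: "nat \<Rightarrow> nat set" and D t v
  assume *: "\<And>j. j \<in> {1..n+1} \<Longrightarrow> finite (I j)" "\<And>j i. j \<in> {1..n+1} \<Longrightarrow> i \<in> I j \<Longrightarrow> D j i \<in> sets (M j)"
      "\<And>j. j \<in> {1..n+1} \<Longrightarrow> disjoint_family_on (D j) (I j)"
      "\<And>r. r \<in> PiE {1..n+1} I \<Longrightarrow> v r \<in> H (n+1)" "\<And>r. r \<in> PiE {1..n+1} I \<Longrightarrow> norm (v r) \<le> t (r (n+1))"
  have "(\<Sum>r\<in>PiE {1..n+1} I. cmod (e (\<lambda>j. D j (r j)) (v r))) \<le>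
    (\<Sum>r\<in>PiE {1..n+1} I. cmod (c (\<lambda>j. D j (r j)) (v r)) + cmod (d (\<lambda>j. D j (r j)) (v r)))"
    using * by (intro sum_mono eq) (auto simp: PiE_iff)
  also have "\<dots> \<le> C * L2_set t (I (n+1)) + B * L2_set t (I (n+1))"
    unfolding sum.distrib by (intro add_mono grid_boundD(2)[OF assms(1)] grid_boundD(2)[OF assms(2)] *)
  finally show "(\<Sum>r\<in>PiE {1..n+1} I. cmod (e (\<lambda>j. D j (r j)) (v r))) \<le> (C + B) * L2_set t (I (n+1))"
    by (simp add: distrib_right)
qed

lemma grid_bound_mono:
  assumes "grid_bound M H n c C" "C \<le> B"
  shows "grid_bound M H n c B"
proof (rule grid_boundI)
  show "B \<ge> 0" using assms by (simp add: grid_bound_def)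
  fix I :: "nat \<Rightarrow> nat set" and D t v
  assume *: "\<And>j. j \<in> {1..n+1} \<Longrightarrow> finite (I j)" "\<And>j i. j \<in> {1..n+1} \<Longrightarrow> i \<in> I j \<Longrightarrow> D j i \<in> sets (M j)"
      "\<And>j. j \<in> {1..n+1} \<Longrightarrow> disjoint_family_on (D j) (I j)"
      "\<And>r. r \<in> PiE {1..n+1} I \<Longrightarrow> v r \<in> H (n+1)" "\<And>r. r \<in> PiE {1..n+1} I \<Longrightarrow> norm (v r) \<le> t (r (n+1))"
  have "(\<Sum>r\<in>PiE {1..n+1} I. cmod (c (\<lambda>j. D j (r j)) (v r))) \<le> C * L2_set t (I (n+1))"
    by (intro grid_boundD(2)[OF assms(1)] *)
  also have "\<dots> \<le> B * L2_set t (I (n+1))" using assms(2) by (intro mult_right_mono L2_set_nonneg)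
  finally show "(\<Sum>r\<in>PiE {1..n+1} I. cmod (c (\<lambda>j. D j (r j)) (v r))) \<le> B * L2_set t (I (n+1))" .
qed

lemma sum_PiE_Suc:
  "(\<Sum>r\<in>PiE {1..Suc n} I. f r) = (\<Sum>r\<in>PiE {1..n} I. \<Sum>i\<in>I (Suc n). f (r(Suc n := i)))"
proof -
  have "{1..Suc n} = insert (Suc n) {1..n}" by auto
  then have "(\<Sum>r\<in>PiE {1..Suc n} I. f r) = (\<Sum>r\<in>(\<lambda>(y, g). g(Suc n := y)) ` (I (Suc n) \<times> PiE {1..n} I). f r)"
    by (simp only: PiE_insert_eq)
  also have "\<dots> = (\<Sum>(y, g)\<in>I (Suc n) \<times> PiE {1..n} I. f (g(Suc n := y)))"
    by (subst sum.reindex) (auto intro!: inj_combinator sum.cong)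
  also have "\<dots> = (\<Sum>r\<in>PiE {1..n} I. \<Sum>i\<in>I (Suc n). f (r(Suc n := i)))"
    by (subst sum.cartesian_product[symmetric]) (rule sum.swap)
  finally show ?thesis .
qed

text \<open>Cauchy-Schwarz in each row: the Frobenius norm of a matrix dominates its Euclidean
  operator norm.\<close>

lemma L2_set_matrix:
  "L2_set (\<lambda>i. \<Sum>j\<in>J. \<beta> i j * \<bar>t j\<bar>) I \<le> sqrt (\<Sum>i\<in>I. \<Sum>j\<in>J. (\<beta> i j)\<^sup>2) * L2_set t J"
proof -
  have 1: "(\<Sum>j\<in>J. \<beta> i j * \<bar>t j\<bar>)\<^sup>2 \<le> (\<Sum>j\<in>J. (\<beta> i j)\<^sup>2) * (\<Sum>j\<in>J. (t j)\<^sup>2)" for i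
    using Cauchy_Schwarz_ineq_sum[of "\<beta> i" "\<lambda>j. \<bar>t j\<bar>" J] by simp
  have "(\<Sum>i\<in>I. (\<Sum>j\<in>J. \<beta> i j * \<bar>t j\<bar>)\<^sup>2) \<le> (\<Sum>i\<in>I. \<Sum>j\<in>J. (\<beta> i j)\<^sup>2) * (\<Sum>j\<in>J. (t j)\<^sup>2)"
    unfolding sum_distrib_right[of _ I] by (intro sum_mono 1)
  then show ?thesis unfolding L2_set_def real_sqrt_mult[symmetric] by (rule real_sqrt_le_mono)
qed

text \<open>One more link costs the factor \<open>B\<close>. The sum over the new index is absorbed
  into a new cell-dependent vector for \<open>c\<close>; its weights are the old ones transformed by
  the matrix of block norms, whose Frobenius norm is at most \<open>B\<close>.\<close>

lemma grid_bound_step: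
  assumes c: "rect_functional M H P n c" and C: "grid_bound M H n c C"
    and P1: "pvm_space (M (n+1)) (H (n+1)) (P (n+1))" and P2: "pvm_space (M (n+2)) (H (n+2)) (P (n+2))"
    and b: "b \<in> bounded_ops (H (n+2)) (H (n+1))" and B: "hs_bound (H (n+2)) b B"
  shows "grid_bound M H (Suc n) (\<lambda>G v. c G (b (P (n+2) (G (n+2)) v))) (C * B)"
proof (rule grid_boundI)
  have N: "Suc n + 1 = n + 2" by simp
  show "C * B \<ge> 0" using grid_boundD(1)[OF C] hs_boundD(1)[OF B] by simp
  fix I :: "nat \<Rightarrow> nat set" and D t v
  assume I: "\<And>j. j \<in> {1..Suc n+1} \<Longrightarrow> finite (I j)"
    and D: "\<And>j i. j \<in> {1..Suc n+1} \<Longrightarrow> i \<in> I j \<Longrightarrow> D j i \<in> sets (M j)"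
      "\<And>j. j \<in> {1..Suc n+1} \<Longrightarrow> disjoint_family_on (D j) (I j)"
    and v: "\<And>r. r \<in> PiE {1..Suc n+1} I \<Longrightarrow> v r \<in> H (Suc n+1)"
      "\<And>r. r \<in> PiE {1..Suc n+1} I \<Longrightarrow> norm (v r) \<le> t (r (Suc n+1))"
  note H1 = pvm_spaceD(2)[OF P1]
  have "\<exists>\<beta>. (\<forall>i j. 0 \<le> \<beta> i j) \<and>
     (\<forall>i\<in>I (n+1). \<forall>j\<in>I (n+2). \<forall>v. norm (P (n+1) (D (n+1) i) (b (P (n+2) (D (n+2) j) v))) \<le> \<beta> i j * norm v) \<and>
     (\<Sum>i\<in>I (n+1). \<Sum>j\<in>I (n+2). (\<beta> i j)\<^sup>2) \<le> B\<^sup>2"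
    using I D by (intro hs_bound_blocks[OF P1 P2 b B]) auto
  then obtain \<beta> where \<beta>: "\<forall>i j. 0 \<le> \<beta> i j"
     "\<forall>i\<in>I (n+1). \<forall>j\<in>I (n+2). \<forall>v. norm (P (n+1) (D (n+1) i) (b (P (n+2) (D (n+2) j) v))) \<le> \<beta> i j * norm v"
     "(\<Sum>i\<in>I (n+1). \<Sum>j\<in>I (n+2). (\<beta> i j)\<^sup>2) \<le> B\<^sup>2" by blast
  define G where "G r j = D j (r j)" for r :: "nat \<Rightarrow> nat" and j
  define w where "w r i = b (P (n+2) (D (n+2) i) (v (r(n+2 := i))))" for r i
  \<comment> \<open>Inserting the projection of the cell leaves the value of \<open>c\<close>
    unchanged and completes the block that is bounded by \<open>\<beta>\<close>.\<close>
  define u where "u r i = P (n+1) (D (n+1) (r (n+1))) (w r i)" for r i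
  \<comment> \<open>The phases turn all the values of \<open>c\<close> into nonnegative reals, so
    that by linearity \<open>c\<close> at this one vector is the sum of their moduli.\<close>
  define V where "V r = (\<Sum>i\<in>I (n+2). cnj (sgn (c (G r) (w r i))) *\<^sub>C u r i)" for r
  \<comment> \<open>The new weight depends on the cell only through its last index
    \<open>r (n+1)\<close>, as \<open>grid_bound\<close> demands.\<close>
  define s where "s g = (\<Sum>i\<in>I (n+2). \<beta> g i * \<bar>t i\<bar>)" for g
  have upd: "r(n+2 := i) \<in> PiE {1..Suc n+1} I" if "r \<in> PiE {1..n+1} I" "i \<in> I (n+2)" for r i
    using that by (auto simp: PiE_iff extensional_def)
  have Gs: "G r \<in> (\<Pi> j\<in>{1..n+1}. sets (M j))" if "r \<in> PiE {1..n+1} I" for r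
    using that D(1) by (auto simp: G_def PiE_iff)
  have D2: "D (n+2) i \<in> sets (M (n+2))" if "i \<in> I (n+2)" for i using D(1)[of "n+2" i] that by simp
  have wH: "w r i \<in> H (n+1)" if "r \<in> PiE {1..n+1} I" "i \<in> I (n+2)" for r i
    unfolding w_def using v(1)[OF upd[OF that]] D2[OF that(2)] by (intro bounded_opsD(1)[OF b] pvm_in[OF P2]) auto
  have D1: "D (n+1) (r (n+1)) \<in> sets (M (n+1))" if "r \<in> PiE {1..n+1} I" for r
    using Gs[OF that] by (auto simp: G_def Pi_iff)
  have uH: "u r i \<in> H (n+1)" if "r \<in> PiE {1..n+1} I" "i \<in> I (n+2)" for r i
    unfolding u_def by (rule pvm_in[OF P1 D1[OF that(1)] wH[OF that]])
  have cV: "c (G r) (V r) = complex_of_real (\<Sum>i\<in>I (n+2). cmod (c (G r) (w r i)))" if r: "r \<in> PiE {1..n+1} I" for r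
  proof -
    have "c (G r) (V r) = (\<Sum>i\<in>I (n+2). cnj (sgn (c (G r) (w r i))) * c (G r) (u r i))"
      unfolding V_def using r by (intro rect_functional_lincomb[OF c Gs H1] uH)
    also have "\<dots> = (\<Sum>i\<in>I (n+2). complex_of_real (cmod (c (G r) (w r i))))"
    proof (rule sum.cong[OF refl])
      fix i assume i: "i \<in> I (n+2)"
      have "c (G r) (u r i) = c (G r) (w r i)"
        using rect_functionalD(4)[OF c Gs[OF r] wH[OF r i]] by (simp add: u_def G_def)
      moreover have "cnj (sgn z) * z = complex_of_real (cmod z)" for z
        using complex_norm_square[of z] by (cases "z = 0") (auto simp: sgn_eq field_simps power2_eq_square)
      ultimately show "cnj (sgn (c (G r) (w r i))) * c (G r) (u r i) = complex_of_real (cmod (c (G r) (w r i)))"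
        by simp
    qed
    finally show ?thesis by simp
  qed
  \<comment> \<open>The last index is summed separately; changing it does not affect
    \<open>c\<close>, which reads only the sides up to \<open>n + 1\<close>.\<close>
  have "(\<Sum>r\<in>PiE {1..Suc n+1} I. cmod (c (\<lambda>j. D j (r j)) (b (P (n+2) (D (n+2) (r (n+2))) (v r)))))
    = (\<Sum>r\<in>PiE {1..n+1} I. \<Sum>i\<in>I (n+2). cmod (c (G r) (w r i)))"
  proof -
    have cG: "c (\<lambda>j. D j ((r(n+2 := i)) j)) = c (G r)" for r i
      by (rule rect_functionalD(1)[OF c]) (auto simp: G_def)
    have "{1..Suc n+1} = {1..Suc (n+1)}" "I (n+2) = I (Suc (n+1))" by simp_all
    then show ?thesis using cG by (simp only: sum_PiE_Suc) (simp add: w_def)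
  qed
  also have "\<dots> = (\<Sum>r\<in>PiE {1..n+1} I. cmod (c (\<lambda>j. D j (r j)) (V r)))"
    using cV by (intro sum.cong refl) (simp add: G_def[abs_def] sum_nonneg del: of_real_sum)
  also have "\<dots> \<le> C * L2_set s (I (n+1))"
  proof (rule grid_boundD(2)[OF C])
    fix r assume r: "r \<in> PiE {1..n+1} I"
    have rn: "r (n+1) \<in> I (n+1)" using PiE_mem[OF r, of "n+1"] by simp
    show "V r \<in> H (n+1)" unfolding V_def using r by (intro csubspace_sum[OF H1] csubspaceD(3)[OF H1] uH)
    have "norm (V r) \<le> (\<Sum>i\<in>I (n+2). norm (cnj (sgn (c (G r) (w r i))) *\<^sub>C u r i))"
      unfolding V_def by (rule norm_sum)
    also have "\<dots> \<le> (\<Sum>i\<in>I (n+2). \<beta> (r (n+1)) i * \<bar>t i\<bar>)"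
    proof (rule sum_mono)
      fix i assume i: "i \<in> I (n+2)"
      have "norm (cnj (sgn (c (G r) (w r i))) *\<^sub>C u r i) \<le> 1 * norm (u r i)"
        unfolding norm_scaleC by (intro mult_right_mono) (auto simp: norm_sgn)
      also have "\<dots> \<le> \<beta> (r (n+1)) i * norm (v (r(n+2 := i)))"
        using \<beta>(2)[rule_format, OF rn i, of "v (r(n+2 := i))"] by (simp only: u_def w_def)
      also have "\<dots> \<le> \<beta> (r (n+1)) i * \<bar>t i\<bar>"
        using \<beta>(1) v(2)[OF upd[OF r i]] by (intro mult_left_mono) auto
      finally show "norm (cnj (sgn (c (G r) (w r i))) *\<^sub>C u r i) \<le> \<beta> (r (n+1)) i * \<bar>t i\<bar>" .
    qed
    finally show "norm (V r) \<le> s (r (n+1))" by (simp add: s_def)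
  qed (use I D in auto)
  also have "\<dots> \<le> C * (B * L2_set t (I (n+2)))"
  proof (intro mult_left_mono grid_boundD(1)[OF C])
    have "L2_set s (I (n+1)) \<le> sqrt (\<Sum>i\<in>I (n+1). \<Sum>j\<in>I (n+2). (\<beta> i j)\<^sup>2) * L2_set t (I (n+2))"
      unfolding s_def by (rule L2_set_matrix)
    also have "\<dots> \<le> B * L2_set t (I (n+2))"
      using \<beta>(3) hs_boundD(1)[OF B] by (intro mult_right_mono L2_set_nonneg real_le_lsqrt) auto
    finally show "L2_set s (I (n+1)) \<le> B * L2_set t (I (n+2))" .
  qed
  finally show "(\<Sum>r\<in>PiE {1..Suc n+1} I. cmod (c (\<lambda>j. D j (r j)) (b (P (n+2) (D (n+2) (r (n+2))) (v r))))) \<le>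
    C * B * L2_set t (I (Suc n + 1))" by (simp add: mult.assoc)
qed

lemma rect_functionalI:
  assumes "\<And>G G'. (\<And>j. j \<in> {1..n+1} \<Longrightarrow> G j = G' j) \<Longrightarrow> c G = c G'"
    and "\<And>G x y. G \<in> (\<Pi> j\<in>{1..n+1}. sets (M j)) \<Longrightarrow> x \<in> H (n+1) \<Longrightarrow> y \<in> H (n+1) \<Longrightarrow> c G (x + y) = c G x + c G y"
    and "\<And>G a x. G \<in> (\<Pi> j\<in>{1..n+1}. sets (M j)) \<Longrightarrow> x \<in> H (n+1) \<Longrightarrow> c G (a *\<^sub>C x) = a * c G x"
    and "\<And>G x. G \<in> (\<Pi> j\<in>{1..n+1}. sets (M j)) \<Longrightarrow> x \<in> H (n+1) \<Longrightarrow> c G (P (n+1) (G (n+1)) x) = c G x"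
  shows "rect_functional M H P n c"
  unfolding rect_functional_def
proof (intro conjI allI impI ballI)
  fix G G' :: "nat \<Rightarrow> 'a set" assume "\<forall>j\<in>{1..n+1}. G j = G' j"
  then show "c G = c G'" by (intro assms(1)) (rule bspec)
qed (rule assms; assumption)+

lemma rect_functional_diff:
  assumes c: "rect_functional M H P n c" and d: "rect_functional M H P n d"
  shows "rect_functional M H P n (\<lambda>G v. c G v - d G v)"
proof (rule rect_functionalI)
  fix G G' :: "nat \<Rightarrow> 'a set" assume eq: "\<And>j. j \<in> {1..n+1} \<Longrightarrow> G j = G' j"
  have "c G = c G'" "d G = d G'"
    by (rule rect_functionalD(1)[OF c eq] rect_functionalD(1)[OF d eq]; assumption)+
  then show "(\<lambda>v. c G v - d G v) = (\<lambda>v. c G' v - d G' v)" by simp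
next
  fix G :: "nat \<Rightarrow> 'a set" and x assume "G \<in> (\<Pi> j\<in>{1..n+1}. sets (M j))" "x \<in> H (n+1)"
  then show "c G (P (n+1) (G (n+1)) x) - d G (P (n+1) (G (n+1)) x) = c G x - d G x"
    by (simp only: rect_functionalD(4)[OF c] rect_functionalD(4)[OF d])
qed (simp_all add: rect_functionalD(2-)[OF c] rect_functionalD(2-)[OF d] right_diff_distrib)

section \<open>Chain functionals and their approximation by finite rank\<close>

definition chain_functional :: "(nat \<Rightarrow> 'w set \<Rightarrow> 'a \<Rightarrow> 'a) \<Rightarrow> (nat \<Rightarrow> 'a \<Rightarrow> 'a) \<Rightarrow> 'a::complex_inner \<Rightarrow> nat \<Rightarrow>
    (nat \<Rightarrow> 'w set) \<Rightarrow> 'a \<Rightarrow> complex" where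
  "chain_functional P b h' n G v = cinner (op_chain n (\<lambda>j. P j (G j)) b v) h'"

lemma chain_functional_Suc:
  "chain_functional P b h' (Suc n) G v = chain_functional P b h' n G (b (n+1) (P (n+2) (G (n+2)) v))"
  by (simp add: chain_functional_def)

lemma rect_functional_chain:
  assumes P: "\<And>j. j \<in> {1..n+1} \<Longrightarrow> pvm_space (M j) (H j) (P j)"
    and b: "\<And>j. j \<in> {1..n} \<Longrightarrow> b j \<in> bounded_ops (H (j + 1)) (H j)"
  shows "rect_functional M H P n (chain_functional P b h' n)"
proof (rule rect_functionalI)
  fix G G' :: "nat \<Rightarrow> 'a set" assume eq: "\<And>j. j \<in> {1..n+1} \<Longrightarrow> G j = G' j"
  have "op_chain n (\<lambda>j. P j (G j)) b = op_chain n (\<lambda>j. P j (G' j)) b"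
    by (rule op_chain_cong) (simp add: eq)
  then show "chain_functional P b h' n G = chain_functional P b h' n G'"
    by (simp add: chain_functional_def fun_eq_iff)
next
  fix G :: "nat \<Rightarrow> 'a set" assume G: "G \<in> (\<Pi> j\<in>{1..n+1}. sets (M j))"
  have T: "op_chain n (\<lambda>j. P j (G j)) b \<in> bounded_ops (H (n + 1)) (H 1)"
  proof (rule op_chain_bounded_ops[where H=H, OF _ b])
    fix j assume j: "j \<in> {1..n+1}"
    show "P j (G j) \<in> bounded_ops (H j) (H j)" by (rule pvm_spaceD(3)[OF P[OF j] Pi_mem[OF G j]])
  qed
  fix x assume x: "x \<in> H (n+1)"
  show "chain_functional P b h' n G (x + y) = chain_functional P b h' n G x + chain_functional P b h' n G y"
    if "y \<in> H (n+1)" for y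
    unfolding chain_functional_def bounded_opsD(3)[OF T x that] by (rule cinner_add_left)
  show "chain_functional P b h' n G (a *\<^sub>C x) = a * chain_functional P b h' n G x" for a
    unfolding chain_functional_def bounded_opsD(4)[OF T x] by (rule cinner_scaleC_left)
  have "G (n+1) \<in> sets (M (n+1))" using G by (simp add: Pi_iff)
  then have "P (n+1) (G (n+1)) (P (n+1) (G (n+1)) x) = P (n+1) (G (n+1)) x"
    by (intro pvm_spaceD(5)[OF P]) simp_all
  then show "chain_functional P b h' n G (P (n+1) (G (n+1)) x) = chain_functional P b h' n G x"
    by (cases n) (simp_all add: chain_functional_def)
qed

text \<open>The shape of a chain in which all \<open>b j\<close> have finite rank: finite sums of
  products with one coefficient per factor, the free vector standing in the last. Scalar multiples
  can be absorbed into the vectors, and the inductive form reduces each property to three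
  cases.\<close>

inductive elementary_functional :: "(nat \<Rightarrow> 'a::complex_inner set) \<Rightarrow>
    (nat \<Rightarrow> 'w set \<Rightarrow> 'a \<Rightarrow> 'a) \<Rightarrow> nat \<Rightarrow> ((nat \<Rightarrow> 'w set) \<Rightarrow> 'a \<Rightarrow> complex) \<Rightarrow> bool" for H P n where
  zero: "elementary_functional H P n (\<lambda>G v. 0)"
| product: "\<lbrakk>\<And>j. j \<in> {1..n} \<Longrightarrow> X j \<in> H j; \<And>j. j \<in> {1..n+1} \<Longrightarrow> Y j \<in> H j\<rbrakk> \<Longrightarrow>
    elementary_functional H P n
      (\<lambda>G v. (\<Prod>j\<in>{1..n}. cinner (P j (G j) (X j)) (Y j)) * cinner (P (n+1) (G (n+1)) v) (Y (n+1)))"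
| add: "elementary_functional H P n c \<Longrightarrow> elementary_functional H P n d \<Longrightarrow>
    elementary_functional H P n (\<lambda>G v. c G v + d G v)"

lemma rect_functional_elementary:
  assumes "elementary_functional H P n c" and P: "pvm_space (M (n+1)) (H (n+1)) (P (n+1))"
  shows "rect_functional M H P n c"
  using assms(1)
proof induction
  case zero
  then show ?case by (intro rect_functionalI) simp_all
next
  case (product X Y)
  show ?case
  proof (rule rect_functionalI)
    fix G G' :: "nat \<Rightarrow> 'b set" assume eq: "\<And>j. j \<in> {1..n+1} \<Longrightarrow> G j = G' j"
    have "(\<Prod>j\<in>{1..n}. cinner (P j (G j) (X j)) (Y j)) = (\<Prod>j\<in>{1..n}. cinner (P j (G' j) (X j)) (Y j))"
      by (intro prod.cong) (simp_all add: eq)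
    then show "(\<lambda>v. (\<Prod>j\<in>{1..n}. cinner (P j (G j) (X j)) (Y j)) * cinner (P (n+1) (G (n+1)) v) (Y (n+1))) =
      (\<lambda>v. (\<Prod>j\<in>{1..n}. cinner (P j (G' j) (X j)) (Y j)) * cinner (P (n+1) (G' (n+1)) v) (Y (n+1)))"
      using eq[of "n+1"] by simp
  next
    fix G :: "nat \<Rightarrow> 'b set" assume "G \<in> (\<Pi> j\<in>{1..n+1}. sets (M j))"
    then have G: "G (n+1) \<in> sets (M (n+1))" by (simp add: Pi_iff)
    note T = pvm_spaceD(3)[OF P G]
    fix x assume x: "x \<in> H (n+1)"
    show "(\<Prod>j\<in>{1..n}. cinner (P j (G j) (X j)) (Y j)) * cinner (P (n+1) (G (n+1)) (x + y)) (Y (n+1)) =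
      (\<Prod>j\<in>{1..n}. cinner (P j (G j) (X j)) (Y j)) * cinner (P (n+1) (G (n+1)) x) (Y (n+1)) +
      (\<Prod>j\<in>{1..n}. cinner (P j (G j) (X j)) (Y j)) * cinner (P (n+1) (G (n+1)) y) (Y (n+1))"
      if "y \<in> H (n+1)" for y
      unfolding bounded_opsD(3)[OF T x that] cinner_add_left by (rule distrib_left)
    show "(\<Prod>j\<in>{1..n}. cinner (P j (G j) (X j)) (Y j)) * cinner (P (n+1) (G (n+1)) (a *\<^sub>C x)) (Y (n+1)) =
      a * ((\<Prod>j\<in>{1..n}. cinner (P j (G j) (X j)) (Y j)) * cinner (P (n+1) (G (n+1)) x) (Y (n+1)))" for a
      unfolding bounded_opsD(4)[OF T x] cinner_scaleC_left by (rule mult.left_commute)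
    show "(\<Prod>j\<in>{1..n}. cinner (P j (G j) (X j)) (Y j)) * cinner (P (n+1) (G (n+1)) (P (n+1) (G (n+1)) x)) (Y (n+1)) =
      (\<Prod>j\<in>{1..n}. cinner (P j (G j) (X j)) (Y j)) * cinner (P (n+1) (G (n+1)) x) (Y (n+1))"
      unfolding pvm_spaceD(5)[OF P G] by (rule refl)
  qed
next
  case (add c d)
  show ?case
  proof (rule rect_functionalI)
    fix G G' :: "nat \<Rightarrow> 'b set" assume eq: "\<And>j. j \<in> {1..n+1} \<Longrightarrow> G j = G' j"
    have "c G = c G'" "d G = d G'"
      by (rule rect_functionalD(1)[OF add.IH(1) eq] rect_functionalD(1)[OF add.IH(2) eq]; assumption)+
    then show "(\<lambda>v. c G v + d G v) = (\<lambda>v. c G' v + d G' v)" by simp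
  next
    fix G :: "nat \<Rightarrow> 'b set" and x assume "G \<in> (\<Pi> j\<in>{1..n+1}. sets (M j))" "x \<in> H (n+1)"
    then show "c G (P (n+1) (G (n+1)) x) + d G (P (n+1) (G (n+1)) x) = c G x + d G x"
      by (simp only: rect_functionalD(4)[OF add.IH(1)] rect_functionalD(4)[OF add.IH(2)])
  qed (simp_all add: rect_functionalD(2-)[OF add.IH(1)] rect_functionalD(2-)[OF add.IH(2)] distrib_left)
qed

text \<open>Freezing the vector at \<open>x\<close> makes the last factor of \<open>c\<close> an
  ordinary coefficient and leaves position \<open>n + 2\<close> for the new free vector. This is
  what a single rank-one operator does to a chain.\<close>

lemma elementary_functional_Suc:
  assumes "elementary_functional H P n c" and x: "x \<in> H (n+1)" and e: "e \<in> H (n+2)"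
  shows "elementary_functional H P (Suc n) (\<lambda>G v. c G x * cinner (P (n+2) (G (n+2)) v) e)"
  using assms(1)
proof induction
  case zero
  then show ?case by (simp add: elementary_functional.zero)
next
  case (product X Y)
  have "elementary_functional H P (Suc n)
      (\<lambda>G v. (\<Prod>j\<in>{1..Suc n}. cinner (P j (G j) ((X(n+1 := x)) j)) ((Y(n+2 := e)) j)) *
        cinner (P (Suc n+1) (G (Suc n+1)) v) ((Y(n+2 := e)) (Suc n+1)))"
    using product x e by (intro elementary_functional.product) auto
  moreover have "(\<Prod>j\<in>{1..Suc n}. cinner (P j (G j) ((X(n+1 := x)) j)) ((Y(n+2 := e)) j)) =
     (\<Prod>j\<in>{1..n}. cinner (P j (G j) (X j)) (Y j)) * cinner (P (n+1) (G (n+1)) x) (Y (n+1))" for G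
  proof -
    have "(\<Prod>j\<in>{1..n}. cinner (P j (G j) ((X(n+1 := x)) j)) ((Y(n+2 := e)) j)) =
      (\<Prod>j\<in>{1..n}. cinner (P j (G j) (X j)) (Y j))" by (intro prod.cong) auto
    then show ?thesis by (simp only: prod.nat_ivl_Suc') simp
  qed
  ultimately show ?case by simp
next
  case (add c d)
  then show ?case by (simp add: distrib_right elementary_functional.add)
qed

lemma elementary_functional_sum:
  assumes "\<And>i. i \<in> I \<Longrightarrow> elementary_functional H P n (c i)"
  shows "elementary_functional H P n (\<lambda>G v. \<Sum>i\<in>I. c i G v)"
  using assms by (induction I rule: infinite_finite_induct)
    (simp_all add: elementary_functional.zero elementary_functional.add)

text \<open>The projection is moved to the fixed vector \<open>h'\<close>, whose pieces are square
  summable over disjoint sets; Cauchy-Schwarz over the index set then pairs them with the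
  weights.\<close>

lemma grid_bound_chain_0:
  assumes P: "pvm_space (M 1) (H 1) (P 1)" and h': "h' \<in> H 1"
  shows "grid_bound M H 0 (chain_functional P b h' 0) (norm h')"
proof (rule grid_boundI)
  fix I :: "nat \<Rightarrow> nat set" and D t v
  assume I: "\<And>j. j \<in> {1..0+1} \<Longrightarrow> finite (I j)"
    and D: "\<And>j i. j \<in> {1..0+1} \<Longrightarrow> i \<in> I j \<Longrightarrow> D j i \<in> sets (M j)"
      "\<And>j. j \<in> {1..0+1} \<Longrightarrow> disjoint_family_on (D j) (I j)"
    and v: "\<And>r. r \<in> PiE {1..0+1} I \<Longrightarrow> v r \<in> H (0+1)" "\<And>r. r \<in> PiE {1..0+1} I \<Longrightarrow> norm (v r) \<le> t (r (0+1))"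
  \<comment> \<open>The only extensional function on the one-element index set with value
    \<open>i\<close>; cells and indices are identified through it.\<close>
  define r where "r i = (\<lambda>_. undefined)(Suc 0 := i)" for i :: nat
  have r: "r i \<in> PiE {1..0+1} I" if "i \<in> I 1" for i using that by (auto simp: r_def PiE_iff extensional_def)
  have "(\<Sum>r\<in>PiE {1..0+1} I. cmod (chain_functional P b h' 0 (\<lambda>j. D j (r j)) (v r))) =
    (\<Sum>i\<in>I 1. cmod (cinner (P 1 (D 1 i) (v (r i))) h'))"
    using sum_PiE_Suc[of "\<lambda>r. cmod (chain_functional P b h' 0 (\<lambda>j. D j (r j)) (v r))" 0 I]
    by (simp add: chain_functional_def r_def fun_upd_def)
  also have "\<dots> \<le> (\<Sum>i\<in>I 1. \<bar>t i\<bar> * \<bar>norm (P 1 (D 1 i) h')\<bar>)"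
  proof (rule sum_mono)
    fix i assume i: "i \<in> I 1"
    have "cinner (P 1 (D 1 i) (v (r i))) h' = cinner (v (r i)) (P 1 (D 1 i) h')"
      using v(1)[OF r[OF i]] D(1)[of 1 i] i h' by (intro pvm_spaceD(6)[OF P]) auto
    also have "cmod \<dots> \<le> norm (v (r i)) * norm (P 1 (D 1 i) h')" by (rule Cauchy_Schwarz_cinner)
    also have "\<dots> \<le> \<bar>t i\<bar> * \<bar>norm (P 1 (D 1 i) h')\<bar>"
      using v(2)[OF r[OF i]] by (intro mult_mono) (auto simp: r_def)
    finally show "cmod (cinner (P 1 (D 1 i) (v (r i))) h') \<le> \<bar>t i\<bar> * \<bar>norm (P 1 (D 1 i) h')\<bar>" .
  qed
  also have "\<dots> \<le> L2_set t (I 1) * L2_set (\<lambda>i. norm (P 1 (D 1 i) h')) (I 1)" by (rule L2_set_mult_ineq)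
  also have "\<dots> \<le> L2_set t (I 1) * norm h'"
    unfolding L2_set_def[of "\<lambda>i. norm (P 1 (D 1 i) h')"]
    using pvm_sum_norm_le[OF P, of "I 1" "D 1" h'] I D
    by (intro mult_left_mono real_le_lsqrt L2_set_nonneg) (auto intro: sum_nonneg)
  finally show "(\<Sum>r\<in>PiE {1..0+1} I. cmod (chain_functional P b h' 0 (\<lambda>j. D j (r j)) (v r))) \<le>
    norm h' * L2_set t (I (0+1))" by (simp add: mult.commute)
qed simp

text \<open>Bound and approximation go through one induction: the error of truncating the next
  operator is multiplied by the grid bound of the approximant constructed so far, which is
  controlled by the bound \<open>C\<close> of the chain.\<close>

lemma chain_functional_approx:
  assumes "\<And>j. j \<in> {1..n+1} \<Longrightarrow> pvm_space (M j) (H j) (P j)"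
    and "\<And>j. j \<in> {1..n} \<Longrightarrow> b j \<in> hilbert_schmidt (H (j + 1)) (H j)" and h': "h' \<in> H 1"
  shows "(\<exists>C. grid_bound M H n (chain_functional P b h' n) C) \<and>
     (\<forall>d>0. \<exists>c. elementary_functional H P n c \<and> grid_bound M H n (\<lambda>G v. chain_functional P b h' n G v - c G v) d)"
  using assms(1,2)
proof (induction n)
  case 0
  have P: "pvm_space (M 1) (H 1) (P 1)" using 0 by simp
  have "elementary_functional H P 0 (chain_functional P b h' 0)"
    using elementary_functional.product[of 0 undefined H "\<lambda>_. h'" P] h'
    by (simp add: chain_functional_def[abs_def])
  moreover have "grid_bound M H 0 (\<lambda>G v. chain_functional P b h' 0 G v - chain_functional P b h' 0 G v) d" if "d > 0" for d
    by (rule grid_boundI) (use that in simp_all)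
  ultimately show ?case using grid_bound_chain_0[where M=M and H=H and P=P and b=b, OF P h'] by blast
next
  case (Suc n)
  have P: "\<And>j. j \<in> {1..n+1} \<Longrightarrow> pvm_space (M j) (H j) (P j)"
    and b: "\<And>j. j \<in> {1..n} \<Longrightarrow> b j \<in> hilbert_schmidt (H (j + 1)) (H j)"
    using Suc.prems by auto
  note IH = Suc.IH[OF P b]
  have P1: "pvm_space (M (n+1)) (H (n+1)) (P (n+1))" and P2: "pvm_space (M (n+2)) (H (n+2)) (P (n+2))"
    using Suc.prems(1)[of "n+1"] Suc.prems(1)[of "n+2"] by simp_all
  have bn: "b (n+1) \<in> hilbert_schmidt (H (n+2)) (H (n+1))" using Suc.prems(2)[of "n+1"] by simp
  note bo = hilbert_schmidt_bounded_ops[OF bn] and hs = hilbert_schmidt_hs_bound[OF bn]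
  define B where "B = hs_norm (H (n+2)) (b (n+1))"
  have B: "B \<ge> 0" unfolding B_def by (rule hs_norm_nonneg)
  have rc: "rect_functional M H P n (chain_functional P b h' n)"
    by (rule rect_functional_chain[where M=M and H=H and P=P and n=n and b=b, OF P hilbert_schmidt_bounded_ops[OF b]])
  obtain C where C: "grid_bound M H n (chain_functional P b h' n) C" using IH by blast
  have "grid_bound M H (Suc n) (chain_functional P b h' (Suc n)) (C * B)"
    unfolding chain_functional_Suc[abs_def] B_def by (rule grid_bound_step[OF rc C P1 P2 bo hs])
  moreover have "\<exists>c. elementary_functional H P (Suc n) c \<and>
      grid_bound M H (Suc n) (\<lambda>G v. chain_functional P b h' (Suc n) G v - c G v) d" if d: "d > 0" for d
  proof -
    \<comment> \<open>The previous error is multiplied by \<open>B\<close> in the next link; half of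
      \<open>d\<close> is reserved for it.\<close>
    define d1 where "d1 = d / (2 * (B + 1))"
    have d1: "d1 > 0" using d B by (simp add: d1_def)
    obtain c where c: "elementary_functional H P n c"
      and cb: "grid_bound M H n (\<lambda>G v. chain_functional P b h' n G v - c G v) d1" using IH d1 by blast
    note rcc = rect_functional_elementary[of H P n c M, OF c P1]
    have cC: "grid_bound M H n c (C + d1)"
    proof (rule grid_bound_add[OF C cb])
      fix G v
      show "cmod (c G v) \<le> cmod (chain_functional P b h' n G v) + cmod (chain_functional P b h' n G v - c G v)"
        using norm_triangle_ineq4[of "chain_functional P b h' n G v" "chain_functional P b h' n G v - c G v"] by simp
    qed
    have C0: "C \<ge> 0" by (rule grid_boundD(1)[OF C])
    \<comment> \<open>The other half of \<open>d\<close>: the truncation error is multiplied by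
      \<open>C + d1\<close>, the grid bound of \<open>c\<close>. The added 1 keeps the denominator
      positive.\<close>
    define d2 where "d2 = d / (2 * (C + d1 + 1))"
    have d2: "d2 > 0" using d C0 d1 by (simp add: d2_def)
    obtain F where F: "finite F" "F \<subseteq> some_onb (H (n+2))"
      "hs_bound (H (n+2)) (\<lambda>x. b (n+1) x - finite_rank_part (H (n+2)) F (b (n+1)) x) d2"
      using hs_bound_finite_rank_approx[OF bn pvm_spaceD(1)[OF P2] d2] by blast
    have FH: "F \<subseteq> H (n+2)" using F(2) onb_subset[OF onb_some_onb[OF pvm_spaceD(1)[OF P2]]] by blast
    define f where "f = finite_rank_part (H (n+2)) F (b (n+1))"
    have fo: "f \<in> bounded_ops (H (n+2)) (H (n+1))"
      unfolding f_def by (rule finite_rank_part_bounded_ops[OF bo pvm_spaceD(2)[OF P2] pvm_spaceD(2)[OF P1] FH])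
    have bf: "(\<lambda>x. b (n+1) x - f x) \<in> bounded_ops (H (n+2)) (H (n+1))"
      using bounded_ops_add[OF bo bounded_ops_scaleC[OF fo pvm_spaceD(2)[OF P1], of "-1"] pvm_spaceD(2)[OF P1]]
      by (simp add: scaleC_minus1)
    \<comment> \<open>This is \<open>c\<close> after the truncated operator, expanded along
      \<open>F\<close>; the free vector now occurs only in the last factor, so the functional stays
      elementary.\<close>
    define c' where "c' G v = (\<Sum>e\<in>F. c G (b (n+1) e) * cinner (P (n+2) (G (n+2)) v) e)" for G v
    have "elementary_functional H P (Suc n) c'"
      unfolding c'_def[abs_def] using FH bounded_opsD(1)[OF bo]
      by (intro elementary_functional_sum elementary_functional_Suc[OF c]) auto
    moreover have "grid_bound M H (Suc n) (\<lambda>G v. chain_functional P b h' (Suc n) G v - c' G v) (d1 * B + (C + d1) * d2)"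
    proof (rule grid_bound_add)
      show "grid_bound M H (Suc n)
          (\<lambda>G v. chain_functional P b h' n G (b (n+1) (P (n+2) (G (n+2)) v)) - c G (b (n+1) (P (n+2) (G (n+2)) v))) (d1 * B)"
        unfolding B_def by (rule grid_bound_step[OF rect_functional_diff[OF rc rcc] cb P1 P2 bo hs])
      show "grid_bound M H (Suc n)
          (\<lambda>G v. c G (b (n+1) (P (n+2) (G (n+2)) v) - f (P (n+2) (G (n+2)) v))) ((C + d1) * d2)"
        by (rule grid_bound_step[OF rcc cC P1 P2 bf F(3)[folded f_def]])
    next
      fix G v assume G: "G \<in> (\<Pi> j\<in>{1..Suc n+1}. sets (M j))" and v: "v \<in> H (Suc n+1)"
      define x where "x = P (n+2) (G (n+2)) v"
      have xH: "x \<in> H (n+2)" unfolding x_def using v G by (intro pvm_in[OF P2]) (auto simp: Pi_iff)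
      have Gn: "G \<in> (\<Pi> j\<in>{1..n+1}. sets (M j))" using G by (auto simp: Pi_iff)
      have bx: "b (n+1) x \<in> H (n+1)" "f x \<in> H (n+1)" using bounded_opsD(1)[OF bo xH] bounded_opsD(1)[OF fo xH] .
      have "c G (b (n+1) x - f x) = c G (b (n+1) x + (-1) *\<^sub>C f x)" by (simp add: scaleC_minus1)
      also have "\<dots> = c G (b (n+1) x) - c G (f x)"
        using rect_functionalD(2)[OF rcc Gn bx(1) csubspaceD(3)[OF pvm_spaceD(2)[OF P1] bx(2)], of "-1"]
          rect_functionalD(3)[OF rcc Gn bx(2), of "-1"] by simp
      also have "c G (f x) = c' G v"
      proof -
        have "f x = (\<Sum>e\<in>F. cinner x e *\<^sub>C b (n+1) e)" using xH by (simp add: f_def finite_rank_part_def)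
        then have "c G (f x) = (\<Sum>e\<in>F. cinner x e * c G (b (n+1) e))"
          using FH bounded_opsD(1)[OF bo]
          by (simp only:) (intro rect_functional_lincomb[OF rcc Gn pvm_spaceD(2)[OF P1]], auto)
        then show ?thesis by (simp add: c'_def x_def mult.commute)
      qed
      finally have "chain_functional P b h' (Suc n) G v - c' G v =
         (chain_functional P b h' n G (b (n+1) x) - c G (b (n+1) x)) + c G (b (n+1) x - f x)"
        by (simp only: chain_functional_Suc x_def) simp
      then show "cmod (chain_functional P b h' (Suc n) G v - c' G v) \<le>
         cmod (chain_functional P b h' n G (b (n+1) (P (n+2) (G (n+2)) v)) - c G (b (n+1) (P (n+2) (G (n+2)) v))) +
         cmod (c G (b (n+1) (P (n+2) (G (n+2)) v) - f (P (n+2) (G (n+2)) v)))"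
        unfolding x_def by (simp only: norm_triangle_ineq)
    qed
    moreover have "d1 * B + (C + d1) * d2 \<le> d"
    proof -
      have "d1 * B \<le> d / 2" using d B by (simp add: d1_def field_simps)
      moreover have "(C + d1) * d2 \<le> d / 2" using d C0 d1 by (simp add: d2_def field_simps)
      ultimately show ?thesis by simp
    qed
    ultimately show ?thesis using grid_bound_mono by blast
  qed
  ultimately show ?case by blast
qed

section \<open>Comparison with the tensor product measure\<close>

lemma tensor_pvm_facts:
  assumes "tensor_pvm J M H P T \<tau> PT"
  shows "pvm_space (PiM J M) T PT" "x \<in> PiE J H \<Longrightarrow> \<tau> x \<in> T"
    "x \<in> PiE J H \<Longrightarrow> y \<in> PiE J H \<Longrightarrow> cinner (\<tau> x) (\<tau> y) = (\<Prod>j\<in>J. cinner (x j) (y j))"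
    "G \<in> (\<Pi> j\<in>J. sets (M j)) \<Longrightarrow> x \<in> PiE J H \<Longrightarrow> PT (PiE J G) (\<tau> x) = \<tau> (\<lambda>j\<in>J. P j (G j) (x j))"
proof -
  have ht: "hilbert_tensor J H T \<tau>" using assms by (simp add: tensor_pvm_def)
  then have "\<tau> ` PiE J H \<subseteq> T"
    unfolding hilbert_tensor_def using order_trans[OF hull_subset closure_subset] by blast
  then show "x \<in> PiE J H \<Longrightarrow> \<tau> x \<in> T" by blast
  show "x \<in> PiE J H \<Longrightarrow> y \<in> PiE J H \<Longrightarrow> cinner (\<tau> x) (\<tau> y) = (\<Prod>j\<in>J. cinner (x j) (y j))"
    using ht by (simp add: hilbert_tensor_def)
qed (use assms in \<open>simp_all add: tensor_pvm_def\<close>)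

text \<open>On a rectangle a product of coefficients is the coefficient of \<open>PT\<close> between
  two elementary tensors. The latter is a measure on the whole product sigma-algebra and vanishes
  wherever \<open>PT\<close> does.\<close>

lemma elementary_functional_measure:
  fixes n :: nat
  defines "J \<equiv> {1..n+1}"
  assumes "elementary_functional H P n c" and h: "h \<in> H (n+1)"
    and P: "\<And>j. j \<in> J \<Longrightarrow> pvm_space (M j) (H j) (P j)"
    and PT: "tensor_pvm J M H P T \<tau> PT"
  shows "\<exists>\<nu>. cmeas (PiM J M) \<nu> \<and> (\<forall>N\<in>sets (PiM J M). PT N = zero_op \<longrightarrow> \<nu> N = 0) \<and>
    (\<forall>G\<in>(\<Pi> j\<in>J. sets (M j)). \<nu> (PiE J G) = c G h)"
  using assms(2)
proof induction
  case zero
  have "cmeas (PiM J M) (\<lambda>_. 0)" by (auto simp: cmeas_def)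
  then show ?case by auto
next
  case (product X Y)
  \<comment> \<open>\<open>h\<close> occupies the last position, and the restriction makes the
    family extensional as \<open>PiE\<close> requires.\<close>
  define x where "x = (\<lambda>j\<in>J. if j = n+1 then h else X j)"
  define y where "y = restrict Y J"
  have x: "x \<in> PiE J H" using product h by (auto simp: x_def J_def)
  have y: "y \<in> PiE J H" using product by (auto simp: y_def J_def)
  note facts = tensor_pvm_facts[OF PT]
  have "cinner (PT (PiE J G) (\<tau> x)) (\<tau> y) =
      (\<Prod>j\<in>{1..n}. cinner (P j (G j) (X j)) (Y j)) * cinner (P (n+1) (G (n+1)) h) (Y (n+1))"
    if G: "G \<in> (\<Pi> j\<in>J. sets (M j))" for G
  proof -
    have "(\<lambda>j\<in>J. P j (G j) (x j)) \<in> PiE J H" using G x by (auto intro!: pvm_in[OF P])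
    then have "cinner (PT (PiE J G) (\<tau> x)) (\<tau> y) = (\<Prod>j\<in>J. cinner (P j (G j) (x j)) (y j))"
      unfolding facts(4)[OF G x] by (subst facts(3)[OF _ y]) auto
    also have "\<dots> = (\<Prod>j\<in>{1..n}. cinner (P j (G j) (x j)) (y j)) * cinner (P (n+1) (G (n+1)) (x (n+1))) (y (n+1))"
      by (simp add: J_def)
    also have "(\<Prod>j\<in>{1..n}. cinner (P j (G j) (x j)) (y j)) = (\<Prod>j\<in>{1..n}. cinner (P j (G j) (X j)) (Y j))"
      by (intro prod.cong) (auto simp: x_def y_def J_def)
    also have "x (n+1) = h" by (simp add: x_def J_def)
    also have "y (n+1) = Y (n+1)" by (simp add: y_def J_def)
    finally show ?thesis .
  qed
  then show ?case
    using cmeas_pvm[OF facts(1) facts(2)[OF x] facts(2)[OF y]]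
    by (intro exI[of _ "\<lambda>N. cinner (PT N (\<tau> x)) (\<tau> y)"]) (simp add: zero_op_def)
next
  case (add c d)
  then obtain \<nu> \<kappa> where "cmeas (PiM J M) \<nu> \<and> (\<forall>N\<in>sets (PiM J M). PT N = zero_op \<longrightarrow> \<nu> N = 0) \<and>
    (\<forall>G\<in>(\<Pi> j\<in>J. sets (M j)). \<nu> (PiE J G) = c G h)"
    "cmeas (PiM J M) \<kappa> \<and> (\<forall>N\<in>sets (PiM J M). PT N = zero_op \<longrightarrow> \<kappa> N = 0) \<and>
    (\<forall>G\<in>(\<Pi> j\<in>J. sets (M j)). \<kappa> (PiE J G) = d G h)" by blast
  then show ?case by (intro exI[of _ "\<lambda>G. \<nu> G + \<kappa> G"]) (simp add: cmeas_add)
qed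

text \<open>Only the values on rectangles and countable additivity enter, so the lemma is formulated
  for any scalar measure with these values.\<close>

lemma sharp_absolutely_continuous:
  fixes k :: nat
  defines "J \<equiv> {1..k+1}"
  assumes P: "\<And>j. j \<in> J \<Longrightarrow> pvm_space (M j) (H j) (P j)"
    and PT: "tensor_pvm J M H P T \<tau> PT"
    and b: "\<And>j. j \<in> {1..k} \<Longrightarrow> b j \<in> hilbert_schmidt (H (j + 1)) (H j)"
    and h: "h \<in> H (k+1)" "h' \<in> H 1"
    and \<nu>: "cmeas (PiM J M) \<nu>"
    and rect: "\<And>G. G \<in> (\<Pi> j\<in>J. sets (M j)) \<Longrightarrow> \<nu> (PiE J G) = cinner (op_chain k (\<lambda>j. P j (G j)) b h) h'"
    and N: "N \<in> sets (PiM J M)" "PT N = zero_op"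
  shows "\<nu> N = 0"
proof -
  have J: "finite J" "k + 1 \<in> J" by (simp_all add: J_def)
  note Pk = P[OF J(2)]
  let ?c = "chain_functional P b h' k"
  have "cmod (\<nu> N) \<le> 0 + e" if e: "e > 0" for e
  proof -
    \<comment> \<open>The estimate on grid sets will be \<open>d * norm h\<close>; the added 1
      covers \<open>h = 0\<close>.\<close>
    define d where "d = e / (norm h + 1)"
    have d: "d > 0" unfolding d_def using e by (intro divide_pos_pos add_nonneg_pos) auto
    obtain c where c: "elementary_functional H P k c" and gb: "grid_bound M H k (\<lambda>G v. ?c G v - c G v) d"
      using chain_functional_approx[where n=k and M=M and H=H and P=P and b=b and h'=h'] P b h(2) d
      unfolding J_def by blast
    obtain \<kappa> where \<kappa>: "cmeas (PiM J M) \<kappa>" "\<forall>N\<in>sets (PiM J M). PT N = zero_op \<longrightarrow> \<kappa> N = 0"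
      "\<forall>G\<in>(\<Pi> j\<in>J. sets (M j)). \<kappa> (PiE J G) = c G h"
      using elementary_functional_measure[OF c h(1), of M T \<tau> PT] P PT unfolding J_def by blast
    define \<delta> where "\<delta> = (\<lambda>G. \<nu> G - \<kappa> G)"
    have \<delta>: "cmeas (PiM J M) \<delta>" unfolding \<delta>_def by (rule cmeas_diff[OF \<nu> \<kappa>(1)])
    have rc: "rect_functional M H P k (\<lambda>G v. ?c G v - c G v)"
      using P unfolding J_def
      by (intro rect_functional_diff rect_functional_chain rect_functional_elementary[OF c]
        hilbert_schmidt_bounded_ops b) auto
    have "cmod (\<delta> A) \<le> d * norm h" if A0: "A \<in> grid_sets J M" for A
    proof -
      obtain q R where q: "\<forall>j\<in>J. q j \<in> measurable (M j) (count_space (UNIV::nat set)) \<and> finite (q j ` space (M j))"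
        and A: "A = {\<omega>\<in>space (PiM J M). R (\<lambda>j\<in>J. q j (\<omega> j))}" using A0 unfolding grid_sets_def by auto
      define I where "I j = q j ` space (M j)" for j
      define D where "D = grid_cell M q"
      have I: "finite (I j)" if "j \<in> J" for j using q that by (simp add: I_def)
      have D: "D j i \<in> sets (M j)" if "j \<in> J" for j i using q that by (simp add: D_def grid_cell_sets)
      have disj: "disjoint_family_on (D j) (I j)" for j by (auto simp: disjoint_family_on_def D_def grid_cell_def)
      have fin: "finite (PiE J I)" using J I by (intro finite_PiE) auto
      have cell: "(\<lambda>j. D j (r j)) \<in> (\<Pi> j\<in>J. sets (M j))" for r using D by auto
      have "\<delta> A = (\<Sum>r\<in>{r\<in>PiE J I. R r}. \<delta> (PiE J (\<lambda>j. D j (r j))))"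
        unfolding A grid_set_eq_UN I_def[symmetric] D_def[symmetric]
        using fin J D disjoint_family_on_mono[OF _ disjoint_grid_cells[of J M q I], of "{r\<in>PiE J I. R r}"]
        by (intro cmeas_finite_UN[OF \<delta>] sets_PiM_I_finite) (auto simp: D_def)
      then have "cmod (\<delta> A) \<le> (\<Sum>r\<in>{r\<in>PiE J I. R r}. cmod (\<delta> (PiE J (\<lambda>j. D j (r j)))))"
        by (simp add: norm_sum)
      also have "\<dots> \<le> (\<Sum>r\<in>PiE J I. cmod (\<delta> (PiE J (\<lambda>j. D j (r j)))))"
        using fin by (intro sum_mono2) auto
      \<comment> \<open>The projection of the last side is inserted before the grid bound is
        applied. The weights become \<open>norm (P (k+1) (D (k+1) i) h)\<close>, square summable
        with bound \<open>norm h\<close>; the constant weight \<open>norm h\<close> would grow with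
        the number of cells.\<close>
      also have "\<dots> = (\<Sum>r\<in>PiE J I. cmod (?c (\<lambda>j. D j (r j)) (P (k+1) (D (k+1) (r (k+1))) h) -
          c (\<lambda>j. D j (r j)) (P (k+1) (D (k+1) (r (k+1))) h)))"
      proof (rule sum.cong[OF refl])
        fix r
        have "\<delta> (PiE J (\<lambda>j. D j (r j))) = ?c (\<lambda>j. D j (r j)) h - c (\<lambda>j. D j (r j)) h"
          using rect[OF cell] \<kappa>(3) cell by (simp add: \<delta>_def chain_functional_def)
        also have "\<dots> = ?c (\<lambda>j. D j (r j)) (P (k+1) (D (k+1) (r (k+1))) h) -
          c (\<lambda>j. D j (r j)) (P (k+1) (D (k+1) (r (k+1))) h)"
          using rect_functionalD(4)[OF rc cell[unfolded J_def] h(1)] by simp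
        finally show "cmod (\<delta> (PiE J (\<lambda>j. D j (r j)))) = cmod (?c (\<lambda>j. D j (r j)) (P (k+1) (D (k+1) (r (k+1))) h) -
          c (\<lambda>j. D j (r j)) (P (k+1) (D (k+1) (r (k+1))) h))" by simp
      qed
      also have "\<dots> \<le> d * L2_set (\<lambda>i. norm (P (k+1) (D (k+1) i) h)) (I (k+1))"
        unfolding J_def
      proof (rule grid_boundD(2)[OF gb])
        fix r
        show "P (k+1) (D (k+1) (r (k+1))) h \<in> H (k+1)" by (rule pvm_in[OF Pk D[OF J(2)] h(1)])
      qed (use I D disj in \<open>auto simp: J_def\<close>)
      also have "\<dots> \<le> d * norm h"
        unfolding L2_set_def using d pvm_sum_norm_le[OF Pk I[OF J(2)] D[OF J(2)] disj]
        by (intro mult_left_mono real_le_lsqrt) (auto intro: sum_nonneg)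
      finally show ?thesis .
    qed
    then have "cmod (\<delta> N) \<le> d * norm h"
      by (rule cmeas_bound_algebra[OF \<delta> sets_PiM_grid_sets[OF J(1)] algebra_grid_sets _ N(1)])
    also have "\<dots> \<le> d * (norm h + 1)" using d by simp
    also have "\<dots> = e"
    proof -
      have "norm h + 1 \<noteq> 0" using norm_ge_zero[of h] by linarith
      then show ?thesis by (simp add: d_def)
    qed
    finally show ?thesis using \<kappa>(2) N by (simp add: \<delta>_def)
  qed
  then have "cmod (\<nu> N) \<le> 0" by (rule field_le_epsilon)
  then show ?thesis by simp
qed

section \<open>Integration with respect to Hilbert--Schmidt valued measures\<close>

lemma total_variation_bound:
  assumes sv: "semivariation M H K \<mu> < \<infinity>" and l: "l \<in> hs_dual_ball H K"
    and \<pi>: "finite \<pi>" "\<pi> \<subseteq> sets M" "disjoint \<pi>" "\<Union>\<pi> = space M"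
  shows "(\<Sum>G\<in>\<pi>. cmod (l (\<mu> G))) \<le> enn2real (semivariation M H K \<mu>)"
proof -
  have "(\<Sum>G\<in>\<pi>. ennreal (cmod (l (\<mu> G)))) \<le> total_variation M (\<lambda>G. l (\<mu> G))"
    unfolding total_variation_def using \<pi> by (intro SUP_upper) auto
  also have "\<dots> \<le> semivariation M H K \<mu>" unfolding semivariation_def using l by (rule SUP_upper)
  finally have "ennreal (\<Sum>G\<in>\<pi>. cmod (l (\<mu> G))) \<le> ennreal (enn2real (semivariation M H K \<mu>))"
    using sv by simp
  then show ?thesis by (subst (asm) ennreal_le_iff) simp_all
qed

lemma cmeas_hs_vector_measure:
  assumes \<mu>: "hs_vector_measure M H K \<mu>" and sv: "semivariation M H K \<mu> < \<infinity>"
    and H: "hilbert_space H" and K: "csubspace K" and hk: "h \<in> H" "k \<in> K"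
  shows "cmeas M (\<lambda>G. cinner (\<mu> G h) k)"
  unfolding cmeas_def
proof (intro conjI allI impI)
  fix A :: "nat \<Rightarrow> _" assume A: "range A \<subseteq> sets M \<and> disjoint_family A"
  define D where "D n = (\<lambda>x. (\<Sum>i<n. \<mu> (A i) x) - \<mu> (\<Union>i. A i) x)" for n
  have hs: "\<mu> G \<in> hilbert_schmidt H K" if "G \<in> sets M" for G using \<mu> that by (simp add: hs_vector_measure_def)
  have Ai: "A i \<in> sets M" for i using A by auto
  then have "(\<Union>i. A i) \<in> sets M" by auto
  then have D: "D n \<in> hilbert_schmidt H K" for n
    unfolding D_def by (intro hilbert_schmidt_diff[OF hilbert_schmidt_sum[OF K] _ K] hs Ai)
  have lim: "(\<lambda>n. hs_norm H (D n)) \<longlonglongrightarrow> 0" using \<mu> A by (simp add: hs_vector_measure_def D_def)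
  have "(\<lambda>n. (\<Sum>i<n. cinner (\<mu> (A i) h) k) - cinner (\<mu> (\<Union>i. A i) h) k) \<longlonglongrightarrow> 0"
  proof (rule Lim_null_comparison)
    have "norm (D n h) \<le> hs_norm H (D n) * norm h" for n
      by (rule norm_le_hs_bound[OF hilbert_schmidt_bounded_ops[OF D] H hilbert_schmidt_hs_bound[OF D]])
    then have "cmod (cinner (D n h) k) \<le> hs_norm H (D n) * (norm h * norm k)" for n
      using Cauchy_Schwarz_cinner[of "D n h" k] mult_right_mono[of "norm (D n h)" "hs_norm H (D n) * norm h" "norm k"]
      by (simp add: mult.assoc)
    moreover have "cinner (D n h) k = (\<Sum>i<n. cinner (\<mu> (A i) h) k) - cinner (\<mu> (\<Union>i. A i) h) k" for n
      by (simp add: D_def cinner_diff_left cinner_sum_left)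
    ultimately show "\<forall>\<^sub>F n in sequentially. norm ((\<Sum>i<n. cinner (\<mu> (A i) h) k) - cinner (\<mu> (\<Union>i. A i) h) k)
        \<le> hs_norm H (D n) * (norm h * norm k)" by (intro always_eventually allI) metis
    show "(\<lambda>n. hs_norm H (D n) * (norm h * norm k)) \<longlonglongrightarrow> 0"
      by (rule tendsto_mult_left_zero[OF lim])
  qed
  then show "(\<lambda>n. cinner (\<mu> (A n) h) k) sums cinner (\<mu> (\<Union>n. A n) h) k"
    unfolding sums_def by (rule LIM_zero_cancel)
next
  \<comment> \<open>Division by \<open>a\<close> moves the coefficient functional into the dual unit
    ball; the added 1 keeps \<open>a\<close> positive for zero vectors.\<close>
  define a where "a = 1 + norm h * norm k"
  have a: "a > 0" by (simp add: a_def add_pos_nonneg)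
  define l where "l A = cinner (A h) k / complex_of_real a" for A :: "'b \<Rightarrow> 'c"
  have l: "l \<in> hs_dual_ball H K" unfolding hs_dual_ball_def
  proof (intro CollectI conjI ballI allI)
    fix A assume A: "A \<in> hilbert_schmidt H K"
    have "cmod (cinner (A h) k) \<le> norm (A h) * norm k" by (rule Cauchy_Schwarz_cinner)
    also have "\<dots> \<le> (hs_norm H A * norm h) * norm k"
      by (intro mult_right_mono norm_le_hs_bound[OF hilbert_schmidt_bounded_ops[OF A] H hilbert_schmidt_hs_bound[OF A]]) simp
    also have "\<dots> \<le> hs_norm H A * a" unfolding mult.assoc a_def by (intro mult_left_mono hs_norm_nonneg) simp
    finally show "cmod (l A) \<le> hs_norm H A" using a by (simp add: l_def norm_divide divide_le_eq)
  qed (simp_all add: l_def cinner_add_left cinner_scaleC_left add_divide_distrib)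
  have "cmod (cinner (\<mu> G h) k) \<le> enn2real (semivariation M H K \<mu>) * a" if G: "G \<in> sets M" for G
  proof -
    \<comment> \<open>The semivariation controls sums over partitions of the space, so
      \<open>G\<close> is completed by its complement.\<close>
    have "cmod (l (\<mu> G)) \<le> (\<Sum>G\<in>{G, space M - G}. cmod (l (\<mu> G)))"
      by (rule member_le_sum[where f="\<lambda>G. cmod (l (\<mu> G))"]) auto
    also have "\<dots> \<le> enn2real (semivariation M H K \<mu>)"
      using G sets.sets_into_space[OF G] by (intro total_variation_bound[OF sv l]) (auto simp: disjoint_def)
    finally show ?thesis using a by (simp add: l_def norm_divide divide_le_eq)
  qed
  then show "\<exists>B. \<forall>G\<in>sets M. cmod (cinner (\<mu> G h) k) \<le> B" by blast
qed

lemma simple_vector_integral_hs: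
  assumes \<mu>: "hs_vector_measure M H K \<mu>" and K: "csubspace K" and s: "simple_function M s"
  shows "simple_vector_integral M \<mu> s \<in> hilbert_schmidt H K"
  unfolding simple_vector_integral_def
  using \<mu> simple_functionD(2)[OF s]
  by (intro hilbert_schmidt_sum[OF K] hilbert_schmidt_scaleC[OF _ K]) (auto simp: hs_vector_measure_def)

lemma cinner_simple_vector_integral:
  assumes "cmeas M (\<lambda>G. cinner (\<mu> G h) k)" and s: "simple_function M s"
  shows "cinner (simple_vector_integral M \<mu> s h) k = cint M (\<lambda>G. cinner (\<mu> G h) k) s"
  unfolding simple_vector_integral_def cint_simple[OF assms]
  by (simp add: cinner_sum_left cinner_scaleC_left)

text \<open>The semivariation sees only scalar images of \<open>\<mu>\<close>. The Hilbert-Schmidt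
  norm over finitely many basis vectors is recovered by duality, testing with the integral
  itself.\<close>

lemma hs_bound_simple_vector_integral:
  assumes \<mu>: "hs_vector_measure M H K \<mu>" and sv: "semivariation M H K \<mu> < \<infinity>"
    and K: "csubspace K" and s: "simple_function M s"
    and c: "c \<ge> 0" "\<And>x. x \<in> space M \<Longrightarrow> cmod (s x) \<le> c"
  shows "hs_bound H (simple_vector_integral M \<mu> s) (c * enn2real (semivariation M H K \<mu>))"
  unfolding hs_bound_L2_set
proof (intro conjI allI impI)
  let ?V = "enn2real (semivariation M H K \<mu>)"
  show "0 \<le> c * ?V" using c by simp
  fix F assume F: "finite F \<and> F \<subseteq> some_onb H"
  define S where "S = simple_vector_integral M \<mu> s"
  define L where "L = L2_set (\<lambda>e. norm (S e)) F"
  have L2: "complex_of_real (L * L) = (\<Sum>e\<in>F. cinner (S e) (S e))"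
    by (simp add: L_def L2_set_def cinner_self sum_nonneg)
  show "L2_set (\<lambda>e. norm (simple_vector_integral M \<mu> s e)) F \<le> c * ?V"
  proof (cases "L = 0")
    case True
    then show ?thesis using c by (simp add: L_def S_def)
  next
    case False
    then have L: "L > 0" unfolding L_def using L2_set_nonneg by (metis less_eq_real_def)
    \<comment> \<open>The normalised pairing with \<open>S\<close> on \<open>F\<close>: it lies in
      the dual ball and takes the value \<open>L\<close> at \<open>S\<close>.\<close>
    define l where "l A = (\<Sum>e\<in>F. cinner (A e) (S e)) / complex_of_real L" for A :: "'b \<Rightarrow> 'c"
    have l: "l \<in> hs_dual_ball H K" unfolding hs_dual_ball_def
    proof (intro CollectI conjI ballI allI)
      fix A assume A: "A \<in> hilbert_schmidt H K"
      have "cmod (\<Sum>e\<in>F. cinner (A e) (S e)) \<le> (\<Sum>e\<in>F. \<bar>norm (A e)\<bar> * \<bar>norm (S e)\<bar>)"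
        by (rule order_trans[OF norm_sum]) (auto intro!: sum_mono simp: Cauchy_Schwarz_cinner)
      also have "\<dots> \<le> L2_set (\<lambda>e. norm (A e)) F * L" unfolding L_def by (rule L2_set_mult_ineq)
      also have "\<dots> \<le> hs_norm H A * L"
        using hilbert_schmidt_hs_bound[OF A] F L unfolding hs_bound_L2_set by (intro mult_right_mono) auto
      finally show "cmod (l A) \<le> hs_norm H A" using L by (simp add: l_def norm_divide divide_le_eq)
    qed (simp_all add: l_def cinner_add_left cinner_scaleC_left sum.distrib add_divide_distrib sum_distrib_left)
    define G where "G z = s -` {z} \<inter> space M" for z
    have fin: "finite (s ` space M)" and G: "G z \<in> sets M" for z
      unfolding G_def by (rule simple_functionD[OF s])+
    \<comment> \<open>A partition is a set of sets, so the level sets must be distinct; they are,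
      because each of them is nonempty.\<close>
    have inj: "inj_on G (s ` space M)"
    proof (rule inj_onI)
      fix z z' assume "z \<in> s ` space M" "z' \<in> s ` space M" and eq: "G z = G z'"
      then obtain x where "x \<in> G z" by (auto simp: G_def)
      then show "z = z'" using eq by (auto simp: G_def)
    qed
    have "complex_of_real L = (\<Sum>e\<in>F. cinner (S e) (S e)) / complex_of_real L"
      using L2 L by (simp add: field_simps)
    also have "\<dots> = (\<Sum>e\<in>F. \<Sum>z\<in>s ` space M. z * cinner (\<mu> (G z) e) (S e)) / complex_of_real L"
      by (subst (1) S_def) (simp add: simple_vector_integral_def cinner_sum_left cinner_scaleC_left G_def)
    also have "\<dots> = (\<Sum>z\<in>s ` space M. z * l (\<mu> (G z)))"
      by (subst sum.swap) (simp add: l_def sum_distrib_left sum_divide_distrib)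
    finally have "L = cmod (\<Sum>z\<in>s ` space M. z * l (\<mu> (G z)))"
      using L by (metis norm_of_real abs_of_pos)
    also have "\<dots> \<le> (\<Sum>z\<in>s ` space M. c * cmod (l (\<mu> (G z))))"
      by (rule order_trans[OF norm_sum]) (auto intro!: sum_mono mult_right_mono simp: norm_mult c)
    also have "\<dots> = c * (\<Sum>A\<in>G ` s ` space M. cmod (l (\<mu> A)))"
      by (simp add: sum.reindex[OF inj] sum_distrib_left)
    also have "\<dots> \<le> c * ?V"
      using fin G by (intro mult_left_mono c total_variation_bound[OF sv l]) (auto simp: disjoint_def G_def)
    finally show ?thesis by (simp add: L_def S_def)
  qed
qed

text \<open>Real and imaginary parts are rounded down to multiples of \<open>d / 2\<close>.
  Pointwise approximation would not do, since the vector integral is continuous in the uniform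
  norm.\<close>

lemma uniform_simple_approx:
  fixes f :: "'w \<Rightarrow> complex"
  assumes f[measurable]: "f \<in> borel_measurable M" and c: "\<And>x. x \<in> space M \<Longrightarrow> cmod (f x) \<le> c" and d: "d > 0"
  shows "\<exists>s. simple_function M s \<and> (\<forall>x\<in>space M. cmod (s x - f x) \<le> d)"
proof -
  define r where "r t = d / 2 * of_int \<lfloor>t / (d / 2)\<rfloor>" for t :: real
  have r: "\<bar>r t - t\<bar> \<le> d / 2" for t
  proof -
    have "of_int \<lfloor>t / (d / 2)\<rfloor> * (d / 2) \<le> t" "t < (of_int \<lfloor>t / (d / 2)\<rfloor> + 1) * (d / 2)"
      using d by (intro floor_divide_lower floor_divide_upper; simp)+
    then show ?thesis unfolding r_def by (simp only: distrib_right mult.commute[of "d / 2"])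
  qed
  have [measurable]: "r \<in> borel_measurable borel" unfolding r_def[abs_def] by measurable
  define s where "s x = Complex (r (Re (f x))) (r (Im (f x)))" for x
  have s_eq: "s = (\<lambda>x. complex_of_real (r (Re (f x))) + \<i> * complex_of_real (r (Im (f x))))"
    by (auto simp: s_def complex_eq_iff)
  have "s \<in> borel_measurable M" unfolding s_eq by measurable
  moreover have "finite (s ` space M)"
  proof -
    \<comment> \<open>Rounding down can move an index below \<open>- (c / (d / 2))\<close> by less
      than 1, hence the added 1.\<close>
    define N where "N = \<lceil>c / (d / 2)\<rceil> + 1"
    have rN: "\<lfloor>t / (d / 2)\<rfloor> \<in> {-N..N}" if "\<bar>t\<bar> \<le> c" for t
    proof -
      have "t / (d / 2) \<le> c / (d / 2)" "- (c / (d / 2)) \<le> t / (d / 2)"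
        using that d by (auto simp: field_simps)
      then show ?thesis unfolding N_def by (auto simp: floor_le_iff le_floor_iff) linarith+
    qed
    have "s ` space M \<subseteq> (\<lambda>(a, b). Complex (d / 2 * of_int a) (d / 2 * of_int b)) ` ({-N..N} \<times> {-N..N})"
    proof
      fix z assume "z \<in> s ` space M"
      then obtain x where x: "x \<in> space M" "z = s x" by auto
      have "\<bar>Re (f x)\<bar> \<le> c" "\<bar>Im (f x)\<bar> \<le> c"
        using c[OF x(1)] abs_Re_le_cmod[of "f x"] abs_Im_le_cmod[of "f x"] by auto
      then have "(\<lfloor>Re (f x) / (d / 2)\<rfloor>, \<lfloor>Im (f x) / (d / 2)\<rfloor>) \<in> {-N..N} \<times> {-N..N}" using rN by blast
      then show "z \<in> (\<lambda>(a, b). Complex (d / 2 * of_int a) (d / 2 * of_int b)) ` ({-N..N} \<times> {-N..N})"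
        unfolding x(2) s_def r_def by (rule rev_image_eqI) simp
    qed
    then show ?thesis by (rule finite_subset) auto
  qed
  ultimately have "simple_function M s" by (rule simple_function_borel_measurable)
  moreover have "cmod (s x - f x) \<le> d" for x
  proof -
    have "cmod (s x - f x) \<le> \<bar>Re (s x - f x)\<bar> + \<bar>Im (s x - f x)\<bar>" by (rule cmod_le)
    then show ?thesis using r[of "Re (f x)"] r[of "Im (f x)"] by (simp add: s_def)
  qed
  ultimately show ?thesis by blast
qed

lemma cint_diff:
  assumes "\<And>i. integrable (jordan M \<nu> i) f" "\<And>i. integrable (jordan M \<nu> i) g"
  shows "cint M \<nu> (\<lambda>x. f x - g x) = cint M \<nu> f - cint M \<nu> g"
  unfolding cint_def using assms by (simp add: sum_subtractf right_diff_distrib)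

text \<open>The operator is built from the form of scalar integrals. Convergence of simple integrals
  to it in Hilbert-Schmidt norm is established afterwards, by limits in finite sums of
  coefficients.\<close>

lemma bounded_vector_integral:
  assumes \<mu>: "hs_vector_measure M H K \<mu>" and sv: "semivariation M H K \<mu> < \<infinity>"
    and H: "hilbert_space H" and K: "hilbert_space K"
    and f: "f \<in> borel_measurable M" and c: "\<And>x. x \<in> space M \<Longrightarrow> cmod (f x) \<le> c"
  shows "bounded_vector_integral M H K \<mu> f \<in> bounded_ops H K"
    and "h \<in> H \<Longrightarrow> k \<in> K \<Longrightarrow> cinner (bounded_vector_integral M H K \<mu> f h) k = cint M (\<lambda>G. cinner (\<mu> G h) k) f"
proof -
  define V where "V = enn2real (semivariation M H K \<mu>)"
  have V: "V \<ge> 0" by (simp add: V_def)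
  note sK = hilbert_space_csubspace[OF K] and sH = hilbert_space_csubspace[OF H]
  note \<nu> = cmeas_hs_vector_measure[OF \<mu> sv H sK]
  let ?S = "simple_vector_integral M \<mu>"
  note Shs = simple_vector_integral_hs[OF \<mu> sK]
  note Sbo = hilbert_schmidt_bounded_ops[OF Shs]
  have simple_bd: "\<exists>b. \<forall>x\<in>space M. cmod (s x) \<le> b" if s: "simple_function M s" for s :: "_ \<Rightarrow> complex"
    using simple_functionD(1)[OF s] by (intro exI[of _ "Max (cmod ` s ` space M)"]) auto
  have int_simple: "integrable (jordan M (\<lambda>G. cinner (\<mu> G h) k) i) s"
    if "h \<in> H" "k \<in> K" "simple_function M s" for h k i and s :: "_ \<Rightarrow> complex"
    using simple_bd[OF that(3)] integrable_jordan_bounded[OF \<nu>[OF that(1,2)] borel_measurable_simple_function[OF that(3)]] by blast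
  have int_f: "integrable (jordan M (\<lambda>G. cinner (\<mu> G h) k) i) f" if "h \<in> H" "k \<in> K" for h k i
    by (rule integrable_jordan_bounded[OF \<nu>[OF that] f c])
  \<comment> \<open>The two sides are sums over different level sets, so linearity is checked on
    coefficients, where it is linearity of \<open>cint\<close>.\<close>
  have S_diff: "?S s x - ?S s' x = ?S (\<lambda>x. s x - s' x) x"
    if s: "simple_function M s" "simple_function M s'" for s s' x
  proof (cases "x \<in> H")
    case True
    have s'': "simple_function M (\<lambda>x. s x - s' x)" using s by (rule simple_function_diff)
    show ?thesis
    proof (rule eq_if_cinner_eq[OF sK])
      show "?S s x - ?S s' x \<in> K" "?S (\<lambda>x. s x - s' x) x \<in> K"
        using True s s'' by (auto intro!: csubspaceD(6)[OF sK] bounded_opsD(1)[OF Sbo])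
      fix k assume k: "k \<in> K"
      show "cinner (?S s x - ?S s' x) k = cinner (?S (\<lambda>x. s x - s' x) x) k"
        unfolding cinner_diff_left
        using s s'' cint_diff[OF int_simple[OF True k s(1)] int_simple[OF True k s(2)]]
        by (simp add: cinner_simple_vector_integral[where \<mu>=\<mu>, OF \<nu>[OF True k]])
    qed
  next
    case False
    have "simple_function M (\<lambda>x. s x - s' x)" using s by (rule simple_function_diff)
    then show ?thesis using False s bounded_opsD(2)[OF Sbo] by simp
  qed
  have "\<exists>s. simple_function M s \<and> (\<forall>x\<in>space M. cmod (s x - f x) \<le> 1 / real (Suc n))" for n
    by (rule uniform_simple_approx[OF f c]) simp_all
  then obtain s where s: "\<And>n. simple_function M (s n)"
    and sf: "\<And>n x. x \<in> space M \<Longrightarrow> cmod (s n x - f x) \<le> 1 / real (Suc n)" by metis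
  have null: "(\<lambda>n. 1 / real (Suc n)) \<longlonglongrightarrow> 0" by (rule LIMSEQ_Suc[OF lim_1_over_n])
  have slim: "(\<lambda>n. s n x) \<longlonglongrightarrow> f x" if "x \<in> space M" for x
    by (rule LIM_zero_cancel, rule Lim_null_comparison[OF always_eventually null]) (use sf that in auto)
  have sc: "cmod (s n x) \<le> c + 1" if "x \<in> space M" for n x
  proof -
    have "1 / real (Suc n) \<le> 1" by simp
    then show ?thesis using sf[OF that, of n] c[OF that] norm_triangle_sub[of "s n x" "f x"] by linarith
  qed
  have lim: "(\<lambda>n. cinner (?S (s n) h) k) \<longlonglongrightarrow> cint M (\<lambda>G. cinner (\<mu> G h) k) f" if hk: "h \<in> H" "k \<in> K" for h k
    unfolding cinner_simple_vector_integral[where \<mu>=\<mu>, OF \<nu>[OF hk] s]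
    using s slim sc by (intro cint_tendsto[OF \<nu>[OF hk]] borel_measurable_simple_function)
  have "\<exists>T\<in>bounded_ops H K. \<forall>h\<in>H. \<forall>k\<in>K. cinner (T h) k = cint M (\<lambda>G. cinner (\<mu> G h) k) f"
  proof (rule bounded_ops_of_form[OF sH K])
    show "0 \<le> max 0 (c + 1) * V" using V by simp
    fix h k assume hk: "h \<in> H" "k \<in> K"
    have "cmod (cinner (?S (s n) h) k) \<le> max 0 (c + 1) * V * norm h * norm k" for n
    proof -
      have "hs_bound H (?S (s n)) (max 0 (c + 1) * V)"
        unfolding V_def using sc by (intro hs_bound_simple_vector_integral[OF \<mu> sv sK s]) (auto simp: le_max_iff_disj)
      then have "norm (?S (s n) h) \<le> max 0 (c + 1) * V * norm h" by (rule norm_le_hs_bound[OF Sbo[OF s] H])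
      then show ?thesis using Cauchy_Schwarz_cinner[of "?S (s n) h" k]
        by (meson mult_right_mono norm_ge_zero order_trans)
    qed
    then show "cmod (cint M (\<lambda>G. cinner (\<mu> G h) k) f) \<le> max 0 (c + 1) * V * norm h * norm k"
      by (intro LIMSEQ_le_const2[OF tendsto_norm[OF lim[OF hk]]]) auto
    show "cint M (\<lambda>G. cinner (\<mu> G (a *\<^sub>C h)) k) f = a * cint M (\<lambda>G. cinner (\<mu> G h) k) f" for a
      using tendsto_mult_left[OF lim[OF hk], of a] csubspaceD(3)[OF sH hk(1), of a]
      by (intro LIMSEQ_unique[OF lim[of "a *\<^sub>C h" k]]) (auto simp: hk bounded_opsD(4)[OF Sbo[OF s] hk(1)] cinner_scaleC_left)
    show "cint M (\<lambda>G. cinner (\<mu> G h) (a *\<^sub>C k)) f = cnj a * cint M (\<lambda>G. cinner (\<mu> G h) k) f" for a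
      using tendsto_mult_left[OF lim[OF hk], of "cnj a"] csubspaceD(3)[OF sK hk(2), of a]
      by (intro LIMSEQ_unique[OF lim[of h "a *\<^sub>C k"]]) (auto simp: hk cinner_scaleC_right)
    show "cint M (\<lambda>G. cinner (\<mu> G h) (k + l)) f = cint M (\<lambda>G. cinner (\<mu> G h) k) f + cint M (\<lambda>G. cinner (\<mu> G h) l) f"
      if l: "l \<in> K" for l
      using tendsto_add[OF lim[OF hk] lim[OF hk(1) l]] csubspaceD(2)[OF sK hk(2) l]
      by (intro LIMSEQ_unique[OF lim[of h "k + l"]]) (auto simp: hk cinner_add_right)
    show "cint M (\<lambda>G. cinner (\<mu> G (h + l)) k) f = cint M (\<lambda>G. cinner (\<mu> G h) k) f + cint M (\<lambda>G. cinner (\<mu> G l) k) f"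
      if l: "l \<in> H" for l
      using tendsto_add[OF lim[OF hk] lim[OF l hk(2)]] csubspaceD(2)[OF sH hk(1) l]
      by (intro LIMSEQ_unique[OF lim[of "h + l" k]]) (auto simp: hk l bounded_opsD(3)[OF Sbo[OF s] hk(1)] cinner_add_left)
  qed
  then obtain T where T: "T \<in> bounded_ops H K" "\<forall>h\<in>H. \<forall>k\<in>K. cinner (T h) k = cint M (\<lambda>G. cinner (\<mu> G h) k) f" by blast
  note EH = onb_some_onb[OF H] and EK = onb_some_onb[OF K]
  \<comment> \<open>\<open>u\<close> is compared with the sequence \<open>s n\<close>, for which the
    bound for simple functions applies; in the limit the error \<open>1 / Suc n\<close> disappears
    from the coefficient sums, and \<open>Parseval_le\<close> returns to norms.\<close>
  have close: "hs_bound H (\<lambda>x. ?S u x - T x) (d * V)"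
    if u: "simple_function M u" "\<And>x. x \<in> space M \<Longrightarrow> cmod (u x - f x) \<le> d" and d: "d \<ge> 0" for u d
    unfolding hs_bound_def
  proof (intro conjI allI impI)
    show "0 \<le> d * V" using d V by simp
    fix F assume F: "finite F \<and> F \<subseteq> some_onb H"
    have FH: "e \<in> H" if "e \<in> F" for e using F that onb_subset[OF EH] by blast
    show "(\<Sum>e\<in>F. (norm (?S u e - T e))\<^sup>2) \<le> (d * V)\<^sup>2"
    proof (rule Parseval_le[OF EK])
      show "finite F" using F by simp
      show "?S u e - T e \<in> K" if "e \<in> F" for e
        by (rule csubspaceD(6)[OF sK bounded_opsD(1)[OF Sbo[OF u(1)] FH[OF that]] bounded_opsD(1)[OF T(1) FH[OF that]]])
      fix G assume G: "finite G" "G \<subseteq> some_onb K"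
      have GK: "g \<in> K" if "g \<in> G" for g using G that onb_subset[OF EK] by blast
      have "(\<Sum>e\<in>F. \<Sum>g\<in>G. (cmod (cinner (?S u e - ?S (s n) e) g))\<^sup>2) \<le> ((d + 1 / real (Suc n)) * V)\<^sup>2" for n
      proof -
        have "(\<Sum>e\<in>F. \<Sum>g\<in>G. (cmod (cinner (?S u e - ?S (s n) e) g))\<^sup>2) \<le> (\<Sum>e\<in>F. (norm (?S u e - ?S (s n) e))\<^sup>2)"
          by (intro sum_mono Bessel[OF onb_ortho_set[OF EK] G])
        also have "\<dots> = (\<Sum>e\<in>F. (norm (?S (\<lambda>x. u x - s n x) e))\<^sup>2)"
          by (simp only: S_diff[OF u(1) s])
        also have "\<dots> \<le> ((d + 1 / real (Suc n)) * V)\<^sup>2"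
        proof (rule hs_boundD(2)[of H])
          show "hs_bound H (?S (\<lambda>x. u x - s n x)) ((d + 1 / real (Suc n)) * V)"
            unfolding V_def
          proof (rule hs_bound_simple_vector_integral[OF \<mu> sv sK])
            show "simple_function M (\<lambda>x. u x - s n x)" using u(1) s by (rule simple_function_diff)
            show "cmod (u x - s n x) \<le> d + 1 / real (Suc n)" if "x \<in> space M" for x
              using norm_triangle_ineq4[of "u x - f x" "s n x - f x"] u(2)[OF that] sf[OF that, of n] by simp
          qed (use d in simp)
        qed (use F in auto)
        finally show ?thesis .
      qed
      moreover have "(\<lambda>n. \<Sum>e\<in>F. \<Sum>g\<in>G. (cmod (cinner (?S u e - ?S (s n) e) g))\<^sup>2) \<longlonglongrightarrow>
          (\<Sum>e\<in>F. \<Sum>g\<in>G. (cmod (cinner (?S u e - T e) g))\<^sup>2)"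
        unfolding cinner_diff_left
        using lim[OF FH GK] T(2) FH GK by (intro tendsto_sum tendsto_power tendsto_norm tendsto_diff tendsto_const) auto
      moreover have "(\<lambda>n. ((d + 1 / real (Suc n)) * V)\<^sup>2) \<longlonglongrightarrow> ((d + 0) * V)\<^sup>2"
        by (intro tendsto_power tendsto_mult tendsto_add tendsto_const null)
      ultimately show "(\<Sum>e\<in>F. \<Sum>g\<in>G. (cmod (cinner (?S u e - T e) g))\<^sup>2) \<le> (d * V)\<^sup>2"
        by (intro LIMSEQ_le[where X="\<lambda>n. \<Sum>e\<in>F. \<Sum>g\<in>G. (cmod (cinner (?S u e - ?S (s n) e) g))\<^sup>2"
          and Y="\<lambda>n. ((d + 1 / real (Suc n)) * V)\<^sup>2"]) auto
    qed
  qed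
  have Ths: "T \<in> hilbert_schmidt H K"
  proof (rule hilbert_schmidtI[OF T(1)])
    \<comment> \<open>\<open>T\<close> is a simple integral minus its error; \<open>s 0\<close> lies
      within distance 1 of \<open>f\<close>, which explains \<open>1 * V\<close>.\<close>
    have "hs_bound H (\<lambda>x. ?S (s 0) x - (?S (s 0) x - T x)) (hs_norm H (?S (s 0)) + 1 * V)"
      using sf[of _ 0] by (intro hs_bound_diff[OF hilbert_schmidt_hs_bound[OF Shs[OF s]] close[OF s]]) auto
    then show "hs_bound H T (hs_norm H (?S (s 0)) + 1 * V)" by simp
  qed
  have conv: "(\<lambda>n. hs_norm H (\<lambda>x. ?S (u n) x - T x)) \<longlonglongrightarrow> 0"
    if u: "\<forall>n. simple_function M (u n)" "uniform_limit (space M) u f sequentially" for u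
  proof (rule LIMSEQ_I)
    fix e :: real assume e: "e > 0"
    define d where "d = e / (2 * (V + 1))"
    have d: "d > 0" using e V by (simp add: d_def)
    have "d * V \<le> d * (V + 1)" using d by simp
    also have "\<dots> = e / 2" using V by (simp add: d_def field_simps)
    finally have dV: "d * V < e" using e by simp
    have "\<forall>\<^sub>F n in sequentially. \<forall>x\<in>space M. dist (u n x) (f x) < d" using u(2) d by (rule uniform_limitD)
    then obtain N where N: "\<And>n x. n \<ge> N \<Longrightarrow> x \<in> space M \<Longrightarrow> dist (u n x) (f x) < d"
      unfolding eventually_sequentially by blast
    have "norm (hs_norm H (\<lambda>x. ?S (u n) x - T x) - 0) < e" if n: "n \<ge> N" for n
    proof -
      have "hs_norm H (\<lambda>x. ?S (u n) x - T x) \<le> d * V"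
        using u(1) N[OF n] d by (intro hs_norm_le close) (auto simp: dist_norm less_imp_le)
      then show ?thesis using dV hs_norm_nonneg[of H "\<lambda>x. ?S (u n) x - T x"] by simp
    qed
    then show "\<exists>N. \<forall>n\<ge>N. norm (hs_norm H (\<lambda>x. ?S (u n) x - T x) - 0) < e" by blast
  qed
  have unif: "uniform_limit (space M) s f sequentially"
  proof (rule uniform_limitI)
    fix e :: real assume "e > 0"
    then have "\<forall>\<^sub>F n in sequentially. 1 / real (Suc n) < e" by (rule order_tendstoD(2)[OF null])
    then show "\<forall>\<^sub>F n in sequentially. \<forall>x\<in>space M. dist (s n x) (f x) < e"
    proof eventually_elim
      case (elim n)
      then show ?case using sf[of _ n] by (auto simp: dist_norm intro: le_less_trans)
    qed
  qed
  have "bounded_vector_integral M H K \<mu> f = T"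
    unfolding bounded_vector_integral_def
  proof (rule the_equality)
    show "T \<in> hilbert_schmidt H K \<and> (\<forall>s. (\<forall>n. simple_function M (s n)) \<and> uniform_limit (space M) s f sequentially \<longrightarrow>
      (\<lambda>n. hs_norm H (\<lambda>x. ?S (s n) x - T x)) \<longlonglongrightarrow> 0)" using Ths conv by blast
    fix T' assume T': "T' \<in> hilbert_schmidt H K \<and> (\<forall>s. (\<forall>n. simple_function M (s n)) \<and> uniform_limit (space M) s f sequentially \<longrightarrow>
      (\<lambda>n. hs_norm H (\<lambda>x. ?S (s n) x - T' x)) \<longlonglongrightarrow> 0)"
    \<comment> \<open>Convergence in Hilbert-Schmidt norm implies pointwise convergence, so the
      common sequence \<open>s\<close> determines the operator.\<close>
    have pw: "(\<lambda>n. ?S (s n) x) \<longlonglongrightarrow> R x"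
      if R: "R \<in> hilbert_schmidt H K" "(\<lambda>n. hs_norm H (\<lambda>x. ?S (s n) x - R x)) \<longlonglongrightarrow> 0" for R x
    proof (rule LIM_zero_cancel, rule Lim_null_comparison)
      have D: "(\<lambda>x. ?S (s n) x - R x) \<in> hilbert_schmidt H K" for n
        by (rule hilbert_schmidt_diff[OF Shs[OF s] R(1) sK])
      show "\<forall>\<^sub>F n in sequentially. norm (?S (s n) x - R x) \<le> hs_norm H (\<lambda>x. ?S (s n) x - R x) * norm x"
        by (intro always_eventually allI
          norm_le_hs_bound[OF hilbert_schmidt_bounded_ops[OF D] H hilbert_schmidt_hs_bound[OF D]])
      show "(\<lambda>n. hs_norm H (\<lambda>x. ?S (s n) x - R x) * norm x) \<longlonglongrightarrow> 0"
        by (rule tendsto_mult_left_zero[OF R(2)])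
    qed
    show "T' = T"
    proof
      fix x
      have "(\<lambda>n. ?S (s n) x) \<longlonglongrightarrow> T' x" using T' s unif by (intro pw) auto
      moreover have "(\<lambda>n. ?S (s n) x) \<longlonglongrightarrow> T x" using Ths conv s unif by (intro pw) auto
      ultimately show "T' x = T x" by (rule LIMSEQ_unique)
    qed
  qed
  then show "bounded_vector_integral M H K \<mu> f \<in> bounded_ops H K"
    "h \<in> H \<Longrightarrow> k \<in> K \<Longrightarrow> cinner (bounded_vector_integral M H K \<mu> f h) k = cint M (\<lambda>G. cinner (\<mu> G h) k) f"
    using T by auto
qed

section \<open>Integral projective decompositions\<close>

text \<open>On elementary tensors the projection produces a tensor with a zero component, whose norm
  is 0. Its kernel is a closed subspace, and elementary tensors span a dense one.\<close>

lemma tensor_pvm_slice_null: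
  assumes PT: "tensor_pvm J M H P T \<tau> PT" and J: "finite J" "j \<in> J"
    and P: "\<And>i. i \<in> J \<Longrightarrow> pvm_space (M i) (H i) (P i)"
    and N: "N \<in> sets (M j)" "P j N = zero_op"
  shows "PT (PiE J (\<lambda>i. if i = j then N else space (M i))) = zero_op"
proof -
  note facts = tensor_pvm_facts[OF PT]
  note T = pvm_spaceD(1,2)[OF facts(1)]
  define G where "G i = (if i = j then N else space (M i))" for i
  have G: "G \<in> (\<Pi> i\<in>J. sets (M i))" using N J by (auto simp: G_def)
  have GS: "PiE J G \<in> sets (PiM J M)" using G J by (intro sets_PiM_I_finite) auto
  note R = pvm_spaceD(3)[OF facts(1) GS]
  have elem: "PT (PiE J G) (\<tau> x) = 0" if x: "x \<in> PiE J H" for x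
  proof -
    define y where "y = (\<lambda>i\<in>J. P i (G i) (x i))"
    have y: "y \<in> PiE J H" unfolding y_def using G x by (auto intro!: pvm_in[OF P])
    have "cinner (\<tau> y) (\<tau> y) = (\<Prod>i\<in>J. cinner (y i) (y i))" by (rule facts(3)[OF y y])
    moreover have "y j = 0" using J N by (simp add: y_def G_def zero_op_def)
    then have "(\<Prod>i\<in>J. cinner (y i) (y i)) = 0" using J by (auto simp: prod_zero_iff intro!: bexI[of _ j])
    ultimately have "\<tau> y = 0" by (simp add: cinner_self)
    then show ?thesis using facts(4)[OF G x] by (simp add: y_def)
  qed
  define Z where "Z = {t \<in> T. PT (PiE J G) t = 0}"
  have Z: "csubspace Z" unfolding csubspace_def Z_def
    by (auto simp: csubspaceD[OF T(2)] bounded_ops_0[OF R] bounded_opsD(3,4)[OF R])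
  have "closed Z"
    unfolding closed_sequential_limits
  proof (intro allI impI, elim conjE)
    fix t l assume t: "\<forall>n. t n \<in> Z" "t \<longlonglongrightarrow> l"
    have l: "l \<in> T" using t hilbert_space_closed[OF T(1)] unfolding closed_sequential_limits Z_def by blast
    have "(\<lambda>n. norm (l - t n)) \<longlonglongrightarrow> norm (l - l)" by (intro tendsto_norm tendsto_diff tendsto_const t(2))
    then have "(\<lambda>n. norm (l - t n)) \<longlonglongrightarrow> 0" by simp
    moreover have "norm (PT (PiE J G) l) \<le> norm (l - t n)" for n
    proof -
      have "PT (PiE J G) (l - t n) = PT (PiE J G) l"
        using bounded_ops_diff[OF R T(2) l, of "t n"] t(1) by (simp add: Z_def)
      then show ?thesis using pvm_norm_le[OF facts(1) GS, of "l - t n"] by simp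
    qed
    ultimately have "norm (PT (PiE J G) l) \<le> 0" by (intro LIMSEQ_le_const) auto
    then show "l \<in> Z" using l by (simp add: Z_def)
  qed
  moreover have "csubspace hull (\<tau> ` PiE J H) \<subseteq> Z"
    using elem facts(2) by (intro hull_minimal[where S=csubspace, OF _ Z]) (auto simp: Z_def)
  ultimately have "closure (csubspace hull (\<tau> ` PiE J H)) \<subseteq> Z" by (intro closure_minimal)
  then have "T \<subseteq> Z" using PT by (simp add: tensor_pvm_def hilbert_tensor_def)
  then have "PT (PiE J G) t = 0" for t
    using bounded_opsD(2)[OF R, of t] by (cases "t \<in> T") (auto simp: Z_def)
  then show ?thesis by (simp add: zero_op_def G_def[abs_def] fun_eq_iff)
qed

lemma decomposition_prod_measurable:
  assumes J: "finite J" and \<Phi>: "\<And>j. j \<in> J \<Longrightarrow> \<Phi> j \<in> borel_measurable (M j \<Otimes>\<^sub>M \<rho>)"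
  shows "(\<lambda>(\<omega>, s). \<Prod>j\<in>J. \<Phi> j (\<omega> j, s) :: complex) \<in> borel_measurable (PiM J M \<Otimes>\<^sub>M \<rho>)"
  unfolding case_prod_beta
proof (intro borel_measurable_prod)
  fix j assume j: "j \<in> J"
  have "(\<lambda>p. (fst p j, snd p)) \<in> measurable (PiM J M \<Otimes>\<^sub>M \<rho>) (M j \<Otimes>\<^sub>M \<rho>)"
    by (intro measurable_Pair measurable_compose[OF measurable_fst measurable_component_singleton[OF j]] measurable_snd)
  then show "(\<lambda>p. \<Phi> j (fst p j, snd p)) \<in> borel_measurable (PiM J M \<Otimes>\<^sub>M \<rho>)"
    by (rule measurable_compose[OF _ \<Phi>[OF j]])
qed

text \<open>The measure \<open>\<kappa>\<close> is kept general because two kinds are used: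
  coefficients of \<open>PT\<close>, to bound the integrated function, and coefficients of
  \<open>\<mu>\<close>, for Fubini's theorem. \<open>g\<close> is the measurable majorant behind the
  upper integral.\<close>

lemma decomposition_estimates:
  fixes \<Phi> :: "'i \<Rightarrow> 'w \<times> 's \<Rightarrow> complex"
  defines "\<Psi> \<equiv> \<lambda>J \<omega> s. \<Prod>j\<in>J. \<Phi> j (\<omega> j, s)"
  assumes PT: "tensor_pvm J M H P T \<tau> PT" and J: "finite J"
    and P: "\<And>i. i \<in> J \<Longrightarrow> pvm_space (M i) (H i) (P i)"
    and \<rho>: "sigma_finite_measure \<rho>"
    and \<Phi>: "\<And>j. j \<in> J \<Longrightarrow> \<Phi> j \<in> borel_measurable (M j \<Otimes>\<^sub>M \<rho>)"
    and Linf: "\<And>j s. j \<in> J \<Longrightarrow> s \<in> space \<rho> \<Longrightarrow> (\<lambda>x. \<Phi> j (x, s)) \<in> Linf (M j) (P j)"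
    and g: "g \<in> borel_measurable \<rho>" "(\<integral>\<^sup>+s. g s \<partial>\<rho>) < \<infinity>"
      "AE s in \<rho>. (\<Prod>j\<in>J. ennreal (Linf_norm (M j) (P j) (\<lambda>x. \<Phi> j (x, s)))) \<le> g s"
    and \<kappa>: "cmeas (PiM J M) \<kappa>"
    and ac: "\<And>N. N \<in> sets (PiM J M) \<Longrightarrow> PT N = zero_op \<Longrightarrow> \<kappa> N = 0"
  shows "s \<in> space \<rho> \<Longrightarrow> AE \<omega> in jordan (PiM J M) \<kappa> i. \<forall>j\<in>J. cmod (\<Phi> j (\<omega> j, s)) \<le> Linf_norm (M j) (P j) (\<lambda>x. \<Phi> j (x, s))"
    and "integrable (jordan (PiM J M) \<kappa> i \<Otimes>\<^sub>M \<rho>) (\<lambda>(\<omega>, s). \<Psi> J \<omega> s)"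
    and "AE \<omega> in jordan (PiM J M) \<kappa> i. cmod (\<integral>s. \<Psi> J \<omega> s \<partial>\<rho>) \<le> enn2real (\<integral>\<^sup>+s. g s \<partial>\<rho>)"
proof -
  let ?m = "jordan (PiM J M) \<kappa> i"
  define L where "L j s = Linf_norm (M j) (P j) (\<lambda>x. \<Phi> j (x, s))" for j s
  have L: "L j s \<ge> 0" "P j {x \<in> space (M j). cmod (\<Phi> j (x, s)) > L j s} = zero_op"
    if "j \<in> J" "s \<in> space \<rho>" for j s
    using Linf_norm[OF P Linf] that by (simp_all add: L_def)
  interpret m: finite_measure ?m by (rule finite_measure_jordan[OF \<kappa>])
  interpret \<rho>: sigma_finite_measure \<rho> by (rule \<rho>)
  interpret pair_sigma_finite ?m \<rho> ..
  have bound: "AE \<omega> in ?m. \<forall>j\<in>J. cmod (\<Phi> j (\<omega> j, s)) \<le> L j s" if s: "s \<in> space \<rho>" for s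
    unfolding AE_finite_all[OF J]
  proof
    fix j assume j: "j \<in> J"
    define N where "N = {x \<in> space (M j). cmod (\<Phi> j (x, s)) > L j s}"
    have "(\<lambda>x. \<Phi> j (x, s)) \<in> borel_measurable (M j)" using Linf[OF j s] by (simp add: Linf_def)
    then have N: "N \<in> sets (M j)" unfolding N_def by measurable
    have "pvm_AE (PiM J M) PT (\<lambda>\<omega>. cmod (\<Phi> j (\<omega> j, s)) \<le> L j s)"
      unfolding pvm_AE_def
    proof (intro bexI conjI)
      show "PT (PiE J (\<lambda>i. if i = j then N else space (M i))) = zero_op"
        using L(2)[OF j s] by (intro tensor_pvm_slice_null[OF PT J j P N]) (simp_all add: N_def)
      show "{\<omega> \<in> space (PiM J M). \<not> cmod (\<Phi> j (\<omega> j, s)) \<le> L j s} \<subseteq> PiE J (\<lambda>i. if i = j then N else space (M i))"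
        using j by (auto simp: space_PiM PiE_iff N_def extensional_def)
      show "PiE J (\<lambda>i. if i = j then N else space (M i)) \<in> sets (PiM J M)"
        using J N by (intro sets_PiM_I_finite) auto
    qed
    then show "AE \<omega> in ?m. cmod (\<Phi> j (\<omega> j, s)) \<le> L j s"
      using ac by (intro AE_jordan[OF \<kappa> tensor_pvm_facts(1)[OF PT]])
  qed
  then show "s \<in> space \<rho> \<Longrightarrow> AE \<omega> in ?m. \<forall>j\<in>J. cmod (\<Phi> j (\<omega> j, s)) \<le> Linf_norm (M j) (P j) (\<lambda>x. \<Phi> j (x, s))"
    unfolding L_def .
  have meas: "(\<lambda>(\<omega>, s). \<Psi> J \<omega> s) \<in> borel_measurable (PiM J M \<Otimes>\<^sub>M \<rho>)"
    unfolding \<Psi>_def by (rule decomposition_prod_measurable[OF J \<Phi>])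
  have meas'[measurable]: "(\<lambda>(\<omega>, s). \<Psi> J \<omega> s) \<in> borel_measurable (?m \<Otimes>\<^sub>M \<rho>)"
    using meas measurable_cong_sets[OF sets_pair_measure_cong[OF sets_jordan[of "PiM J M" \<kappa> i] refl[of "sets \<rho>"]] refl] by blast
  have le_g: "AE s in \<rho>. AE \<omega> in ?m. ennreal (cmod (\<Psi> J \<omega> s)) \<le> g s"
    using g(3) AE_space
  proof eventually_elim
    case (elim s)
    show ?case
      using bound[OF elim(2)]
    proof eventually_elim
      case (elim \<omega>)
      have "cmod (\<Psi> J \<omega> s) \<le> (\<Prod>j\<in>J. L j s)"
        unfolding \<Psi>_def prod_norm[symmetric] using elim by (intro prod_mono) auto
      then have "ennreal (cmod (\<Psi> J \<omega> s)) \<le> ennreal (\<Prod>j\<in>J. L j s)" by (rule ennreal_leI)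
      also have "\<dots> = (\<Prod>j\<in>J. ennreal (L j s))"
        using L(1) \<open>s \<in> space \<rho>\<close> by (intro prod_ennreal[symmetric]) auto
      also have "\<dots> \<le> g s" using \<open>(\<Prod>j\<in>J. ennreal (Linf_norm (M j) (P j) (\<lambda>x. \<Phi> j (x, s)))) \<le> g s\<close>
        by (simp add: L_def)
      finally show ?case .
    qed
  qed
  show "integrable (?m \<Otimes>\<^sub>M \<rho>) (\<lambda>(\<omega>, s). \<Psi> J \<omega> s)"
  proof (rule integrableI_bounded[OF meas'])
    have "(\<integral>\<^sup>+p. ennreal (cmod (case p of (\<omega>, s) \<Rightarrow> \<Psi> J \<omega> s)) \<partial>(?m \<Otimes>\<^sub>M \<rho>)) =
      (\<integral>\<^sup>+s. \<integral>\<^sup>+\<omega>. ennreal (cmod (\<Psi> J \<omega> s)) \<partial>?m \<partial>\<rho>)"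
      by (subst nn_integral_snd[symmetric]) simp_all
    also have "\<dots> \<le> (\<integral>\<^sup>+s. g s * emeasure ?m (space ?m) \<partial>\<rho>)"
    proof (rule nn_integral_mono_AE)
      show "AE s in \<rho>. (\<integral>\<^sup>+\<omega>. ennreal (cmod (\<Psi> J \<omega> s)) \<partial>?m) \<le> g s * emeasure ?m (space ?m)"
        using le_g
      proof eventually_elim
        case (elim s)
        then have "(\<integral>\<^sup>+\<omega>. ennreal (cmod (\<Psi> J \<omega> s)) \<partial>?m) \<le> (\<integral>\<^sup>+\<omega>. g s \<partial>?m)" by (rule nn_integral_mono_AE)
        then show ?case by simp
      qed
    qed
    also have "\<dots> = (\<integral>\<^sup>+s. g s \<partial>\<rho>) * emeasure ?m (space ?m)" by (rule nn_integral_multc[OF g(1)])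
    also have "\<dots> < \<infinity>" using g(2) by (simp add: ennreal_mult_less_top m.emeasure_eq_measure)
    finally show "(\<integral>\<^sup>+p. ennreal (cmod (case p of (\<omega>, s) \<Rightarrow> \<Psi> J \<omega> s)) \<partial>(?m \<Otimes>\<^sub>M \<rho>)) < \<infinity>" .
  qed
  \<comment> \<open>In \<open>le_g\<close> the exceptional set of points depends on
    \<open>s\<close>. Since the inequality defines a measurable set of pairs, the quantifiers may be
    exchanged.\<close>
  have "AE \<omega> in ?m. AE s in \<rho>. ennreal (cmod (\<Psi> J \<omega> s)) \<le> g s"
  proof (subst AE_commute)
    have [measurable]: "g \<in> borel_measurable \<rho>" by (rule g(1))
    have [measurable]: "(\<lambda>p. \<Psi> J (fst p) (snd p)) \<in> borel_measurable (?m \<Otimes>\<^sub>M \<rho>)"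
      using meas' by (simp add: case_prod_beta)
    show "{p \<in> space (?m \<Otimes>\<^sub>M \<rho>). ennreal (cmod (\<Psi> J (fst p) (snd p))) \<le> g (snd p)} \<in> sets (?m \<Otimes>\<^sub>M \<rho>)"
      by measurable
  qed (rule le_g)
  then show "AE \<omega> in ?m. cmod (\<integral>s. \<Psi> J \<omega> s \<partial>\<rho>) \<le> enn2real (\<integral>\<^sup>+s. g s \<partial>\<rho>)"
  proof eventually_elim
    case (elim \<omega>)
    show ?case
    proof (cases "integrable \<rho> (\<Psi> J \<omega>)")
      case True
      have "ennreal (cmod (\<integral>s. \<Psi> J \<omega> s \<partial>\<rho>)) \<le> (\<integral>\<^sup>+s. ennreal (cmod (\<Psi> J \<omega> s)) \<partial>\<rho>)"
        by (rule integral_norm_bound_ennreal[OF True])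
      also have "\<dots> \<le> (\<integral>\<^sup>+s. g s \<partial>\<rho>)" using elim by (rule nn_integral_mono_AE)
      also have "\<dots> = ennreal (enn2real (\<integral>\<^sup>+s. g s \<partial>\<rho>))" using g(2) by simp
      finally show ?thesis by (simp add: ennreal_le_iff)
    \<comment> \<open>A slice that is not integrable has integral 0 by convention and satisfies the
      bound trivially.\<close>
    qed (simp add: not_integrable_integral_eq)
  qed
qed

theorem theorem4p4p3:
  fixes k :: nat
    and M :: "nat \<Rightarrow> 'w measure"
    and H :: "nat \<Rightarrow> 'a::complex_inner set"
    and P :: "nat \<Rightarrow> 'w set \<Rightarrow> 'a \<Rightarrow> 'a"
    and T :: "'t::complex_inner set"
    and \<tau> :: "(nat \<Rightarrow> 'a) \<Rightarrow> 't"
    and PT :: "(nat \<Rightarrow> 'w) set \<Rightarrow> 't \<Rightarrow> 't"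
    and \<phi> :: "(nat \<Rightarrow> 'w) \<Rightarrow> complex"
    and \<rho> :: "'s measure"
    and \<Phi> :: "nat \<Rightarrow> 'w \<times> 's \<Rightarrow> complex"
    and b :: "nat \<Rightarrow> 'a \<Rightarrow> 'a"
    and \<mu> :: "(nat \<Rightarrow> 'w) set \<Rightarrow> 'a \<Rightarrow> 'a"
  assumes "k \<ge> 1"
    and "\<And>j. j \<in> {1..k+1} \<Longrightarrow> pvm_space (M j) (H j) (P j)"
    and "tensor_pvm {1..k+1} M H P T \<tau> PT"
    and "integral_decomposition {1..k+1} M P PT \<phi> \<rho> \<Phi>"
    and "\<And>j. j \<in> {1..k} \<Longrightarrow> b j \<in> hilbert_schmidt (H (j + 1)) (H j)"
    and "is_sharp k M H P b \<mu>"
  shows "multiple_op_integral k M H P \<rho> \<Phi> b =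
         vector_integral (PiM {1..k+1} M) PT (H (k + 1)) (H 1) \<mu> \<phi>"
proof -
  define J where "J = {1..k+1}"
  have J: "finite J" "1 \<in> J" "k + 1 \<in> J" by (simp_all add: J_def)
  let ?\<Omega> = "PiM J M"
  note P = assms(2)[folded J_def] and PT = assms(3)[folded J_def] and b = assms(5)
  note facts = tensor_pvm_facts[OF PT]
  have dec: "sigma_finite_measure \<rho>" "\<And>j. j \<in> J \<Longrightarrow> \<Phi> j \<in> borel_measurable (M j \<Otimes>\<^sub>M \<rho>)"
    "\<And>j s. j \<in> J \<Longrightarrow> s \<in> space \<rho> \<Longrightarrow> (\<lambda>x. \<Phi> j (x, s)) \<in> Linf (M j) (P j)"
    "upper_nn_integral \<rho> (\<lambda>s. \<Prod>j\<in>J. ennreal (Linf_norm (M j) (P j) (\<lambda>x. \<Phi> j (x, s)))) < \<infinity>"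
    "pvm_AE ?\<Omega> PT (\<lambda>x. \<phi> x = (\<integral>s. (\<Prod>j\<in>J. \<Phi> j (x j, s)) \<partial>\<rho>))"
    using assms(4) unfolding integral_decomposition_def J_def by auto
  have \<mu>: "hs_vector_measure ?\<Omega> (H (k + 1)) (H 1) \<mu>" "semivariation ?\<Omega> (H (k + 1)) (H 1) \<mu> < \<infinity>"
    and rect: "\<And>G. G \<in> (\<Pi> j\<in>J. sets (M j)) \<Longrightarrow> \<mu> (PiE J G) = op_chain k (\<lambda>j. P j (G j)) b"
    using assms(6) unfolding is_sharp_def J_def by auto
  note H1 = pvm_spaceD(1,2)[OF P[OF J(2)]] and Hk = pvm_spaceD(1,2)[OF P[OF J(3)]]
  \<comment> \<open>The product of the essential norms is not assumed measurable in
    \<open>s\<close>; finiteness of its upper integral supplies a measurable majorant.\<close>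
  obtain g where g: "g \<in> borel_measurable \<rho>" "(\<integral>\<^sup>+s. g s \<partial>\<rho>) < \<infinity>"
    "AE s in \<rho>. (\<Prod>j\<in>J. ennreal (Linf_norm (M j) (P j) (\<lambda>x. \<Phi> j (x, s)))) \<le> g s"
    using dec(4) unfolding upper_nn_integral_def INF_less_iff by auto
  have est: "s \<in> space \<rho> \<Longrightarrow> AE \<omega> in jordan ?\<Omega> \<kappa> i. \<forall>j\<in>J. cmod (\<Phi> j (\<omega> j, s)) \<le> Linf_norm (M j) (P j) (\<lambda>x. \<Phi> j (x, s))"
      "integrable (jordan ?\<Omega> \<kappa> i \<Otimes>\<^sub>M \<rho>) (\<lambda>(\<omega>, s). \<Prod>j\<in>J. \<Phi> j (\<omega> j, s))"
      "AE \<omega> in jordan ?\<Omega> \<kappa> i. cmod (\<integral>s. (\<Prod>j\<in>J. \<Phi> j (\<omega> j, s)) \<partial>\<rho>) \<le> enn2real (\<integral>\<^sup>+s. g s \<partial>\<rho>)"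
    if "cmeas ?\<Omega> \<kappa>" "\<forall>N\<in>sets ?\<Omega>. PT N = zero_op \<longrightarrow> \<kappa> N = 0" for \<kappa> i s
    by (rule decomposition_estimates[OF PT J(1) P dec(1-3) g that(1)]; use that(2) in simp)+
  define \<psi> where "\<psi> \<omega> = (\<integral>s. (\<Prod>j\<in>J. \<Phi> j (\<omega> j, s)) \<partial>\<rho>)" for \<omega>
  interpret \<rho>: sigma_finite_measure \<rho> by (rule dec(1))
  have \<psi>m[measurable]: "\<psi> \<in> borel_measurable ?\<Omega>"
    unfolding \<psi>_def[abs_def]
    by (rule \<rho>.borel_measurable_lebesgue_integral) (rule decomposition_prod_measurable[OF J(1) dec(2)])
  define c where "c = enn2real (\<integral>\<^sup>+s. g s \<partial>\<rho>)"
  have c: "c \<ge> 0" by (simp add: c_def)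
  \<comment> \<open>The essential bound is tested on the measures \<open>cinner (PT G x) x\<close>:
    their Jordan parts give the set measure 0, which forces the projection to vanish.\<close>
  have \<psi>_null: "PT {\<omega> \<in> space ?\<Omega>. cmod (\<psi> \<omega>) > c} = zero_op"
  proof (rule pvm_zero_opI[OF facts(1)])
    show N: "{\<omega> \<in> space ?\<Omega>. cmod (\<psi> \<omega>) > c} \<in> sets ?\<Omega>" by measurable
    fix x assume x: "x \<in> T"
    define \<kappa> where "\<kappa> G = cinner (PT G x) x" for G
    have \<kappa>: "cmeas ?\<Omega> \<kappa>" unfolding \<kappa>_def[abs_def] by (rule cmeas_pvm[OF facts(1) x x])
    have "measure (jordan ?\<Omega> \<kappa> i) {\<omega> \<in> space ?\<Omega>. cmod (\<psi> \<omega>) > c} = 0" for i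
    proof -
      have "AE \<omega> in jordan ?\<Omega> \<kappa> i. cmod (\<psi> \<omega>) \<le> c"
        unfolding \<psi>_def c_def by (rule est(3)[OF \<kappa>]) (simp add: \<kappa>_def zero_op_def)
      then have "AE \<omega> in jordan ?\<Omega> \<kappa> i. \<omega> \<notin> {\<omega> \<in> space ?\<Omega>. cmod (\<psi> \<omega>) > c}"
        by eventually_elim auto
      then have "{\<omega> \<in> space ?\<Omega>. cmod (\<psi> \<omega>) > c} \<in> null_sets (jordan ?\<Omega> \<kappa> i)"
        using N by (subst AE_iff_null_sets) auto
      then show ?thesis by (simp add: null_sets_def measure_def)
    qed
    then have "\<kappa> {\<omega> \<in> space ?\<Omega>. cmod (\<psi> \<omega>) > c} = 0" by (simp add: jordan_decomposition[OF \<kappa> N])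
    then show "cinner (PT {\<omega> \<in> space ?\<Omega>. cmod (\<psi> \<omega>) > c} x) x = 0" by (simp add: \<kappa>_def)
  qed
  \<comment> \<open>A witness for the choice made in \<open>vector_integral\<close>; later only the
    chosen function's defining properties are used.\<close>
  have "\<exists>f. f \<in> borel_measurable ?\<Omega> \<and> bounded (f ` space ?\<Omega>) \<and> pvm_AE ?\<Omega> PT (\<lambda>x. f x = \<phi> x)"
  proof (intro exI conjI)
    show "truncate c \<psi> \<in> borel_measurable ?\<Omega>" by (rule truncate_measurable[OF \<psi>m])
    show "bounded (truncate c \<psi> ` space ?\<Omega>)"
      unfolding bounded_iff using cmod_truncate[OF c, of \<psi>] by (intro exI[of _ c]) auto
    obtain N where N: "N \<in> sets ?\<Omega>" "PT N = zero_op" "{x \<in> space ?\<Omega>. \<phi> x \<noteq> \<psi> x} \<subseteq> N"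
      using dec(5) unfolding pvm_AE_def \<psi>_def by blast
    \<comment> \<open>Index 0 collects the points where \<open>\<phi>\<close> and
      \<open>\<psi>\<close> differ, every other index the points where the truncation changes
      \<open>\<psi>\<close>; two null sets are thus presented as a sequence.\<close>
    define A where "A n = (if n = 0 then N else {\<omega> \<in> space ?\<Omega>. cmod (\<psi> \<omega>) > c})" for n :: nat
    have As: "A n \<in> sets ?\<Omega>" for n using N(1) by (auto simp: A_def)
    have "PT (\<Union>n. A n) = zero_op"
      by (rule pvm_zero_op_UN[OF facts(1) As]) (simp add: A_def N \<psi>_null)
    moreover have "{x \<in> space ?\<Omega>. truncate c \<psi> x \<noteq> \<phi> x} \<subseteq> (\<Union>n. A n)"
    proof
      fix x assume x: "x \<in> {x \<in> space ?\<Omega>. truncate c \<psi> x \<noteq> \<phi> x}"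
      then have "x \<in> A 0 \<or> x \<in> A 1" using N(3) by (auto simp: A_def truncate_def split: if_splits)
      then show "x \<in> (\<Union>n. A n)" by blast
    qed
    ultimately show "pvm_AE ?\<Omega> PT (\<lambda>x. truncate c \<psi> x = \<phi> x)"
      unfolding pvm_AE_def using As by blast
  qed
  note some_f = someI_ex[OF this]
  define f where "f = (SOME f. f \<in> borel_measurable ?\<Omega> \<and> bounded (f ` space ?\<Omega>) \<and> pvm_AE ?\<Omega> PT (\<lambda>x. f x = \<phi> x))"
  have f: "f \<in> borel_measurable ?\<Omega>" and f_bd: "bounded (f ` space ?\<Omega>)" and f_ae: "pvm_AE ?\<Omega> PT (\<lambda>x. f x = \<phi> x)"
    using some_f unfolding f_def by simp_all
  obtain d where d: "\<And>x. x \<in> space ?\<Omega> \<Longrightarrow> cmod (f x) \<le> d" using f_bd unfolding bounded_iff by blast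
  define S where "S = bounded_vector_integral ?\<Omega> (H (k + 1)) (H 1) \<mu> f"
  have S: "S \<in> bounded_ops (H (k + 1)) (H 1)"
    "h \<in> H (k + 1) \<Longrightarrow> h' \<in> H 1 \<Longrightarrow> cinner (S h) h' = cint ?\<Omega> (\<lambda>G. cinner (\<mu> G h) h') f" for h h'
    unfolding S_def using bounded_vector_integral[OF \<mu> Hk(1) H1(1) f d] by simp_all
  define F where "F s = op_chain k (\<lambda>j. pvm_integral (M j) (H j) (P j) (\<lambda>x. \<Phi> j (x, s))) b" for s
  \<comment> \<open>Integrability is included because the property that defines
    \<open>weak_op_integral\<close> demands it along with the value.\<close>
  have main: "integrable \<rho> (\<lambda>s. cinner (F s h) h') \<and> cinner (S h) h' = (\<integral>s. cinner (F s h) h' \<partial>\<rho>)"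
    if h: "h \<in> H (k + 1)" "h' \<in> H 1" for h h'
  proof -
    define \<nu> where "\<nu> G = cinner (\<mu> G h) h'" for G
    have \<nu>: "cmeas ?\<Omega> \<nu>"
      unfolding \<nu>_def[abs_def] by (rule cmeas_hs_vector_measure[OF \<mu> Hk(1) H1(2) h])
    have \<nu>_rect: "\<nu> (PiE J G) = cinner (op_chain k (\<lambda>j. P j (G j)) b h) h'" if "G \<in> (\<Pi> j\<in>J. sets (M j))" for G
      by (simp add: \<nu>_def rect[OF that])
    have ac: "\<nu> N = 0" if "N \<in> sets ?\<Omega>" "PT N = zero_op" for N
      using sharp_absolutely_continuous[where k=k and M=M and H=H and P=P and b=b and h=h and h'=h' and \<nu>=\<nu>,
        folded J_def, OF P PT b h \<nu> \<nu>_rect that] .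
    have ac': "\<forall>N\<in>sets ?\<Omega>. PT N = zero_op \<longrightarrow> \<nu> N = 0" using ac by blast
    note est\<nu> = est[OF \<nu> ac']
    let ?m = "jordan ?\<Omega> \<nu>"
    let ?\<Psi> = "\<lambda>\<omega> s. \<Prod>j\<in>J. \<Phi> j (\<omega> j, s)"
    have Fs: "cinner (F s h) h' = cint ?\<Omega> \<nu> (\<lambda>\<omega>. ?\<Psi> \<omega> s)" if s: "s \<in> space \<rho>" for s
    proof -
      \<comment> \<open>The value 0 off \<open>J\<close> provides the nonnegativity that
        \<open>op_chain_cint\<close> asks of all indices.\<close>
      define L where "L j = (if j \<in> J then Linf_norm (M j) (P j) (\<lambda>x. \<Phi> j (x, s)) else 0)" for j
      define q where "q j = truncate (L j) (\<lambda>x. \<Phi> j (x, s))" for j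
      have \<Phi>m: "(\<lambda>x. \<Phi> j (x, s)) \<in> borel_measurable (M j)" if "j \<in> J" for j
        using dec(3)[OF that s] by (simp add: Linf_def)
      have L: "L j \<ge> 0" for j using Linf_norm(1)[OF P dec(3)] s by (simp add: L_def)
      have LN: "P j {x \<in> space (M j). cmod (\<Phi> j (x, s)) > L j} = zero_op" if "j \<in> J" for j
        using Linf_norm(2)[OF P dec(3)] s that by (simp add: L_def)
      have qm: "q j \<in> borel_measurable (M j)" if "j \<in> J" for j
        unfolding q_def by (rule truncate_measurable[OF \<Phi>m[OF that]])
      have "cinner (F s h) h' = cint ?\<Omega> \<nu> (\<lambda>\<omega>. \<Prod>j\<in>J. q j (\<omega> j))"
        unfolding F_def J_def
      proof (rule op_chain_cint[where M=M and H=H and P=P and c=L])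
        show "b j \<in> bounded_ops (H (j + 1)) (H j)" if "j \<in> {1..k}" for j
          by (rule hilbert_schmidt_bounded_ops[OF b[OF that]])
        show "cmod (q j x) \<le> L j" for j x unfolding q_def by (rule cmod_truncate[OF L])
        show "cinner (pvm_integral (M j) (H j) (P j) (\<lambda>x. \<Phi> j (x, s)) x) y =
            cint (M j) (\<lambda>G. cinner (P j G x) y) (q j)"
          if "j \<in> {1..k+1}" "x \<in> H j" "y \<in> H j" for j x y
          unfolding q_def using that
          by (intro pvm_integral_eq(2)[OF P \<Phi>m L LN]) (simp_all add: J_def)
        show "pvm_integral (M j) (H j) (P j) (\<lambda>x. \<Phi> j (x, s)) \<in> bounded_ops (H j) (H j)"
          if "j \<in> {1..k+1}" for j
          using that by (intro pvm_integral_eq(1)[OF P \<Phi>m L LN]) (simp_all add: J_def)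
      qed (use P h \<nu> \<nu>_rect qm L in \<open>simp_all add: J_def\<close>)
      \<comment> \<open>For fixed \<open>s\<close> the essential bounds hold almost everywhere for
        each Jordan part of \<open>\<nu>\<close>, so there the truncations change nothing.\<close>
      also have "\<dots> = cint ?\<Omega> \<nu> (\<lambda>\<omega>. ?\<Psi> \<omega> s)"
      proof (rule cint_AE_cong)
        show "(\<lambda>\<omega>. \<Prod>j\<in>J. q j (\<omega> j)) \<in> borel_measurable ?\<Omega>"
        proof (rule borel_measurable_prod)
          fix j assume j: "j \<in> J"
          show "(\<lambda>\<omega>. q j (\<omega> j)) \<in> borel_measurable ?\<Omega>"
            by (rule measurable_compose[where f="\<lambda>\<omega>. \<omega> j", OF measurable_component_singleton[where M=M, OF j] qm[OF j]])
        qed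
        show "(\<lambda>\<omega>. ?\<Psi> \<omega> s) \<in> borel_measurable ?\<Omega>"
        proof (rule borel_measurable_prod)
          fix j assume j: "j \<in> J"
          show "(\<lambda>\<omega>. \<Phi> j (\<omega> j, s)) \<in> borel_measurable ?\<Omega>"
            by (rule measurable_compose[where f="\<lambda>\<omega>. \<omega> j", OF measurable_component_singleton[where M=M, OF j] \<Phi>m[OF j]])
        qed
        fix i
        show "AE \<omega> in ?m i. (\<Prod>j\<in>J. q j (\<omega> j)) = ?\<Psi> \<omega> s"
          using est\<nu>(1)[OF s, of i]
        proof eventually_elim
          case (elim \<omega>)
          then show ?case by (intro prod.cong) (auto simp: q_def truncate_def L_def)
        qed
      qed
      finally show ?thesis .
    qed
    have fub: "integrable \<rho> (\<lambda>s. \<integral>\<omega>. ?\<Psi> \<omega> s \<partial>?m i) \<and>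
        (\<integral>s. (\<integral>\<omega>. ?\<Psi> \<omega> s \<partial>?m i) \<partial>\<rho>) = (\<integral>\<omega>. \<psi> \<omega> \<partial>?m i)" for i
    proof -
      interpret m: finite_measure "?m i" by (rule finite_measure_jordan[OF \<nu>])
      interpret pair_sigma_finite "?m i" \<rho> ..
      have int: "integrable (?m i \<Otimes>\<^sub>M \<rho>) (\<lambda>(\<omega>, s). ?\<Psi> \<omega> s)" by (rule est\<nu>(2))
      show ?thesis unfolding \<psi>_def using integrable_snd[OF int] Fubini_integral[OF int] by simp
    qed
    have cint_eq: "cint ?\<Omega> \<nu> (\<lambda>\<omega>. ?\<Psi> \<omega> s) = (\<Sum>i<4. \<i> ^ i * (\<integral>\<omega>. ?\<Psi> \<omega> s \<partial>?m i))" for s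
      by (simp add: cint_def)
    have "integrable \<rho> (\<lambda>s. cint ?\<Omega> \<nu> (\<lambda>\<omega>. ?\<Psi> \<omega> s))"
      unfolding cint_eq using fub by (intro Bochner_Integration.integrable_sum integrable_mult_right) auto
    then have int: "integrable \<rho> (\<lambda>s. cinner (F s h) h')"
      using Fs by (subst Bochner_Integration.integrable_cong[OF refl]) auto
    have "cinner (S h) h' = cint ?\<Omega> \<nu> f" unfolding \<nu>_def[abs_def] by (rule S(2)[OF h])
    also have "\<dots> = cint ?\<Omega> \<nu> \<psi>"
    proof (rule cint_AE_cong[OF f \<psi>m])
      fix i
      have "AE x in ?m i. f x = \<phi> x" "AE x in ?m i. \<phi> x = \<psi> x"
        using AE_jordan[OF \<nu> facts(1) ac f_ae] AE_jordan[OF \<nu> facts(1) ac dec(5)] by (simp_all add: \<psi>_def)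
      then show "AE x in ?m i. f x = \<psi> x" by eventually_elim simp
    qed
    also have "\<dots> = (\<Sum>i<4. \<i> ^ i * (\<integral>s. (\<integral>\<omega>. ?\<Psi> \<omega> s \<partial>?m i) \<partial>\<rho>))" using fub by (simp add: cint_def)
    also have "\<dots> = (\<integral>s. cint ?\<Omega> \<nu> (\<lambda>\<omega>. ?\<Psi> \<omega> s) \<partial>\<rho>)"
      unfolding cint_eq using fub by (subst Bochner_Integration.integral_sum) auto
    also have "\<dots> = (\<integral>s. cinner (F s h) h' \<partial>\<rho>)"
      using Fs by (intro Bochner_Integration.integral_cong) auto
    finally show ?thesis using int by simp
  qed
  have "multiple_op_integral k M H P \<rho> \<Phi> b = S"
    unfolding multiple_op_integral_def weak_op_integral_def F_def[symmetric]
  proof (rule the_equality)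
    show "S \<in> bounded_ops (H (k + 1)) (H 1) \<and> (\<forall>h\<in>H (k + 1). \<forall>h'\<in>H 1. integrable \<rho> (\<lambda>s. cinner (F s h) h') \<and>
        cinner (S h) h' = (\<integral>s. cinner (F s h) h' \<partial>\<rho>))"
      using S(1) main by blast
    fix R assume R: "R \<in> bounded_ops (H (k + 1)) (H 1) \<and> (\<forall>h\<in>H (k + 1). \<forall>h'\<in>H 1. integrable \<rho> (\<lambda>s. cinner (F s h) h') \<and>
        cinner (R h) h' = (\<integral>s. cinner (F s h) h' \<partial>\<rho>))"
    then show "R = S" using S(1) main by (intro bounded_ops_eqI[OF H1(2)]) auto
  qed
  also have "S = vector_integral ?\<Omega> PT (H (k + 1)) (H 1) \<mu> \<phi>"
    unfolding vector_integral_def S_def f_def ..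
  finally show ?thesis unfolding J_def .
qed

end
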